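(* Let $d=3$, let $(\boldsymbol v,C)$ be an admissible generalised medium, $A=C-\boldsymbol v\boldsymbol v^{\mathrm T}$, $p=(1+\boldsymbol v^{\mathrm T}A^{-1}\boldsymbol v)^{-1/2}$, let $\omega>0$, and let $p_\omega$ be the outgoing (limiting-absorption, $\omega\to\omega+\mathrm i0$) solution of $P_{Q(\boldsymbol v,C)}\bigl(p_\omega e^{-\mathrm i\omega t}\bigr)=s\,e^{-\mathrm i\omega t}$ with $s=s(\boldsymbol x)$ compactly supported. For a unit vector $\boldsymbol n$ put $\boldsymbol\nu=\boldsymbol n/\sqrt{\boldsymbol n^{\mathrm T}A^{-1}\boldsymbol n}$ and $$\boldsymbol k_*(\boldsymbol n,\omega)=\omega A^{-1}\Bigl(\frac{\boldsymbol\nu}{p}-\boldsymbol v\Bigr),\qquad\text{so that}\qquad \boldsymbol k_*\cdot\boldsymbol n=\omega\Bigl(\frac{\sqrt{\boldsymbol n^{\mathrm T}A^{-1}\boldsymbol n}}{p}-\boldsymbol v^{\mathrm T}A^{-1}\boldsymbol n\Bigr).$$ Then, as $r\to\infty$ along fixed $\boldsymbol n$, $$p_\omega(r\boldsymbol n)=\frac{\hat s(\boldsymbol k_*(\boldsymbol n,\omega))\,e^{\mathrm i(\boldsymbol k_*\cdot\boldsymbol n)r}}{4\pi r\,\sqrt{\det A}\,\sqrt{\boldsymbol n^{\mathrm T}A^{-1}\boldsymbol n}}+O(r^{-2}).$$ Moreover $\boldsymbol k_*$ is the unique wavevector on the outgoing sonic ellipsoid $$E_\omega:\quad \boldsymbol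 k^{\mathrm T}A\boldsymbol k+2\omega\,\boldsymbol v\cdot\boldsymbol k=\omega^2,\qquad\text{equivalently}\quad \omega-\boldsymbol v\cdot\boldsymbol k=+\sqrt{\boldsymbol k^{\mathrm T}C\boldsymbol k},$$ whose group velocity $\boldsymbol v_g(\boldsymbol k)=\boldsymbol v+C\boldsymbol k/\sqrt{\boldsymbol k^{\mathrm T}C\boldsymbol k}$ is positively parallel to $\boldsymbol n$; and the group speed is $|\boldsymbol v_g(\boldsymbol k_* )|=\bigl[\sqrt{\boldsymbol n^{\mathrm T}A^{-1}\boldsymbol n}\;\mu\bigr]^{-1}$ with $\mu=1/p-\boldsymbol v^{\mathrm T}A^{-1}\boldsymbol\nu>0$.
   Context: A pair $(\boldsymbol v,C)$ with $\boldsymbol v\in\mathbb R^3$ and $C$ a real symmetric $3\times3$ matrix is an admissible generalised medium if $A=C-\boldsymbol v\boldsymbol v^{\mathrm T}$ is positive definite. Its operator is $P_{Q(\boldsymbol v,C)}=\sum_{a,b=0}^3Q^{ab}\partial_a\partial_b$ (index $0$ for $t$, $1,2,3$ for $\boldsymbol x$) with $Q(\boldsymbol v,C)=\begin{pmatrix}1&\boldsymbol v^{\mathrm T}\\ \boldsymbol v&\boldsymbol v\boldsymbol v^{\mathrm T}-C\end{pmatrix}$, i.e. $(\partial_t+\boldsymbol v\cdot\nabla)^2-\nabla\cdot C\nabla$. Fourier convention: $\hat s(\boldsymbol k)=\int s(\boldsymbol x)e^{-\mathrm i\boldsymbol k\cdot\boldsymbol x}\,d\boldsymbol x$. The outgoing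 solution is $p_\omega(\boldsymbol x)=\int\frac{\hat s(\boldsymbol k)e^{\mathrm i\boldsymbol k\cdot\boldsymbol x}}{\boldsymbol k^{\mathrm T}C\boldsymbol k-(\omega-\boldsymbol v\cdot\boldsymbol k)^2}\frac{d^3\boldsymbol k}{(2\pi)^3}$ understood as the limit of the same expression with $\omega$ replaced by $\omega+\mathrm i\epsilon$, $\epsilon\downarrow0$. Here $p$ (a positive number) and $p_\omega$ (the field) are different objects. *)

theory Defs
  imports "HOL-Analysis.Analysis" "HOL-Library.Landau_Symbols"
begin

definition pos_def :: "real^'n^'n \<Rightarrow> bool" where
  "pos_def M \<longleftrightarrow> transpose M = M \<and> (\<forall>x. x \<noteq> 0 \<longrightarrow> x \<bullet> (M *v x) > 0)"

text \<open>The product of a column vector and a row vector is the rank-one matrix $v v^T$.\<close>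

definition medium_matrix :: "real^3 \<Rightarrow> real^3^3 \<Rightarrow> real^3^3" where
  "medium_matrix v C = C - (columnvector v :: real^1^3) ** rowvector v"

definition admissible :: "real^3 \<Rightarrow> real^3^3 \<Rightarrow> bool" where
  "admissible v C \<longleftrightarrow> transpose C = C \<and> pos_def (medium_matrix v C)"

text \<open>Space-time is \<^typ>\<open>real \<times> (real^3)\<close>. Its four indices are the elements of the type
  \<^typ>\<open>3 option\<close>: \<^term>\<open>None\<close> is the time index $0$, and \<^term>\<open>Some j\<close> is the space index $j$.\<close>

definition st_axis :: "3 option \<Rightarrow> real \<times> (real^3)" where
  "st_axis a = (case a of None \<Rightarrow> (1, 0) | Some j \<Rightarrow> (0, axis j 1))"

definition medium_form :: "real^3 \<Rightarrow> real^3^3 \<Rightarrow> real^(3 option)^(3 option)" where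
  "medium_form v C = (\<chi> a b.
     case a of
       None \<Rightarrow> (case b of None \<Rightarrow> 1 | Some j \<Rightarrow> v $ j)
     | Some i \<Rightarrow> (case b of None \<Rightarrow> v $ i
                       | Some j \<Rightarrow> ((columnvector v :: real^1^3) ** rowvector v - C) $ i $ j))"

definition partial :: "3 option \<Rightarrow> (real \<times> (real^3) \<Rightarrow> complex) \<Rightarrow> real \<times> (real^3) \<Rightarrow> complex" where
  "partial a f X = vector_derivative (\<lambda>h. f (X + h *\<^sub>R st_axis a)) (at 0)"

definition wave_op ::
    "real^(3 option)^(3 option) \<Rightarrow> (real \<times> (real^3) \<Rightarrow> complex) \<Rightarrow> real \<times> (real^3) \<Rightarrow> complex" where
  "wave_op Q f X =
     (\<Sum>a\<in>UNIV. \<Sum>b\<in>UNIV. complex_of_real (Q $ a $ b) * partial a (partial b f) X)"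

text \<open>Being $C^k$ is expressed by existence and continuity of all iterated partial derivatives
  up to order $k$.\<close>

primrec Ck :: "nat \<Rightarrow> (real \<times> (real^3) \<Rightarrow> complex) \<Rightarrow> bool" where
  "Ck 0 f \<longleftrightarrow> continuous_on UNIV f"
| "Ck (Suc k) f \<longleftrightarrow> continuous_on UNIV f \<and>
     (\<forall>a. (\<forall>X. (\<lambda>h::real. f (X + h *\<^sub>R st_axis a)) differentiable at 0) \<and> Ck k (partial a f))"

definition test_function :: "(real \<times> (real^3) \<Rightarrow> complex) \<Rightarrow> bool" where
  "test_function \<phi> \<longleftrightarrow> (\<forall>k. Ck k \<phi>) \<and> compact (closure {X. \<phi> X \<noteq> 0})"

definition locally_integrable :: "(real \<times> (real^3) \<Rightarrow> complex) \<Rightarrow> bool" where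
  "locally_integrable f \<longleftrightarrow> (\<forall>K. compact K \<longrightarrow> set_integrable lborel K f)"

text \<open>The equation $P_Q u = f$ in the sense of distributions. An operator with constant
  coefficients and only second-order terms is its own formal transpose.\<close>

definition solves_wave_eq ::
    "real^(3 option)^(3 option) \<Rightarrow> (real \<times> (real^3) \<Rightarrow> complex) \<Rightarrow> (real \<times> (real^3) \<Rightarrow> complex) \<Rightarrow> bool" where
  "solves_wave_eq Q u f \<longleftrightarrow> locally_integrable u \<and> locally_integrable f \<and>
     (\<forall>\<phi>. test_function \<phi> \<longrightarrow>
        (LINT X|lborel. u X * wave_op Q \<phi> X) = (LINT X|lborel. f X * \<phi> X))"

definition time_harmonic :: "real \<Rightarrow> (real^3 \<Rightarrow> complex) \<Rightarrow> real \<times> (real^3) \<Rightarrow> complex" where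
  "time_harmonic \<omega> f X = f (snd X) * exp (- (\<i> * of_real \<omega> * of_real (fst X)))"

definition fourier :: "(real^3 \<Rightarrow> complex) \<Rightarrow> real^3 \<Rightarrow> complex" where
  "fourier s k = (LINT x|lborel. s x * exp (- (\<i> * of_real (k \<bullet> x))))"

definition field_integrand ::
    "real^3 \<Rightarrow> real^3^3 \<Rightarrow> complex \<Rightarrow> (real^3 \<Rightarrow> complex) \<Rightarrow> real^3 \<Rightarrow> real^3 \<Rightarrow> complex" where
  "field_integrand v C z s x k =
     fourier s k * exp (\<i> * of_real (k \<bullet> x))
       / (of_real (k \<bullet> (C *v k)) - (z - of_real (v \<bullet> k))\<^sup>2) / of_real ((2 * pi) ^ 3)"

definition field_at ::
    "real^3 \<Rightarrow> real^3^3 \<Rightarrow> complex \<Rightarrow> (real^3 \<Rightarrow> complex) \<Rightarrow> real^3 \<Rightarrow> complex" where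
  "field_at v C z s x = (LINT k|lborel. field_integrand v C z s x k)"

text \<open>Limiting absorption, with the limit taken pointwise in $x$.\<close>

definition outgoing_field ::
    "real^3 \<Rightarrow> real^3^3 \<Rightarrow> real \<Rightarrow> (real^3 \<Rightarrow> complex) \<Rightarrow> real^3 \<Rightarrow> complex" where
  "outgoing_field v C \<omega> s x =
     Lim (at_right 0) (\<lambda>\<epsilon>::real. field_at v C (of_real \<omega> + \<i> * of_real \<epsilon>) s x)"

definition sonic_ellipsoid :: "real^3 \<Rightarrow> real^3^3 \<Rightarrow> real \<Rightarrow> (real^3) set" where
  "sonic_ellipsoid v C \<omega> = {k. k \<bullet> (medium_matrix v C *v k) + 2 * \<omega> * (v \<bullet> k) = \<omega>\<^sup>2}"

definition group_velocity :: "real^3 \<Rightarrow> real^3^3 \<Rightarrow> real^3 \<Rightarrow> real^3" where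
  "group_velocity v C k = v + (1 / sqrt (k \<bullet> (C *v k))) *\<^sub>R (C *v k)"

text \<open>The denominator in \<^term>\<open>field_integrand\<close> is the symbol of the wave operator at complex
  frequency $z$ and wavevector $k$.\<close>

lemma sum_3_option: "(\<Sum>a\<in>UNIV. f a) = f None + (\<Sum>j\<in>UNIV. f (Some (j::3)))"
proof -
  have "(\<Sum>a\<in>insert None (range Some). f a) = f None + (\<Sum>a\<in>range Some. f a)"
    by (subst sum.insert) auto
  then show ?thesis
    by (simp add: UNIV_option_conv sum.reindex)
qed

lemma partial_plane_wave:
  fixes k :: "real^3" and z c :: complex
  shows "partial a (\<lambda>X. c * exp (\<i> * (of_real (k \<bullet> snd X) - z * of_real (fst X)))) =
    (\<lambda>X. (c * (case a of None \<Rightarrow> - (\<i> * z) | Some j \<Rightarrow> \<i> * of_real (k $ j)))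
      * exp (\<i> * (of_real (k \<bullet> snd X) - z * of_real (fst X))))"
proof
  fix X :: "real \<times> (real^3)"
  define l :: complex where "l = (case a of None \<Rightarrow> - (\<i> * z) | Some j \<Rightarrow> \<i> * of_real (k $ j))"
  define e where "e = \<i> * (complex_of_real (k \<bullet> snd X) - z * of_real (fst X))"
  have eq: "(\<lambda>h::real. c * exp (\<i> * (of_real (k \<bullet> snd (X + h *\<^sub>R st_axis a))
             - z * of_real (fst (X + h *\<^sub>R st_axis a))))) = (\<lambda>h. c * exp (e + of_real h * l))"
    by (rule ext, rule arg_cong[where f="\<lambda>u. c * exp u"], cases a)
       (simp_all add: st_axis_def l_def e_def inner_add_right inner_axis algebra_simps)
  have "((\<lambda>h::real. c * exp (e + of_real h * l)) has_vector_derivative c * (exp e * l)) (at 0)"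
    by (rule has_vector_derivative_real_field[where f="\<lambda>h. c * exp (e + h * l)"])
       (auto intro!: derivative_eq_intros)
  then show "partial a (\<lambda>X. c * exp (\<i> * (of_real (k \<bullet> snd X) - z * of_real (fst X)))) X =
      (c * l) * exp (\<i> * (of_real (k \<bullet> snd X) - z * of_real (fst X)))"
    unfolding partial_def eq by (simp add: vector_derivative_at e_def mult_ac)
qed

lemma wave_op_plane_wave:
  fixes k v :: "real^3" and z :: complex
  shows "wave_op (medium_form v C) (\<lambda>X. exp (\<i> * (of_real (k \<bullet> snd X) - z * of_real (fst X)))) X
    = (of_real (k \<bullet> (C *v k)) - (z - of_real (v \<bullet> k))\<^sup>2)
      * exp (\<i> * (of_real (k \<bullet> snd X) - z * of_real (fst X)))"
proof -
  define w where "w = (\<lambda>X. exp (\<i> * (complex_of_real (k \<bullet> snd X) - z * of_real (fst X))))"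
  define l where "l = (\<lambda>a. case a of None \<Rightarrow> - (\<i> * z) | Some j \<Rightarrow> \<i> * complex_of_real (k $ j))"
  have p: "partial b (\<lambda>X. c * w X) = (\<lambda>X. c * l b * w X)" for b c
    using partial_plane_wave[of b c k z] by (simp add: w_def l_def)
  have "partial a (partial b w) X = l b * l a * w X" for a b
    using p[of b 1] p[of a "l b"] by simp
  then have "wave_op (medium_form v C) w X =
      (\<Sum>a\<in>UNIV. \<Sum>b\<in>UNIV. of_real (medium_form v C $ a $ b) * (l b * l a)) * w X"
    by (simp add: wave_op_def sum_distrib_right mult.assoc)
  also have "(\<Sum>a\<in>UNIV. \<Sum>b\<in>UNIV. of_real (medium_form v C $ a $ b) * (l b * l a)) =
      of_real (k \<bullet> (C *v k)) - (z - of_real (v \<bullet> k))\<^sup>2"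
    by (simp add: sum_3_option medium_form_def l_def sum_3 inner_vec_def matrix_vector_mult_def
        matrix_matrix_mult_def columnvector_def rowvector_def)
       (simp add: algebra_simps power2_eq_square)
  finally show ?thesis by (simp add: w_def)
qed

end

theory Submission
  imports Defs "HOL-Complex_Analysis.Complex_Analysis" "HOL-Probability.Probability"
begin

text \<open>
  Write \<open>z = \<omega> + i \<epsilon>\<close> and \<open>c = - i z\<close>, so \<open>Re c = \<epsilon> > 0\<close>. The symbol \<open>k\<^sup>TCk - (z - v \<cdot> k)\<^sup>2\<close> equals
  \<open>c (k\<^sup>TAk / c + 2 i v \<cdot> k + c)\<close>, and the bracket has positive real part for every \<open>k\<close>. Its inverse is
  therefore a Laplace integral of complex Gaussians in \<open>k\<close>; integrating first over \<open>k\<close> and then over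
  the Laplace variable expresses the field as the convolution of \<open>s\<close> with the explicit Green function
  \<open>exp (i z \<phi>(w)) / (4 \<pi> sqrt (det A) N(w))\<close>, where \<open>N(w)\<^sup>2 = w\<^sup>TA\<^sup>-\<^sup>1w\<close> and
  \<open>\<phi>(w) = N(w) / p - v\<^sup>TA\<^sup>-\<^sup>1w \<ge> 0\<close>. Dominated convergence gives the limit \<open>\<epsilon> \<rightarrow> 0\<close>, and expanding \<open>N(r n - y)\<close>
  in \<open>1/r\<close> gives the far field. The wave equation holds at complex frequency by pairing with plane
  waves and survives the limit. On the ellipsoid \<open>(\<omega> - v \<cdot> k) v\<^sub>g(k) = A k + \<omega> v\<close>, which determines \<open>k\<close>
  from the direction of \<open>v\<^sub>g\<close>.
\<close>

text \<open>The source is only square integrable with compact support, so \<open>fourier s\<close>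
  is bounded and square integrable but need not be integrable, and the growth of the symbol like
  \<open>k \<bullet> k\<close> does not make its reciprocal integrable in dimension three.
  Convergence of the field integral therefore comes from pairing two square integrable factors. The
  singularity of the Green function is treated in the same way on the space side, since its square
  is locally integrable. The real part of the symbol has no fixed sign. Division by \<open>c\<close>
  rotates it and makes the drift term purely imaginary, so that in the Gaussian integral the drift
  only displaces the observation point by \<open>2 t v\<close>. The limit needs bounds that do not
  depend on \<open>\<epsilon>\<close>, and these come from the sign of the phase. The field of such
  a source need not be twice differentiable. The equation is therefore tested against smooth
  functions whose derivatives are moved onto plane waves, where the symbol appears and cancels the
  denominator.\<close>

unbundle no fps_syntax

lemmas matrix_vector_linear = matrix_vector_mult_diff_distrib matrix_vector_mult_scaleR

lemmas integrable_dominated = Bochner_Integration.integrable_bound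

section \<open>Positive definite forms in three dimensions\<close>

lemma inner_matrix_symmetric:
  fixes S :: "real^'n^'n"
  assumes "transpose S = S"
  shows "x \<bullet> (S *v y) = y \<bullet> (S *v x)"
proof -
  have "x \<bullet> (S *v y) = (transpose S *v x) \<bullet> y"
    by (simp add: dot_lmul_matrix)
  then show ?thesis by (simp add: assms inner_commute)
qed

text \<open>Gram--Schmidt for the inner product of \<open>S\<close>, applied to the standard basis.\<close>

lemma pos_def_congruent_identity:
  fixes S :: "real^3^3"
  assumes "pos_def S"
  obtains M :: "real^3^3" where "transpose M ** S ** M = mat 1"
proof -
  define B where "B x y = x \<bullet> (S *v y)" for x y :: "real^3"
  have sym: "B x y = B y x" for x y
    using assms unfolding B_def pos_def_def by (auto intro: inner_matrix_symmetric)
  have pos: "x \<noteq> 0 \<Longrightarrow> B x x > 0" for x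
    using assms unfolding B_def pos_def_def by auto
  have lin: "B (x - y) z = B x z - B y z" "B z (x - y) = B z x - B z y"
    "B (c *\<^sub>R x) z = c * B x z" "B z (c *\<^sub>R x) = c * B z x" for x y z c
    by (simp_all add: B_def inner_diff_left inner_diff_right matrix_vector_linear)
  define e where "e i = (axis i 1 :: real^3)" for i
  define nm where "nm x = (1 / sqrt (B x x)) *\<^sub>R x" for x
  have nm: "B (nm x) (nm x) = 1" if "x \<noteq> 0" for x
    using pos[OF that] by (simp add: nm_def lin real_sqrt_mult[symmetric] field_simps)
  define u1 where "u1 = nm (e 1)"
  define w2 where "w2 = e 2 - B (e 2) u1 *\<^sub>R u1"
  define u2 where "u2 = nm w2"
  define w3 where "w3 = e 3 - B (e 3) u1 *\<^sub>R u1 - B (e 3) u2 *\<^sub>R u2"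
  define u3 where "u3 = nm w3"
  \<comment> \<open>Orthogonalisation is triangular over the standard basis: \<open>u1\<close> has
    only a first coordinate and \<open>u2\<close> only the first two. The newest coordinate of each
    residual is therefore exactly 1, and no residual vanishes.\<close>
  have c: "w2 $ 2 = 1" "w2 $ 3 = 0" "w3 $ 3 = 1" "e 1 $ 1 = 1"
    by (simp_all add: w2_def w3_def u1_def u2_def nm_def e_def axis_def)
  have nz: "e 1 \<noteq> 0" "w2 \<noteq> 0" "w3 \<noteq> 0"
    using c by (metis zero_index zero_neq_one)+
  have n1: "B u1 u1 = 1" "B u2 u2 = 1" "B u3 u3 = 1"
    unfolding u1_def u2_def u3_def using nz nm by blast+
  have "B u1 w2 = 0" by (simp add: w2_def lin n1 sym)
  then have o12: "B u1 u2 = 0" by (simp add: u2_def nm_def lin)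
  have "B u1 w3 = 0" "B u2 w3 = 0"
    using o12 by (simp_all add: w3_def lin n1 sym[of "e 3"] sym[of u2 u1])
  then have o3: "B u1 u3 = 0" "B u2 u3 = 0" by (simp_all add: u3_def nm_def lin)
  define u where "u j = (if j = (1::3) then u1 else if j = 2 then u2 else u3)" for j
  have orth: "B (u i) (u j) = (if i = j then 1 else 0)" for i j
    using exhaust_3[of i] exhaust_3[of j] n1 o12 o3 sym by (auto simp: u_def)
  define M :: "real^3^3" where "M = (\<chi> i j. u j $ i)"
  have "(transpose M ** S ** M) $ i $ j = B (u i) (u j)" for i j
    by (simp add: B_def M_def matrix_matrix_mult_def transpose_def inner_vec_def
        matrix_vector_mult_def sum_3 algebra_simps)
  then have "transpose M ** S ** M = mat 1"
    by (simp add: vec_eq_iff orth mat_def)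
  then show ?thesis by (rule that)
qed

text \<open>The factor is \<open>T = transpose M\<close> for the congruence
  \<open>transpose M ** S ** M = mat 1\<close>. Cycling the factors gives the inverse of
  \<open>S\<close> as \<open>M ** transpose M\<close>, so \<open>T\<close> carries the inverse form
  to the Euclidean product, while \<open>transpose T\<close> pulls \<open>S\<close> back to it.
  Determinants give the size of \<open>det T\<close>, which is the origin of
  \<open>sqrt (det A)\<close> in the far field.\<close>

lemma pos_def_factor_inverse:
  fixes S :: "real^3^3"
  assumes "pos_def S"
  obtains T :: "real^3^3" where "det T \<noteq> 0" "det S > 0" "\<bar>det T\<bar> = 1 / sqrt (det S)"
    "S ** matrix_inv S = mat 1"
    "\<And>x y. x \<bullet> (matrix_inv S *v y) = (T *v x) \<bullet> (T *v y)"
    "\<And>x y. (transpose T *v x) \<bullet> (S *v (transpose T *v y)) = x \<bullet> y"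
proof -
  obtain M :: "real^3^3" where M: "transpose M ** S ** M = mat 1"
    using pos_def_congruent_identity[OF assms] by blast
  define T where "T = transpose M"
  have dM: "det M * det M * det S = 1"
    using arg_cong[OF M, of det] by (simp add: det_mul det_transpose mult_ac)
  then have nz: "det T \<noteq> 0" "det S \<noteq> 0" by (auto simp: T_def det_transpose)
  have dS: "det S > 0"
    using dM zero_less_mult_iff[of "det M * det M" "det S"] not_real_square_gt_zero[of "det M"]
    by (auto simp: zero_less_mult_iff)
  have "(det T)\<^sup>2 = 1 / det S"
    using dM nz by (simp add: T_def det_transpose power2_eq_square field_simps)
  then have dT: "\<bar>det T\<bar> = 1 / sqrt (det S)"
    by (metis real_sqrt_abs real_sqrt_divide real_sqrt_one)
  have SS: "S ** matrix_inv S = mat 1" "matrix_inv S ** S = mat 1"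
  proof -
    have "\<exists>S'. S ** S' = mat 1 \<and> S' ** S = mat 1"
      using nz invertible_det_nz[of S] by (simp add: invertible_def)
    from someI_ex[OF this] show "S ** matrix_inv S = mat 1" "matrix_inv S ** S = mat 1"
      by (simp_all add: matrix_inv_def)
  qed
  \<comment> \<open>A one-sided inverse of a square matrix is two-sided. Applied twice, this cycles
    the three factors of the congruence into the order wanted here.\<close>
  have "S ** (M ** transpose M) = mat 1"
  proof -
    have "(transpose M ** S) ** M = mat 1" using M by simp
    then have "M ** (transpose M ** S) = mat 1" using matrix_left_right_inverse by blast
    then have "(M ** transpose M) ** S = mat 1" by (simp add: matrix_mul_assoc)
    then show ?thesis using matrix_left_right_inverse by blast
  qed
  then have inv: "matrix_inv S = M ** transpose M"
    by (metis SS(2) matrix_mul_assoc matrix_mul_lid matrix_mul_rid)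
  have "x \<bullet> (matrix_inv S *v y) = (T *v x) \<bullet> (T *v y)" for x y
    by (simp add: inv T_def matrix_vector_mul_assoc[symmetric] dot_lmul_matrix)
  moreover have "(transpose T *v x) \<bullet> (S *v (transpose T *v y)) = x \<bullet> y" for x y
  proof -
    have "(transpose T *v x) \<bullet> (S *v (transpose T *v y)) = x \<bullet> ((transpose M ** S ** M) *v y)"
      by (simp add: T_def transpose_transpose matrix_vector_mul_assoc[symmetric]
          del: transpose_matrix_vector)
         (metis dot_lmul_matrix transpose_matrix_vector transpose_transpose)
    then show ?thesis by (simp add: M)
  qed
  ultimately show ?thesis using that nz dS dT SS by blast
qed

section \<open>Linear substitutions and product integrands for Lebesgue measure\<close>

lemma lborel_integral_linear:
  fixes T :: "real^3^3" and f :: "real^3 \<Rightarrow> complex"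
  assumes "det T \<noteq> 0" and [measurable]: "f \<in> borel_measurable borel"
  shows "(LINT x|lborel. f x) = \<bar>det T\<bar> *\<^sub>R (LINT x|lborel. f (T *v x))"
    and "integrable lborel (\<lambda>x. f (T *v x)) \<longleftrightarrow> integrable lborel f"
proof -
  define g where "g = (\<lambda>x. T *v x)"
  have lin: "linear g" unfolding g_def by (rule matrix_vector_mul_linear)
  have [measurable]: "g \<in> borel_measurable borel"
    by (intro borel_measurable_continuous_onI linear_continuous_on lin linear_linear[THEN iffD2])
  have mg: "matrix g = T" by (simp add: g_def)
  obtain h where h: "linear h" "\<And>x. h (g x) = x" "\<And>x. g (h x) = x"
    by (metis lin assms(1) mg det_nz_iff_inj linear_injective_isomorphism)
  have lh: "det (matrix h) * det T = 1"
  proof -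
    have "matrix (h \<circ> g) = matrix h ** matrix g"
      using matrix_compose[OF lin h(1)] by simp
    moreover have "h \<circ> g = id" using h by (auto simp: fun_eq_iff)
    ultimately have "matrix h ** T = mat 1" by (simp add: mg matrix_id_mat_1)
    then show ?thesis by (metis det_I det_mul)
  qed
  \<comment> \<open>Lebesgue measure is determined by its values on boxes. The preimage of a box
    under \<open>g\<close> is its image under the inverse map \<open>h\<close>, whose volume carries
    the factor \<open>\<bar>det (matrix h)\<bar>\<close>, and the density cancels that factor.
    Equality of measures then transfers integrals and integrability together.\<close>
  have eq: "lborel = density (distr lborel borel g) (\<lambda>_. ennreal \<bar>det T\<bar>)"
  proof (rule lborel_eqI)
    fix l u :: "real^3"
    assume le: "\<And>b. b \<in> Basis \<Longrightarrow> l \<bullet> b \<le> u \<bullet> b"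
    have "g -` box l u = h ` box l u" 
      using h by (auto simp: image_iff) metis
    moreover have "emeasure lborel (h ` box l u) = ennreal (\<bar>det (matrix h)\<bar> * measure lborel (box l u))"
    proof -
      have m: "h ` box l u \<in> lmeasurable"
        by (rule measurable_linear_image[OF h(1)]) simp
      have b: "h ` box l u \<in> sets borel"
        using measurable_sets[of g borel borel "box l u"] \<open>g -` box l u = h ` box l u\<close> by simp
      have "emeasure lebesgue (h ` box l u) = ennreal (measure lebesgue (h ` box l u))"
        using m by (intro emeasure_eq_ennreal_measure) (auto simp: fmeasurable_def)
      also have "measure lebesgue (h ` box l u) = \<bar>det (matrix h)\<bar> * measure lebesgue (box l u)"
        by (rule measure_linear_image[OF h(1)]) simp
      finally show ?thesis using b by simp
    qed
    moreover have "\<bar>det T\<bar> * (\<bar>det (matrix h)\<bar> * measure lborel (box l u)) = (\<Prod>b\<in>Basis. (u - l) \<bullet> b)"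
    proof -
      have "\<bar>det T\<bar> * \<bar>det (matrix h)\<bar> = 1" using lh by (metis abs_mult abs_one mult.commute)
      then have "\<bar>det T\<bar> * (\<bar>det (matrix h)\<bar> * measure lborel (box l u)) = measure lborel (box l u)"
        by (metis mult.assoc mult_1)
      then show ?thesis using le by (simp add: measure_lborel_box_eq)
    qed
    ultimately show "emeasure (density (distr lborel borel g) (\<lambda>_. ennreal \<bar>det T\<bar>)) (box l u)
       = (\<Prod>b\<in>Basis. (u - l) \<bullet> b)"
      by (simp add: emeasure_density emeasure_distr nn_integral_cmult_indicator ennreal_mult'[symmetric])
  qed simp
  show "(LINT x|lborel. f x) = \<bar>det T\<bar> *\<^sub>R (LINT x|lborel. f (T *v x))"
    by (subst eq) (simp add: integral_density integral_distr g_def[symmetric] fun_cong[OF g_def, symmetric])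
  have "integrable lborel f \<longleftrightarrow> integrable lborel (\<lambda>x. \<bar>det T\<bar> *\<^sub>R f (g x))"
    by (subst eq) (simp add: integrable_density integrable_distr_eq)
  also have "\<dots> \<longleftrightarrow> integrable lborel (\<lambda>x. f (g x))"
    using integrable_scaleR_right[of "1 / \<bar>det T\<bar>" lborel "\<lambda>x. \<bar>det T\<bar> *\<^sub>R f (g x)"]
      integrable_scaleR_right[of "\<bar>det T\<bar>" lborel "\<lambda>x. f (g x)"] assms(1) by auto
  finally show "integrable lborel (\<lambda>x. f (T *v x)) \<longleftrightarrow> integrable lborel f"
    by (simp add: g_def)
qed

lemma lborel_integral_translate:
  fixes f :: "'a::euclidean_space \<Rightarrow> complex"
  assumes [measurable]: "f \<in> borel_measurable borel"
  shows "(LINT x|lborel. f (c + x)) = (LINT x|lborel. f x)"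
  using integral_distr[of "(+) c" lborel borel f] by (simp add: lborel_distr_plus)

text \<open>Lebesgue measure is the image of the product of one-dimensional Lebesgue measures under
  the coordinate sum, so Fubini for finite products applies. This serves the Gaussians and the
  three-dimensional weights alike.\<close>

lemma lborel_integral_prod_Basis:
  fixes f :: "'a::euclidean_space \<Rightarrow> real \<Rightarrow> complex"
  assumes "\<And>b. b \<in> Basis \<Longrightarrow> integrable lborel (f b)"
  shows "integrable lborel (\<lambda>x. \<Prod>b\<in>Basis. f b (x \<bullet> b))"
    and "(LINT x|lborel. (\<Prod>b\<in>Basis. f b (x \<bullet> b))) = (\<Prod>b\<in>Basis. LINT t|lborel. f b t)"
proof -
  interpret product_sigma_finite "\<lambda>b::'a. lborel :: real measure" ..
  have m[measurable]: "b \<in> Basis \<Longrightarrow> f b \<in> borel_measurable borel" for b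
    using assms[of b] by auto
  have meas: "(\<lambda>x. \<Prod>b\<in>Basis. f b (x \<bullet> b)) \<in> borel_measurable borel"
    by measurable
  have eq: "(\<Prod>b\<in>Basis. f b ((\<Sum>c\<in>Basis. g c *\<^sub>R c) \<bullet> b)) = (\<Prod>b\<in>Basis. f b (g b))" for g :: "'a \<Rightarrow> real"
    by (intro prod.cong refl) simp
  have s: "(\<lambda>g. \<Sum>b\<in>Basis. g b *\<^sub>R b) \<in> measurable (\<Pi>\<^sub>M b\<in>Basis. lborel) (borel :: 'a measure)"
    by measurable
  show "integrable lborel (\<lambda>x. \<Prod>b\<in>Basis. f b (x \<bullet> b))"
    by (subst lborel_eq, subst integrable_distr_eq[OF s meas], unfold eq)
      (rule product_integrable_prod[OF finite_Basis assms])
  show "(LINT x|lborel. (\<Prod>b\<in>Basis. f b (x \<bullet> b))) = (\<Prod>b\<in>Basis. LINT t|lborel. f b t)"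
    by (subst lborel_eq, subst integral_distr[OF s meas], unfold eq)
      (rule product_integral_prod[OF finite_Basis assms])
qed

subsection \<open>Gaussian integrals with complex variance\<close>

lemma gaussian_integrable_real:
  fixes c :: real
  assumes "c > 0"
  shows "integrable lborel (\<lambda>x::real. exp (- c * x\<^sup>2))"
proof -
  have "integrable lborel (\<lambda>x. sqrt (pi / c) * normal_density 0 (1 / sqrt (2 * c)) x)"
    using assms by (intro integrable_mult_right integrable_normal_density) simp
  also have "(\<lambda>x. sqrt (pi / c) * normal_density 0 (1 / sqrt (2 * c)) x) = (\<lambda>x. exp (- c * x\<^sup>2))"
    using assms by (auto simp: normal_density_def power_divide real_sqrt_divide real_sqrt_mult field_simps)
  finally show ?thesis .
qed

lemma norm_gaussian:
  fixes x b :: real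
  shows "norm (exp (- a * of_real (x\<^sup>2) + \<i> * of_real (b * x))) = exp (- Re a * x\<^sup>2)"
  by (simp add: norm_exp_eq_Re)

lemma gaussian_integrable_complex:
  fixes b :: real
  assumes "Re a > 0"
  shows "integrable lborel (\<lambda>x::real. exp (- a * of_real (x\<^sup>2) + \<i> * of_real (b * x)))"
proof (rule integrable_dominated[OF gaussian_integrable_real[OF assms]])
  show "AE x in lborel. norm (exp (- a * of_real (x\<^sup>2) + \<i> * of_real (b * x))) \<le> norm (exp (- Re a * x\<^sup>2))"
    unfolding norm_gaussian by simp
qed measurable

text \<open>This is the characteristic function of the standard normal law after rescaling:
  \<open>r = sqrt (2 * a)\<close> turns half the square into \<open>a\<close> times the square, and
  \<open>t = b / r\<close> keeps the frequency \<open>b\<close>.\<close>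

lemma gaussian_fourier_real:
  fixes a b :: real
  assumes a: "a > 0"
  shows "(LINT x|lborel. exp (- of_real a * of_real (x\<^sup>2) + \<i> * of_real (b * x)))
    = of_real (sqrt (pi / a) * exp (- (b\<^sup>2) / (4 * a)))"
proof -
  define r where "r = sqrt (2 * a)"
  have r: "r > 0" "r\<^sup>2 = 2 * a" using a by (auto simp: r_def)
  define t where "t = b / r"
  have "of_real (exp (- (t\<^sup>2) / 2)) = char std_normal_distribution t"
    by (simp add: char_std_normal_distribution)
  also have "\<dots> = (LINT x|lborel. std_normal_density x *\<^sub>R iexp (t * x))"
    unfolding char_def by (subst integral_density) auto
  also have "\<dots> = \<bar>r\<bar> *\<^sub>R (LINT x|lborel. std_normal_density (0 + r * x) *\<^sub>R iexp (t * (0 + r * x)))"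
    by (rule lborel_integral_real_affine) (use r in auto)
  also have "(\<lambda>x. std_normal_density (0 + r * x) *\<^sub>R iexp (t * (0 + r * x)))
     = (\<lambda>x. of_real (1 / sqrt (2 * pi)) * exp (- of_real a * of_real (x\<^sup>2) + \<i> * of_real (b * x)))"
    using r by (intro ext) (simp add: std_normal_density_def t_def scaleR_conv_of_real exp_add
        power_mult_distrib exp_of_real[symmetric] flip: of_real_mult of_real_power of_real_minus)
  finally have E: "of_real (exp (- (t\<^sup>2) / 2)) = of_real (r / sqrt (2 * pi)) *
     (LINT x|lborel. exp (- of_real a * of_real (x\<^sup>2) + \<i> * of_real (b * x)))" (is "_ = _ * ?I")
    using r by (simp add: scaleR_conv_of_real)
  have "sqrt (pi / a) * (r / sqrt (2 * pi)) = 1"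
    using a by (simp add: r_def real_sqrt_divide real_sqrt_mult)
  moreover have "x * y = 1 \<Longrightarrow> of_real x * (of_real y * I) = I" for x y :: real and I :: complex
    by (metis mult.assoc mult_1 of_real_1 of_real_mult)
  ultimately have "of_real (sqrt (pi / a)) * (of_real (r / sqrt (2 * pi)) * ?I) = ?I"
    by blast
  then have "of_real (sqrt (pi / a)) * (of_real (exp (- (t\<^sup>2) / 2)) :: complex) = ?I"
    by (simp only: E)
  moreover have "- (t\<^sup>2) / 2 = - (b\<^sup>2) / (4 * a)"
    using r by (simp add: t_def power_divide)
  ultimately show ?thesis by (simp only: of_real_mult)
qed

text \<open>Integrals over compact intervals are holomorphic in \<open>a\<close> by differentiation
  under the integral. They converge locally uniformly, because the discarded tail is dominated by a
  real Gaussian whose rate is a lower bound of \<open>Re a\<close>.\<close>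

lemma gaussian_holomorphic:
  fixes b :: real
  shows "(\<lambda>a. LINT x|lborel. exp (- a * of_real (x\<^sup>2) + \<i> * of_real (b * x))) holomorphic_on {a. Re a > 0}"
proof -
  define g where "g = (\<lambda>a (x::real). exp (- a * of_real (x\<^sup>2) + \<i> * of_real (b * x)) :: complex)"
  define U where "U = {a. Re a > 0}"
  have gc: "continuous_on S (g a)" for S a unfolding g_def by (intro continuous_intros)
  define F where "F = (\<lambda>n a. integral (cbox (- real n) (real n)) (g a))"
  have hol: "F n holomorphic_on U" for n
    unfolding F_def
  proof (rule leibniz_rule_holomorphic)
    show "((\<lambda>a. g a x) has_field_derivative - of_real (x\<^sup>2) * g a x) (at a within U)" for a x
      unfolding g_def by (auto intro!: derivative_eq_intros)
    show "g a integrable_on cbox (- real n) (real n)" for a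
      by (rule integrable_continuous) (rule gc)
    show "continuous_on (U \<times> cbox (- real n) (real n)) (\<lambda>(a, x). - of_real (x\<^sup>2) * g a x)"
      unfolding g_def by (auto simp: case_prod_unfold intro!: continuous_intros)
    show "convex U" unfolding U_def by (rule convex_halfspace_Re_gt)
  qed
  define J where "J = (\<lambda>a. LINT x|lborel. g a x)"
  have gi: "integrable lborel (g a)" if "Re a > 0" for a
    unfolding g_def by (rule gaussian_integrable_complex[OF that])
  have diff: "norm (J a - F n a) \<le> (LINT x|lborel. indicator (- cbox (- real n) (real n)) x *\<^sub>R exp (- c * x\<^sup>2))"
    if "c > 0" "Re a \<ge> c" for a c n
  proof -
    have a: "Re a > 0" using that by simp
    define K where "K = cbox (- real n) (real n)"
    have "F n a = (LINT x:K|lborel. g a x)"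
      unfolding F_def K_def
      by (rule set_borel_integral_eq_integral(2)[symmetric], unfold set_integrable_def)
         (rule integrable_mult_indicator[OF _ gi[OF a]], simp)
    then have "J a - F n a = (LINT x|lborel. g a x - indicator K x *\<^sub>R g a x)"
      unfolding J_def set_lebesgue_integral_def K_def
      by (subst Bochner_Integration.integral_diff) (auto intro!: gi[OF a] integrable_mult_indicator)
    also have "norm \<dots> \<le> (LINT x|lborel. norm (g a x - indicator K x *\<^sub>R g a x))"
      by (rule integral_norm_bound)
    also have "\<dots> \<le> (LINT x|lborel. indicator (- K) x *\<^sub>R exp (- c * x\<^sup>2))"
    proof (rule integral_mono)
      show "integrable lborel (\<lambda>x. norm (g a x - indicator K x *\<^sub>R g a x))"
        unfolding K_def by (intro integrable_norm Bochner_Integration.integrable_diff gi[OF a] integrable_mult_indicator) auto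
      show "integrable lborel (\<lambda>x. indicator (- K) x *\<^sub>R exp (- c * x\<^sup>2))"
        unfolding K_def by (intro integrable_mult_indicator gaussian_integrable_real that) auto
      show "norm (g a x - indicator K x *\<^sub>R g a x) \<le> indicator (- K) x *\<^sub>R exp (- c * x\<^sup>2)" for x
        using that unfolding g_def
        by (auto simp: norm_gaussian indicator_def mult_right_mono simp del: of_real_power of_real_mult)
    qed
    finally show ?thesis by (simp add: K_def)
  qed
  have lim: "(\<lambda>n. LINT x|lborel. indicator (- cbox (- real n) (real n)) x *\<^sub>R exp (- c * x\<^sup>2)) \<longlonglongrightarrow> 0"
    if c: "c > 0" for c
  proof -
    have "(\<lambda>n. LINT x|lborel. indicator (- cbox (- real n) (real n)) x *\<^sub>R exp (- c * x\<^sup>2))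
        \<longlonglongrightarrow> (LINT x::real|lborel. 0::real)"
    proof (rule integral_dominated_convergence[where w="\<lambda>x. exp (- c * x\<^sup>2)"])
      show "AE x in lborel. (\<lambda>n. indicator (- cbox (- real n) (real n)) x *\<^sub>R exp (- c * x\<^sup>2)) \<longlonglongrightarrow> 0"
      proof (rule AE_I2)
        fix x :: real
        have "eventually (\<lambda>n. indicator (- cbox (- real n) (real n)) x *\<^sub>R exp (- c * x\<^sup>2) = 0) sequentially"
          using eventually_ge_at_top[of "nat \<lceil>\<bar>x\<bar>\<rceil>"]
          by eventually_elim (auto simp: indicator_def)
        then show "(\<lambda>n. indicator (- cbox (- real n) (real n)) x *\<^sub>R exp (- c * x\<^sup>2)) \<longlonglongrightarrow> 0"
          by (rule tendsto_eventually)
      qed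
    qed (use gaussian_integrable_real[OF c] in \<open>auto simp: indicator_def\<close>)
    then show ?thesis by simp
  qed
  have "J holomorphic_on U"
  proof (rule holomorphic_uniform_sequence[where f=F])
    show "open U" unfolding U_def by (rule open_halfspace_Re_gt)
    show "F n holomorphic_on U" for n by (rule hol)
    fix z assume z: "z \<in> U"
    \<comment> \<open>The closed disc of radius \<open>Re z / 2\<close> about \<open>z\<close> stays
      in the half plane and has \<open>Re a \<ge> c\<close> throughout, so one real Gaussian
      controls all tails.\<close>
    define c where "c = Re z / 2"
    have c: "c > 0" using z by (simp add: c_def U_def)
    have ge: "Re a \<ge> c" if "a \<in> cball z c" for a
      using that abs_Re_le_cmod[of "z - a"] by (auto simp: dist_norm c_def)
    have "uniform_limit (cball z c) F J sequentially"
    proof (rule uniform_limitI)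
      fix e :: real assume "e > 0"
      with lim[OF c] have "\<forall>\<^sub>F n in sequentially.
          norm (LINT x|lborel. indicator (- cbox (- real n) (real n)) x *\<^sub>R exp (- c * x\<^sup>2)) < e"
        by (simp add: tendsto_iff)
      then show "\<forall>\<^sub>F n in sequentially. \<forall>a\<in>cball z c. dist (F n a) (J a) < e"
      proof eventually_elim
        case (elim n)
        show ?case
        proof
          fix a assume "a \<in> cball z c"
          from diff[OF c ge[OF this], of n] elim show "dist (F n a) (J a) < e"
            by (simp add: dist_norm norm_minus_commute)
        qed
      qed
    qed
    moreover have "cball z c \<subseteq> U" using ge c by (fastforce simp: U_def)
    ultimately show "\<exists>d>0. cball z d \<subseteq> U \<and> uniform_limit (cball z d) F J sequentially"
      using c by blast
  qed
  then show ?thesis by (simp add: J_def g_def U_def)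
qed

text \<open>Both sides are holomorphic on the right half plane, which avoids the cut of the
  principal root, and they agree on the positive reals, which accumulate at 1. Analytic continuation
  gives the rest and fixes the branch of the square root.\<close>

lemma gaussian_fourier_complex:
  fixes b :: real
  assumes "Re a > 0"
  shows "(LINT x|lborel. exp (- a * of_real (x\<^sup>2) + \<i> * of_real (b * x)))
    = of_real (sqrt pi) / csqrt a * exp (- (of_real (b\<^sup>2) / (4 * a)))"
proof -
  define U where "U = {a. Re a > 0}"
  define f where "f = (\<lambda>a. (LINT x|lborel. exp (- a * of_real (x\<^sup>2) + \<i> * of_real (b * x)))
     - of_real (sqrt pi) / csqrt a * exp (- (of_real (b\<^sup>2) / (4 * a))))"
  have "f holomorphic_on U"
    unfolding f_def using gaussian_holomorphic[of b]
    by (intro holomorphic_intros) (auto simp: U_def complex_nonpos_Reals_iff)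
  moreover have "of_real ` {0<..} \<subseteq> U" by (auto simp: U_def)
  moreover have "1 islimpt (of_real ` {0<..} :: complex set)"
  proof (rule islimptI)
    fix T :: "complex set" assume "1 \<in> T" "open T"
    then obtain e where e: "e > 0" "ball 1 e \<subseteq> T" by (meson open_contains_ball)
    have "complex_of_real (1 + e / 2) \<in> T"
      using e by (intro subsetD[OF e(2)]) (simp add: dist_norm)
    then show "\<exists>y\<in>of_real ` {0<..}. y \<in> T \<and> y \<noteq> 1"
      using e by (intro bexI[of _ "of_real (1 + e / 2)"]) (auto simp del: of_real_add simp: add_pos_pos)
  qed
  moreover have "f z = 0" if "z \<in> of_real ` {0<..}" for z
  proof -
    obtain r where r: "z = of_real r" "r > 0" using \<open>z \<in> _\<close> by auto
    have "csqrt z = of_real (sqrt r)" using r by (simp add: csqrt_of_real)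
    then show ?thesis
      using gaussian_fourier_real[OF r(2), of b] r
      by (simp add: f_def real_sqrt_divide exp_of_real[symmetric])
  qed
  moreover have "open U" "connected U" "1 \<in> U" "a \<in> U"
    using assms by (auto simp: U_def open_halfspace_Re_gt convex_connected convex_halfspace_Re_gt)
  ultimately have "f a = 0"
    by (intro analytic_continuation[of f U "of_real ` {0<..}" 1 a]) blast+
  then show ?thesis by (simp add: f_def)
qed

lemma gaussian_character_prod_Basis:
  fixes q w :: "'a::euclidean_space"
  shows "exp (- a * of_real (q \<bullet> q) + \<i> * of_real (q \<bullet> w)) =
    (\<Prod>b\<in>Basis. exp (- a * of_real ((q \<bullet> b)\<^sup>2) + \<i> * of_real ((w \<bullet> b) * (q \<bullet> b))))"
proof -
  have "q \<bullet> q = (\<Sum>b\<in>Basis. (q \<bullet> b)\<^sup>2)" "q \<bullet> w = (\<Sum>b\<in>Basis. (w \<bullet> b) * (q \<bullet> b))"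
    by (subst euclidean_inner, simp add: power2_eq_square mult.commute)+
  then show ?thesis
    by (simp add: exp_sum[symmetric] sum.distrib sum_subtractf sum_distrib_left sum_negf)
qed

lemma gaussian_fourier_euclidean:
  fixes w :: "'a::euclidean_space"
  assumes a: "Re a > 0"
  shows "integrable lborel (\<lambda>q::'a. exp (- a * of_real (q \<bullet> q) + \<i> * of_real (q \<bullet> w)))"
    and "(LINT q|lborel. exp (- a * of_real (q \<bullet> q) + \<i> * of_real (q \<bullet> w)))
      = (of_real (sqrt pi) / csqrt a) ^ DIM('a) * exp (- (of_real (w \<bullet> w) / (4 * a)))"
proof -
  note i = gaussian_integrable_complex[OF a]
  show "integrable lborel (\<lambda>q::'a. exp (- a * of_real (q \<bullet> q) + \<i> * of_real (q \<bullet> w)))"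
    unfolding gaussian_character_prod_Basis by (rule lborel_integral_prod_Basis(1)[OF i])
  have "w \<bullet> w = (\<Sum>b\<in>Basis. (w \<bullet> b)\<^sup>2)"
    by (subst euclidean_inner) (simp add: power2_eq_square)
  then have e: "exp (- (of_real (w \<bullet> w) / (4 * a))) = (\<Prod>b\<in>Basis. exp (- (of_real ((w \<bullet> b)\<^sup>2) / (4 * a))))"
    by (simp add: exp_sum[symmetric] sum_divide_distrib sum_negf[symmetric])
  show "(LINT q|lborel. exp (- a * of_real (q \<bullet> q) + \<i> * of_real (q \<bullet> w)))
      = (of_real (sqrt pi) / csqrt a) ^ DIM('a) * exp (- (of_real (w \<bullet> w) / (4 * a)))"
    unfolding gaussian_character_prod_Basis lborel_integral_prod_Basis(2)[OF i] gaussian_fourier_complex[OF a] e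
    by (simp add: prod.distrib prod_dividef power_divide prod_constant)
qed

section \<open>Exchange of integrals\<close>

lemma integrable_lborel_pair_dominated:
  fixes F :: "'a::euclidean_space \<Rightarrow> 'b::euclidean_space \<Rightarrow> complex" and f :: "'a \<Rightarrow> real" and g :: "'b \<Rightarrow> real"
  assumes [measurable]: "case_prod F \<in> borel_measurable (borel \<Otimes>\<^sub>M borel)"
    and f: "integrable lborel f" and g: "integrable lborel g"
    and le: "\<And>x y. norm (F x y) \<le> f x * g y"
  shows "integrable (lborel \<Otimes>\<^sub>M lborel) (case_prod F)"
proof -
  have [measurable]: "f \<in> borel_measurable borel" "g \<in> borel_measurable borel"
    using f g by auto
  have "integrable (lborel \<Otimes>\<^sub>M lborel) (\<lambda>p. f (fst p) * g (snd p))"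
  proof (rule lborel_pair.Fubini_integrable)
    show "(\<lambda>p. f (fst p) * g (snd p)) \<in> borel_measurable (lborel \<Otimes>\<^sub>M lborel)" by measurable
    show "integrable lborel (\<lambda>x. LINT y|lborel. norm (f (fst (x, y)) * g (snd (x, y))))"
      using f by (simp add: abs_mult)
    show "AE x in lborel. integrable lborel (\<lambda>y. f (fst (x, y)) * g (snd (x, y)))"
      using g by simp
  qed
  then show ?thesis
  proof (rule integrable_dominated)
    show "AE p in lborel \<Otimes>\<^sub>M lborel. norm (case_prod F p) \<le> norm (f (fst p) * g (snd p))"
      using le by (intro AE_I2) (auto simp: case_prod_unfold intro: order_trans[OF le abs_ge_self])
  qed measurable
qed

text \<open>Most exchanges below have such a product majorant. The two that involve the Laplace
  variable are different: there the integral in that variable supplies the decay needed in the other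
  one, so they go through iterated integrability.\<close>

lemma Fubini_lborel_dominated:
  fixes F :: "'a::euclidean_space \<Rightarrow> 'b::euclidean_space \<Rightarrow> complex" and f :: "'a \<Rightarrow> real" and g :: "'b \<Rightarrow> real"
  assumes "case_prod F \<in> borel_measurable (borel \<Otimes>\<^sub>M borel)"
    and "integrable lborel f" and "integrable lborel g"
    and "\<And>x y. norm (F x y) \<le> f x * g y"
  shows "(LINT x|lborel. LINT y|lborel. F x y) = (LINT y|lborel. LINT x|lborel. F x y)"
  using lborel_pair.Fubini_integral[OF integrable_lborel_pair_dominated[OF assms]] by simp

text \<open>A nonintegrable \<open>f\<close> is covered by the convention that its Bochner integral
  is 0.\<close>

lemma ennreal_norm_integral_le:
  fixes f :: "'a \<Rightarrow> complex"
  shows "ennreal (norm (LINT x|M. f x)) \<le> (\<integral>\<^sup>+x. norm (f x) \<partial>M)"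
  by (cases "integrable M f") (auto intro: integral_norm_bound_ennreal simp: not_integrable_integral_eq)

subsection \<open>Two integrable weights\<close>

lemma integrable_lborel_has_integral:
  fixes f :: "real \<Rightarrow> real"
  assumes [measurable]: "f \<in> borel_measurable borel" "S \<in> sets borel"
    and "\<And>x. x \<in> S \<Longrightarrow> 0 \<le> f x" and "(f has_integral I) S"
  shows "integrable lborel (\<lambda>x. indicator S x * f x)"
proof (rule integrableI_nonneg)
  have eq: "(\<lambda>x. if x \<in> S then f x else 0) = (\<lambda>x. indicator S x * f x)"
    by (auto simp: indicator_def)
  have "((\<lambda>x. indicator S x * f x) has_integral I) UNIV"
    using assms(4) has_integral_restrict_UNIV[of S f I] by (simp add: eq)
  then have "integral\<^sup>N lborel (\<lambda>x. indicator S x * f x) = I"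
    by (intro nn_integral_has_integral_lborel) (use assms(3) in \<open>auto simp: indicator_def\<close>)
  then show "integral\<^sup>N lborel (\<lambda>x. indicator S x * f x) < \<infinity>" by simp
qed (use assms(3) in \<open>auto simp: indicator_def\<close>)

lemma integrable_lborel_even:
  fixes f :: "real \<Rightarrow> real"
  assumes "integrable lborel (\<lambda>x. indicator {0..} x * f x)" "\<And>x. f (- x) = f x"
    and [measurable]: "f \<in> borel_measurable borel"
  shows "integrable lborel f"
proof -
  have "integrable lborel (\<lambda>x. indicator {0..} (0 + (-1) * x) * f (0 + (-1) * x))"
    by (rule lborel_integrable_real_affine[OF assms(1)]) simp
  then have "integrable lborel (\<lambda>x. norm (indicator {0..} x * f x) + norm (indicator {0..} (-x) * f x))"
    using assms(1,2) by (intro Bochner_Integration.integrable_add integrable_norm) auto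
  then show ?thesis
    by (rule integrable_dominated) (auto simp: indicator_def)
qed

lemma powr_cube: "(x powr a) ^ 3 = x powr (3 * a)" for x a :: real
  by (simp add: power3_eq_cube powr_add[symmetric])

text \<open>In both lemmas the radial weight is dominated by a product of one-dimensional ones;
  this replaces polar coordinates.\<close>

lemma integrable_decay_weight:
  "integrable lborel (\<lambda>k::real^3. 1 / (1 + k \<bullet> k)\<^sup>2)"
proof -
  \<comment> \<open>Each coordinate takes a third of the exponent \<open>- 2\<close>. The square of
    a coordinate is at most \<open>k \<bullet> k\<close> and the exponent is negative, so each
    factor is at least \<open>(1 + k \<bullet> k) powr (- 2 / 3)\<close>. In one dimension the decay
    \<open>t powr (- 4 / 3)\<close> is still integrable.\<close>
  define g where "g = (\<lambda>t::real. (1 + t\<^sup>2) powr (- 2 / 3))"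
  have gm[measurable]: "g \<in> borel_measurable borel" unfolding g_def by measurable
  have "integrable lborel (\<lambda>t. indicator {0..1} t * (1::real) + indicator {1..} t * t powr (- 4 / 3))"
    by (intro Bochner_Integration.integrable_add integrable_lborel_has_integral[OF _ _ _ has_integral_powr_to_inf]
        integrable_lborel_has_integral[OF _ _ _ has_integral_const_real]) auto
  then have "integrable lborel (\<lambda>t. indicator {0..} t * g t)"
  proof (rule integrable_dominated)
    have "g t \<le> 1" for t :: real
      unfolding g_def using powr_mono2'[of "-2/3" 1 "1 + t\<^sup>2"] by (simp add: )
    moreover have "g t \<le> t powr (- 4 / 3)" if "t \<ge> 1" for t :: real
    proof -
      have "t powr (- 4 / 3) = (t\<^sup>2) powr (- 2 / 3)"
        using that by (simp add: powr_powr flip: powr_numeral)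
      also have "\<dots> \<ge> g t" unfolding g_def
        using that powr_mono2'[of "-2/3" "t\<^sup>2" "1 + t\<^sup>2"] by simp
      finally show ?thesis .
    qed
    moreover have "g t \<ge> 0" for t by (simp add: g_def)
    ultimately show "AE t in lborel. norm (indicator {0..} t * g t)
        \<le> norm (indicator {0..1} t * (1::real) + indicator {1..} t * t powr (- 4 / 3))"
      by (intro AE_I2) (force simp: indicator_def intro: order_trans)
  qed measurable
  then have gi: "integrable lborel g"
    by (rule integrable_lborel_even) (auto simp: g_def)
  then have "integrable lborel (\<lambda>t. complex_of_real (g t))"
    by (rule integrable_of_real)
  from lborel_integral_prod_Basis(1)[where 'a="real^3", OF this]
  show ?thesis
  proof (rule integrable_dominated)
    have "1 / (1 + k \<bullet> k)\<^sup>2 \<le> (\<Prod>b\<in>Basis. g (k \<bullet> b))" for k :: "real^3"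
    proof -
      have kk: "(k \<bullet> b)\<^sup>2 \<le> k \<bullet> k" if "b \<in> Basis" for b
        using power_mono[OF Basis_le_norm[OF that, of k], of 2] by (simp add: dot_square_norm)
      have "(\<Prod>b\<in>(Basis::(real^3) set). (1 + k \<bullet> k) powr (- 2 / 3)) \<le> (\<Prod>b\<in>Basis. g (k \<bullet> b))"
        unfolding g_def using kk powr_mono2'[of "-2/3"]
        by (intro prod_mono) (auto simp: add_pos_nonneg)
      also have "(\<Prod>b\<in>(Basis::(real^3) set). (1 + k \<bullet> k) powr (- 2 / 3)) = (1 + k \<bullet> k) powr (- 2)"
        by (simp add: prod_constant powr_cube)
      also have "\<dots> = 1 / (1 + k \<bullet> k)\<^sup>2"
        by (subst powr_minus) (simp add: add_pos_nonneg divide_inverse)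
      finally show ?thesis .
    qed
    then have le: "1 / (1 + k \<bullet> k)\<^sup>2 \<le> \<bar>\<Prod>b\<in>Basis. g (k \<bullet> b)\<bar>" for k :: "real^3"
      by (rule order_trans[OF _ abs_ge_self])
    show "AE k in (lborel :: (real^3) measure). norm (1 / (1 + k \<bullet> k)\<^sup>2) \<le> norm (\<Prod>b\<in>Basis. complex_of_real (g (k \<bullet> b)))"
    proof (rule AE_I2)
      fix k :: "real^3"
      have "norm (\<Prod>b\<in>(Basis::(real^3) set). complex_of_real (g (k \<bullet> b))) = \<bar>\<Prod>b\<in>Basis. g (k \<bullet> b)\<bar>"
        unfolding of_real_prod[symmetric] norm_of_real ..
      moreover have "norm (1 / (1 + k \<bullet> k)\<^sup>2) = 1 / (1 + k \<bullet> k)\<^sup>2" by simp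
      ultimately show "norm (1 / (1 + k \<bullet> k)\<^sup>2) \<le> norm (\<Prod>b\<in>Basis. complex_of_real (g (k \<bullet> b)))"
        using le[of k] by metis
    qed
  qed measurable
qed

lemma integrable_inverse_square:
  "integrable lborel (\<lambda>w::real^3. indicator (cball 0 1) w * (1 / (w \<bullet> w)))"
proof -
  \<comment> \<open>Again each coordinate takes a third of the exponent:
    \<open>norm w powr (- 2)\<close> lies below a product of three factors with exponent
    \<open>- 2 / 3\<close>, and this exponent exceeds \<open>- 1\<close>, so each factor is
    integrable at 0.\<close>
  define g where "g = (\<lambda>t::real. indicator {-1..1} t * \<bar>t\<bar> powr (- 2 / 3))"
  have gm[measurable]: "g \<in> borel_measurable borel" unfolding g_def by measurable
  have "integrable lborel (\<lambda>t::real. indicator {0..1} t * t powr (- 2 / 3))"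
    by (intro integrable_lborel_has_integral[OF _ _ _ has_integral_powr_from_0]) auto
  also have "(\<lambda>t::real. indicator {0..1} t * t powr (- 2 / 3)) = (\<lambda>t. indicator {0..} t * g t)"
    by (auto simp: g_def indicator_def)
  finally have gi: "integrable lborel g"
    by (rule integrable_lborel_even) (auto simp: g_def indicator_def)
  then have "integrable lborel (\<lambda>t. complex_of_real (g t))"
    by (rule integrable_of_real)
  from lborel_integral_prod_Basis(1)[where 'a="real^3", OF this]
  show ?thesis
  proof (rule integrable_dominated)
    \<comment> \<open>Since \<open>0 powr a = 0\<close>, the product majorant vanishes on the
      coordinate planes and the bound would fail there; these planes are null sets.\<close>
    have "AE w in lborel. \<forall>b\<in>(Basis::(real^3) set). w \<bullet> b \<noteq> 0"
      by (intro AE_finite_allI AE_lborel_inner_neq) auto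
    then show "AE w in lborel. norm (indicator (cball 0 1) w * (1 / (w \<bullet> w)))
        \<le> norm (\<Prod>b\<in>(Basis::(real^3) set). complex_of_real (g (w \<bullet> b)))"
    proof eventually_elim
      case (elim w)
      show ?case
      proof (cases "w \<in> cball 0 1")
        case True
        have w0: "w \<bullet> w > 0" using elim nonempty_Basis by fastforce
        have a: "\<bar>w \<bullet> b\<bar> \<le> 1" if "b \<in> Basis" for b
          using Basis_le_norm[OF that, of w] True by simp
        have "1 / (w \<bullet> w) = norm w powr (- 2)"
          using w0 by (simp add: powr_minus divide_inverse dot_square_norm)
        also have "\<dots> = (\<Prod>b\<in>(Basis::(real^3) set). norm w powr (- 2 / 3))"
          by (simp add: prod_constant powr_cube)
        also have "\<dots> \<le> (\<Prod>b\<in>(Basis::(real^3) set). \<bar>w \<bullet> b\<bar> powr (- 2 / 3))"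
          using elim Basis_le_norm[of _ w] powr_mono2'[of "-2/3"] by (intro prod_mono) auto
        also have "\<dots> = (\<Prod>b\<in>(Basis::(real^3) set). g (w \<bullet> b))"
          using a by (intro prod.cong) (auto simp: g_def indicator_def abs_le_iff)
        finally show ?thesis
          using True w0 by (simp flip: of_real_prod)
      qed simp
    qed
  qed (auto intro!: borel_measurable_times borel_measurable_indicator borel_measurable_divide borel_measurable_inner)
qed

subsection \<open>The Fourier transform of an integrable function\<close>

lemma fourier_measurable[measurable]:
  assumes [measurable]: "s \<in> borel_measurable borel"
  shows "fourier s \<in> borel_measurable borel"
  unfolding fourier_def[abs_def] by measurable

lemma norm_fourier_le: "norm (fourier s k) \<le> (LINT x|lborel. norm (s x))"
proof -
  have "norm (fourier s k) \<le> (LINT x|lborel. norm (s x * exp (- (\<i> * of_real (k \<bullet> x)))))"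
    unfolding fourier_def by (rule integral_norm_bound)
  then show ?thesis by (simp add: norm_mult norm_exp_eq_Re)
qed

text \<open>The substitution \<open>k = transpose T *v q\<close> makes the form Euclidean and moves
  \<open>w\<close> to \<open>T *v w\<close>; its Jacobian is the factor
  \<open>\<bar>det T\<bar>\<close>.\<close>

lemma gaussian_fourier_quadratic:
  fixes S T :: "real^3^3" and w :: "real^3"
  assumes a: "Re a > 0" and T: "det T \<noteq> 0"
    and S: "\<And>q. (transpose T *v q) \<bullet> (S *v (transpose T *v q)) = q \<bullet> q"
  shows "integrable lborel (\<lambda>k. exp (- a * of_real (k \<bullet> (S *v k)) + \<i> * of_real (k \<bullet> w)))" (is "integrable _ ?f")
    and "(LINT k|lborel. exp (- a * of_real (k \<bullet> (S *v k)) + \<i> * of_real (k \<bullet> w)))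
      = of_real \<bar>det T\<bar> * (of_real (sqrt pi) / csqrt a) ^ 3
        * exp (- (of_real ((T *v w) \<bullet> (T *v w)) / (4 * a)))"
proof -
  have cont: "continuous_on UNIV (\<lambda>k. S *v k)"
    by (intro linear_continuous_on linear_linear[THEN iffD2] matrix_vector_mul_linear)
  have m: "?f \<in> borel_measurable borel"
    by (intro borel_measurable_continuous_onI continuous_intros cont)
  have "(transpose T *v q) \<bullet> w = q \<bullet> (T *v w)" for q
    by (simp add: dot_lmul_matrix)
  then have eq: "?f (transpose T *v q) = exp (- a * of_real (q \<bullet> q) + \<i> * of_real (q \<bullet> (T *v w)))" for q
    by (simp only: S)
  have dT: "det (transpose T) \<noteq> 0" using T by (simp add: det_transpose)
  show "integrable lborel ?f"
    by (subst lborel_integral_linear(2)[OF dT m, symmetric], subst eq)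
       (rule gaussian_fourier_euclidean(1)[OF a])
  show "(LINT k|lborel. ?f k) = of_real \<bar>det T\<bar> * (of_real (sqrt pi) / csqrt a) ^ 3
        * exp (- (of_real ((T *v w) \<bullet> (T *v w)) / (4 * a)))"
    by (subst lborel_integral_linear(1)[OF dT m], subst eq, subst gaussian_fourier_euclidean(2)[OF a])
       (simp add: scaleR_conv_of_real det_transpose)
qed

text \<open>Multiplication by a Gaussian on the Fourier side is convolution on the space side: the
  phase inside \<open>fourier s\<close> merges with the character and replaces \<open>w\<close> by
  \<open>w - y\<close>. The Gaussian in \<open>k\<close> and the integrable \<open>s\<close> in
  \<open>y\<close> justify the exchange.\<close>

lemma gaussian_fourier_multiplier:
  fixes S T :: "real^3^3" and w :: "real^3" and s :: "real^3 \<Rightarrow> complex"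
  assumes a: "Re a > 0" and T: "det T \<noteq> 0"
    and S: "\<And>q. (transpose T *v q) \<bullet> (S *v (transpose T *v q)) = q \<bullet> q"
    and s: "integrable lborel s"
  shows "(LINT k|lborel. fourier s k * exp (- a * of_real (k \<bullet> (S *v k)) + \<i> * of_real (k \<bullet> w)))
    = (LINT y|lborel. s y * (of_real \<bar>det T\<bar> * (of_real (sqrt pi) / csqrt a) ^ 3
        * exp (- (of_real ((T *v (w - y)) \<bullet> (T *v (w - y))) / (4 * a)))))"
proof -
  define e where "e = (\<lambda>w k. exp (- a * of_real (k \<bullet> (S *v k)) + \<i> * of_real (k \<bullet> w)))"
  have cont: "continuous_on UNIV (\<lambda>k. S *v k)"
    by (intro linear_continuous_on linear_linear[THEN iffD2] matrix_vector_mul_linear)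
  have em[measurable]: "e w \<in> borel_measurable borel" for w
    unfolding e_def by (intro borel_measurable_continuous_onI continuous_intros cont)
  have [measurable]: "s \<in> borel_measurable borel" using s by auto
  have ei: "integrable lborel (\<lambda>k. norm (e w k))"
    unfolding e_def by (intro integrable_norm gaussian_fourier_quadratic(1)[OF a T S])
  have "(LINT k|lborel. fourier s k * e w k) =
     (LINT k|lborel. LINT y|lborel. s y * exp (- (\<i> * of_real (k \<bullet> y))) * e w k)"
    unfolding fourier_def by simp
  also have "\<dots> = (LINT y|lborel. LINT k|lborel. s y * exp (- (\<i> * of_real (k \<bullet> y))) * e w k)"
    by (rule Fubini_lborel_dominated[where f="\<lambda>k. norm (e w k)" and g="\<lambda>y. norm (s y)"])
       (use ei s in \<open>auto simp: norm_mult norm_exp_eq_Re\<close>)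
  also have "\<dots> = (LINT y|lborel. s y * (LINT k|lborel. e (w - y) k))"
    by (intro Bochner_Integration.integral_cong refl, subst integral_mult_right_zero[symmetric])
       (simp add: e_def exp_add exp_diff exp_minus inner_diff_right right_diff_distrib field_simps)
  finally show ?thesis
    unfolding e_def by (simp only: gaussian_fourier_quadratic(2)[OF a T S])
qed

section \<open>Gaussian regularisation and the square norm of the transform\<close>

definition gauss :: "real^3 \<Rightarrow> real" where "gauss u = sqrt pi ^ 3 * exp (- (u \<bullet> u) / 4)"

text \<open>\<open>gauss\<close> is the Fourier transform of \<open>exp (- (k \<bullet> k))\<close>.
  It is left unnormalised, because its mass is then the constant of Fourier inversion.\<close>

lemma gauss_integral: "has_bochner_integral lborel gauss ((2 * pi) ^ 3)"
proof -
  have a: "Re (complex_of_real (1 / 4)) > 0" by simp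
  have r: "csqrt (of_real (1 / 4)) = of_real (1 / 2)"
    by (subst csqrt_of_real) (simp_all add: real_sqrt_divide)
  have "has_bochner_integral lborel (\<lambda>u::real^3. complex_of_real (exp (- (u \<bullet> u) / 4))) (of_real ((sqrt pi * 2) ^ 3))"
    using gaussian_fourier_euclidean[OF a, of "0::real^3"]
    unfolding has_bochner_integral_iff r by (simp add: exp_of_real[symmetric])
  then have hb: "has_bochner_integral lborel (\<lambda>u::real^3. exp (- (u \<bullet> u) / 4)) ((sqrt pi * 2) ^ 3)"
    unfolding has_bochner_integral_iff complex_of_real_integrable_eq integral_complex_of_real of_real_eq_iff .
  have "has_bochner_integral lborel (\<lambda>u::real^3. sqrt pi ^ 3 * exp (- (u \<bullet> u) / 4)) (sqrt pi ^ 3 * (sqrt pi * 2) ^ 3)"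
    by (rule has_bochner_integral_mult_right) (rule hb)
  moreover have "sqrt pi ^ 3 * (sqrt pi * 2) ^ 3 = (2 * pi) ^ 3"
    unfolding power_mult_distrib[symmetric] by (simp add: mult_ac flip: mult.assoc)
  ultimately show ?thesis by (simp only: gauss_def[abs_def])
qed

lemma gauss_nonneg[simp]: "gauss u \<ge> 0" by (simp add: gauss_def)

lemma gauss_measurable[measurable]: "gauss \<in> borel_measurable borel"
  unfolding gauss_def[abs_def] by measurable

lemma mat_mult_vector: "(mat r :: real^3^3) *v u = r *\<^sub>R u"
  by (simp add: vec_eq_iff matrix_vector_mult_def mat_def sum_3 forall_3)

lemma gauss_scale:
  fixes g :: "real^3 \<Rightarrow> complex"
  assumes [measurable]: "g \<in> borel_measurable borel" and h: "h > 0"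
  shows "(LINT x|lborel. g x * of_real (gauss ((1 / h) *\<^sub>R (x - y)) / h ^ 3))
    = (LINT u|lborel. g (y + h *\<^sub>R u) * of_real (gauss u))"
proof -
  define T where "T = (mat h :: real^3^3)"
  have T: "T *v u = h *\<^sub>R u" for u by (simp add: T_def mat_mult_vector)
  have dT: "det T = h ^ 3" by (simp add: T_def det_3 mat_def power3_eq_cube)
  have "(LINT x|lborel. g x * of_real (gauss ((1 / h) *\<^sub>R (x - y)) / h ^ 3))
     = (LINT x|lborel. g (y + x) * of_real (gauss ((1 / h) *\<^sub>R (y + x - y)) / h ^ 3))"
    by (rule lborel_integral_translate[symmetric]) measurable
  also have "\<dots> = \<bar>det T\<bar> *\<^sub>R (LINT u|lborel. g (y + T *v u) * of_real (gauss ((1 / h) *\<^sub>R (y + T *v u - y)) / h ^ 3))"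
    by (rule lborel_integral_linear(1)) (use h dT in auto)
  also have "\<dots> = (LINT u|lborel. g (y + h *\<^sub>R u) * of_real (gauss u))"
  proof -
    have "\<bar>h ^ 3\<bar> *\<^sub>R (a * of_real (r / h ^ 3)) = a * of_real r" for a :: complex and r
      using h by (simp add: scaleR_conv_of_real)
    moreover have "(1 / h) *\<^sub>R (y + h *\<^sub>R u - y) = u" for u
      using h by simp
    ultimately show ?thesis
      unfolding T dT integral_scaleR_right[symmetric] by (simp only:)
  qed
  finally show ?thesis .
qed

text \<open>The case \<open>S = T = mat 1\<close> of the multiplier formula. The damped inverse
  transform is \<open>s\<close> smeared by a kernel of width \<open>h\<close> and mass
  \<open>(2 * pi) ^ 3\<close>.\<close>

lemma gaussian_regularised_fourier:
  fixes s :: "real^3 \<Rightarrow> complex"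
  assumes s: "integrable lborel s" and h: "h > 0"
  shows "(LINT k|lborel. fourier s k * (of_real (exp (- h\<^sup>2 * (k \<bullet> k))) * iexp (k \<bullet> x)))
    = (LINT y|lborel. s y * of_real (gauss ((1 / h) *\<^sub>R (x - y)) / h ^ 3))"
proof -
  define c where "c = complex_of_real (h\<^sup>2)"
  have c: "Re c > 0" using h by (simp add: c_def)
  have rc: "csqrt c = of_real h" unfolding c_def using h by (subst csqrt_of_real) auto
  have I: "det (mat 1 :: real^3^3) \<noteq> 0"
    "(transpose (mat 1) *v q) \<bullet> ((mat 1 :: real^3^3) *v (transpose (mat 1) *v q)) = q \<bullet> q" for q :: "real^3"
    by (simp_all add: transpose_mat)
  have e: "of_real (exp (- h\<^sup>2 * (k \<bullet> k))) * iexp (k \<bullet> x)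
      = exp (- c * of_real (k \<bullet> (mat 1 *v k)) + \<i> * of_real (k \<bullet> x))" for k :: "real^3"
    unfolding exp_add by (simp add: c_def exp_of_real[symmetric])
  have g: "of_real \<bar>det (mat 1 :: real^3^3)\<bar> * (of_real (sqrt pi) / csqrt c) ^ 3
        * exp (- (of_real (((mat 1 :: real^3^3) *v (x - y)) \<bullet> (mat 1 *v (x - y))) / (4 * c)))
      = complex_of_real (gauss ((1 / h) *\<^sub>R (x - y)) / h ^ 3)" for y
  proof -
    have "exp (- (of_real ((x - y) \<bullet> (x - y)) / (4 * c))) = complex_of_real (exp (- (((1 / h) *\<^sub>R (x - y)) \<bullet> ((1 / h) *\<^sub>R (x - y))) / 4))"
      by (simp add: c_def exp_of_real[symmetric] power2_eq_square mult_ac)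
    then show ?thesis unfolding rc by (simp add: gauss_def power_divide)
  qed
  show ?thesis unfolding e gaussian_fourier_multiplier[OF c I s] g ..
qed

text \<open>The upper bound of Plancherel. Under Gaussian damping, the integral of the squared
  transform becomes a double integral of \<open>cnj (s x) * s y\<close> against
  \<open>H r (x - y)\<close>. The inequality \<open>2 * a * b \<le> a^2 + b^2\<close> and the mass
  of \<open>H r\<close> bound it independently of \<open>r\<close>, and Fatou's lemma removes the
  damping.\<close>

lemma fourier_square_integrable:
  fixes s :: "real^3 \<Rightarrow> complex"
  assumes s: "integrable lborel s" and s2: "integrable lborel (\<lambda>x. (norm (s x))\<^sup>2)"
  shows "integrable lborel (\<lambda>k. (norm (fourier s k))\<^sup>2)"
proof -
  have [measurable]: "s \<in> borel_measurable borel" using s by auto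
  define Z where "Z = (\<integral>\<^sup>+x. ennreal ((norm (s x))\<^sup>2) \<partial>lborel)"
  have Z: "Z < \<infinity>" using s2 unfolding Z_def integrable_iff_bounded by simp
  define u where "u = (\<lambda>x. ennreal ((norm (s x))\<^sup>2 / 2))"
  have [measurable]: "u \<in> borel_measurable borel" unfolding u_def by measurable
  define P where "P = ennreal ((2 * pi) ^ 3)"
  define H where "H = (\<lambda>r u. gauss ((1 / r) *\<^sub>R u) / r ^ 3)"
  have Hm[measurable]: "H r \<in> borel_measurable borel" for r unfolding H_def by measurable
  have H0: "H r u \<ge> 0" if "r > 0" for r u using that by (simp add: H_def)
  have Heven: "H r (- u) = H r u" for r u by (simp add: H_def gauss_def)
  have Hint: "(\<integral>\<^sup>+u. ennreal (H r u) \<partial>lborel) = P" if r: "r > 0" for r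
  proof -
    define S where "S = (mat (1 / r) :: real^3^3)"
    have S: "S *v u = (1 / r) *\<^sub>R u" for u by (simp add: S_def mat_mult_vector)
    have "det S \<noteq> 0" using r by (simp add: S_def det_3 mat_def)
    then have "integrable lborel (\<lambda>u. complex_of_real (gauss (S *v u)))"
      using gauss_integral by (subst lborel_integral_linear(2)) (auto simp: has_bochner_integral_iff)
    then have "integrable lborel (\<lambda>u. gauss ((1 / r) *\<^sub>R u))"
      unfolding S complex_of_real_integrable_eq .
    then have i: "integrable lborel (H r)" unfolding H_def by simp
    have "complex_of_real (integral\<^sup>L lborel (H r)) = of_real ((2 * pi) ^ 3)"
      using gauss_scale[of "\<lambda>_. 1" r 0] gauss_integral r
      by (simp add: H_def has_bochner_integral_iff del: of_real_divide)
    then have "integral\<^sup>L lborel (H r) = (2 * pi) ^ 3" unfolding of_real_eq_iff .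
    then show ?thesis using nn_integral_eq_integral[OF i] H0[OF r] by (simp add: P_def)
  qed
  have bound: "(\<integral>\<^sup>+k. ennreal ((norm (fourier s k))\<^sup>2 * exp (- r\<^sup>2 * (k \<bullet> k))) \<partial>lborel) \<le> P * Z"
    if r: "r > 0" for r
  proof -
    have c: "Re (complex_of_real (r\<^sup>2)) > 0" using r by simp
    define h where "h = (\<lambda>k::real^3. exp (- r\<^sup>2 * (k \<bullet> k)))"
    have hi: "integrable lborel h"
      using integrable_norm[OF gaussian_fourier_euclidean(1)[OF c, of "0::real^3"]]
      by (simp add: h_def norm_exp_eq_Re flip: of_real_power)
    have hm[measurable]: "h \<in> borel_measurable borel" using hi by auto
    define L where "L = (LINT x|lborel. norm (s x))"
    have L: "norm (fourier s k) \<le> L" for k unfolding L_def by (rule norm_fourier_le)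
    have int: "integrable lborel (\<lambda>k. (norm (fourier s k))\<^sup>2 * h k)"
    proof (rule integrable_dominated[OF integrable_mult_right[OF hi, of "L\<^sup>2"]])
      show "AE k in lborel. norm ((norm (fourier s k))\<^sup>2 * h k) \<le> norm (L\<^sup>2 * h k)"
        using L by (intro AE_I2) (simp add: h_def norm_mult mult_right_mono power_mono)
    qed measurable
    define s' where "s' = (\<lambda>x. cnj (s x))"
    have [measurable]: "s' \<in> borel_measurable borel"
      unfolding s'_def by (rule borel_measurable_continuous_on[of cnj]) (auto intro: continuous_intros)
    have conj: "cnj (fourier s k) = (LINT x|lborel. s' x * iexp (k \<bullet> x))" for k
      unfolding fourier_def s'_def by (subst Bochner_Integration.integral_cnj[symmetric]) (simp add: exp_cnj)
    define F where "F = (\<lambda>k x. fourier s k * of_real (h k) * (s' x * iexp (k \<bullet> x)))"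
    have F: "complex_of_real ((norm (fourier s k))\<^sup>2 * h k) = (LINT x|lborel. F k x)" for k
    proof -
      have "(LINT x|lborel. F k x) = fourier s k * of_real (h k) * cnj (fourier s k)"
        unfolding F_def conj by (rule integral_mult_right_zero)
      then show ?thesis by (simp add: complex_norm_square del: of_real_power)
    qed
    have "complex_of_real (LINT k|lborel. (norm (fourier s k))\<^sup>2 * h k)
       = (LINT k|lborel. LINT x|lborel. F k x)"
      unfolding integral_complex_of_real[symmetric] F ..
    also have "\<dots> = (LINT x|lborel. LINT k|lborel. F k x)"
    proof (rule Fubini_lborel_dominated)
      show "case_prod F \<in> borel_measurable (borel \<Otimes>\<^sub>M borel)"
        unfolding F_def by measurable
      show "norm (F k x) \<le> (L * h k) * norm (s x)" for k x
        using L by (simp add: F_def s'_def norm_mult norm_exp_eq_Re h_def mult_right_mono)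
    qed (use s hi in auto)
    also have "\<dots> = (LINT x|lborel. cnj (s x) * (LINT y|lborel. s y * of_real (H r (x - y))))"
    proof (rule Bochner_Integration.integral_cong[OF refl])
      fix x
      have "(LINT k|lborel. F k x) = cnj (s x) *
          (LINT k|lborel. fourier s k * (of_real (h k) * iexp (k \<bullet> x)))"
        unfolding integral_mult_right_zero[symmetric] F_def s'_def by (simp only: mult_ac)
      also have "\<dots> = cnj (s x) * (LINT y|lborel. s y * of_real (H r (x - y)))"
        unfolding h_def gaussian_regularised_fourier[OF s r] H_def ..
      finally show "(LINT k|lborel. F k x) = cnj (s x) * (LINT y|lborel. s y * of_real (H r (x - y)))" .
    qed
    finally have E: "complex_of_real (LINT k|lborel. (norm (fourier s k))\<^sup>2 * h k)
       = (LINT x|lborel. cnj (s x) * (LINT y|lborel. s y * of_real (H r (x - y))))" (is "complex_of_real ?R = ?I") .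
    have "?R \<ge> 0" by (simp add: h_def)
    \<comment> \<open>The left side is real and nonnegative, so nothing is lost in taking moduli.
      From here on all integrands are nonnegative and Tonelli applies.\<close>
    then have R: "?R = norm ?I" unfolding E[symmetric] norm_of_real by simp
    have "(\<integral>\<^sup>+k. ennreal ((norm (fourier s k))\<^sup>2 * h k) \<partial>lborel) = ennreal ?R"
      by (rule nn_integral_eq_integral[OF int]) (simp add: h_def)
    also have "\<dots> \<le> (\<integral>\<^sup>+x. norm (cnj (s x) * (LINT y|lborel. s y * of_real (H r (x - y)))) \<partial>lborel)"
      unfolding R by (rule ennreal_norm_integral_le)
    also have "\<dots> \<le> (\<integral>\<^sup>+x. (\<integral>\<^sup>+y. ennreal (norm (s x) * (norm (s y) * H r (x - y))) \<partial>lborel) \<partial>lborel)"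
    proof (rule nn_integral_mono)
      fix x
      have "ennreal (norm (LINT y|lborel. s y * of_real (H r (x - y)))) \<le> (\<integral>\<^sup>+y. norm (s y * of_real (H r (x - y))) \<partial>lborel)"
        by (rule ennreal_norm_integral_le)
      then have "ennreal (norm (s x)) * ennreal (norm (LINT y|lborel. s y * of_real (H r (x - y))))
         \<le> ennreal (norm (s x)) * (\<integral>\<^sup>+y. norm (s y * of_real (H r (x - y))) \<partial>lborel)"
        by (rule mult_left_mono) simp
      then show "ennreal (norm (cnj (s x) * (LINT y|lborel. s y * of_real (H r (x - y)))))
         \<le> (\<integral>\<^sup>+y. ennreal (norm (s x) * (norm (s y) * H r (x - y))) \<partial>lborel)"
        using H0[OF r] by (simp add: norm_mult ennreal_mult nn_integral_cmult)
    qed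
    also have "\<dots> \<le> (\<integral>\<^sup>+x. (\<integral>\<^sup>+y. (u x * H r (x - y) + u y * H r (x - y)) \<partial>lborel) \<partial>lborel)"
    proof (intro nn_integral_mono)
      fix x y
      have "0 \<le> (norm (s x) - norm (s y))\<^sup>2" by simp
      then have "norm (s x) * norm (s y) \<le> (norm (s x))\<^sup>2 / 2 + (norm (s y))\<^sup>2 / 2"
        by (simp add: power2_diff)
      from mult_right_mono[OF this H0[OF r, of "x - y"]]
      have "norm (s x) * (norm (s y) * H r (x - y)) \<le> (norm (s x))\<^sup>2 / 2 * H r (x - y) + (norm (s y))\<^sup>2 / 2 * H r (x - y)"
        by (simp add: algebra_simps)
      from ennreal_leI[OF this] show "ennreal (norm (s x) * (norm (s y) * H r (x - y)))
        \<le> u x * H r (x - y) + u y * H r (x - y)"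
        using H0[OF r] by (simp add: u_def ennreal_plus[symmetric] ennreal_mult[symmetric] del: ennreal_plus)
    qed
    also have "\<dots> = (\<integral>\<^sup>+x. (\<integral>\<^sup>+y. u x * H r (x - y) \<partial>lborel) \<partial>lborel)
        + (\<integral>\<^sup>+x. (\<integral>\<^sup>+y. u y * H r (x - y) \<partial>lborel) \<partial>lborel)"
      by (simp add: nn_integral_add)
    also have "(\<integral>\<^sup>+x. (\<integral>\<^sup>+y. u y * H r (x - y) \<partial>lborel) \<partial>lborel)
       = (\<integral>\<^sup>+y. (\<integral>\<^sup>+x. u y * H r (x - y) \<partial>lborel) \<partial>lborel)"
      by (rule lborel_pair.Fubini') measurable
    also have "(\<integral>\<^sup>+y. (\<integral>\<^sup>+x. u y * H r (x - y) \<partial>lborel) \<partial>lborel)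
       = (\<integral>\<^sup>+y. u y * P \<partial>lborel)"
    proof (rule nn_integral_cong)
      fix y
      have "(\<integral>\<^sup>+x. H r (x - y) \<partial>lborel) = (\<integral>\<^sup>+x. H r x \<partial>lborel)"
        using nn_integral_distr[of "(+) (- y)" lborel borel "\<lambda>x. ennreal (H r x)"] by (simp add: lborel_distr_plus)
      then show "(\<integral>\<^sup>+x. u y * H r (x - y) \<partial>lborel) = u y * P"
        by (simp add: nn_integral_cmult Hint[OF r])
    qed
    also have "(\<integral>\<^sup>+x. (\<integral>\<^sup>+y. u x * H r (x - y) \<partial>lborel) \<partial>lborel)
       = (\<integral>\<^sup>+x. u x * P \<partial>lborel)"
    proof (rule nn_integral_cong)
      fix x
      have "H r (x - y) = H r (- x + y)" for y using Heven[of r "x - y"] by simp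
      then have "(\<integral>\<^sup>+y. H r (x - y) \<partial>lborel) = (\<integral>\<^sup>+y. H r y \<partial>lborel)"
        using nn_integral_distr[of "(+) (- x)" lborel borel "\<lambda>x. ennreal (H r x)"] by (simp add: lborel_distr_plus)
      then show "(\<integral>\<^sup>+y. u x * H r (x - y) \<partial>lborel) = u x * P"
        by (simp add: nn_integral_cmult Hint[OF r])
    qed
    also have "(\<integral>\<^sup>+x. u x * P \<partial>lborel)
        + (\<integral>\<^sup>+x. u x * P \<partial>lborel)
      = (\<integral>\<^sup>+x. P * ennreal ((norm (s x))\<^sup>2) \<partial>lborel)"
      by (subst nn_integral_add[symmetric], measurable)
         (intro nn_integral_cong, simp add: u_def P_def ennreal_mult[symmetric] ennreal_plus[symmetric] del: ennreal_plus)
    also have "\<dots> = P * Z"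
      by (simp add: Z_def nn_integral_cmult)
    finally show ?thesis unfolding h_def .
  qed
  have "(\<integral>\<^sup>+k. ennreal ((norm (fourier s k))\<^sup>2) \<partial>lborel)
     = (\<integral>\<^sup>+k. liminf (\<lambda>n. ennreal ((norm (fourier s k))\<^sup>2 * exp (- (1 / real (Suc n))\<^sup>2 * (k \<bullet> k)))) \<partial>lborel)"
  proof (intro nn_integral_cong)
    fix k :: "real^3"
    have "(\<lambda>n. (norm (fourier s k))\<^sup>2 * exp (- (1 / real (Suc n))\<^sup>2 * (k \<bullet> k))) \<longlonglongrightarrow> (norm (fourier s k))\<^sup>2 * exp (- 0\<^sup>2 * (k \<bullet> k))"
      by (intro tendsto_intros LIMSEQ_Suc lim_1_over_n)
    then have "(\<lambda>n. ennreal ((norm (fourier s k))\<^sup>2 * exp (- (1 / real (Suc n))\<^sup>2 * (k \<bullet> k)))) \<longlonglongrightarrow> ennreal ((norm (fourier s k))\<^sup>2)"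
      by (intro tendsto_ennrealI) simp
    then show "ennreal ((norm (fourier s k))\<^sup>2) = liminf (\<lambda>n. ennreal ((norm (fourier s k))\<^sup>2 * exp (- (1 / real (Suc n))\<^sup>2 * (k \<bullet> k))))"
      using lim_imp_Liminf sequentially_bot by metis
  qed
  also have "\<dots> \<le> liminf (\<lambda>n. \<integral>\<^sup>+k. ennreal ((norm (fourier s k))\<^sup>2 * exp (- (1 / real (Suc n))\<^sup>2 * (k \<bullet> k))) \<partial>lborel)"
    by (rule nn_integral_liminf) measurable
  also have "\<dots> \<le> P * Z"
    by (intro Liminf_le always_eventually allI bound) simp_all
  also have "\<dots> < \<infinity>" using Z by (simp add: P_def ennreal_mult_less_top)
  finally have fin: "(\<integral>\<^sup>+k. ennreal ((norm (fourier s k))\<^sup>2) \<partial>lborel) < \<infinity>" .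
  show ?thesis
    by (rule integrableI_nonneg[OF _ _ fin]) simp_all
qed

section \<open>Laplace integrals in one real variable\<close>

lemma gaussian_antiderivative:
  fixes c :: complex
  assumes c: "Re c > 0"
  obtains P :: "real \<Rightarrow> complex" where
    "\<And>y. (P has_vector_derivative exp (- c * of_real (y\<^sup>2))) (at y)"
    "(P \<longlongrightarrow> of_real (sqrt pi) / csqrt c) at_top" "(P \<longlongrightarrow> 0) at_bot"
proof -
  define g where "g = (\<lambda>u::real. exp (- c * of_real (u\<^sup>2)))"
  have gi: "integrable lborel g"
    using gaussian_integrable_complex[OF c, of 0] by (simp add: g_def)
  have gI: "integral\<^sup>L lborel g = of_real (sqrt pi) / csqrt c"
    using gaussian_fourier_complex[OF c, of 0] by (simp add: g_def)
  have gc: "continuous_on S g" for S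
    unfolding g_def by (intro continuous_intros)
  have gm[measurable]: "g \<in> borel_measurable borel"
    by (rule borel_measurable_continuous_onI) (rule gc)
  \<comment> \<open>Up to normalisation this is the complex error function, taken as the integral
    from minus infinity. Its derivative concerns only a neighbourhood of the point, hence the base
    point \<open>y - 1\<close> in \<open>der\<close>; both limits follow by dominated
    convergence.\<close>
  define P where "P = (\<lambda>y. LINT u|lborel. indicator {..y} u *\<^sub>R g u)"
  have ind: "integrable lborel (\<lambda>u. indicator A u *\<^sub>R g u)" if "A \<in> sets borel" for A
    using that by (intro integrable_mult_indicator gi) auto
  have split: "P u = P l + integral {l..u} g" if "l \<le> u" for l u
  proof -
    have "P u = (LINT t|lborel. indicator {..l} t *\<^sub>R g t + indicator {l<..u} t *\<^sub>R g t)"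
      unfolding P_def using that
      by (intro Bochner_Integration.integral_cong refl) (auto simp: indicator_def)
    also have "\<dots> = P l + (LINT t|lborel. indicator {l<..u} t *\<^sub>R g t)"
      unfolding P_def by (intro Bochner_Integration.integral_add ind) auto
    also have "(LINT t|lborel. indicator {l<..u} t *\<^sub>R g t) = (LINT t|lborel. indicator {l..u} t *\<^sub>R g t)"
      by (rule integral_cong_AE)
         (use AE_lborel_singleton[of l] in \<open>auto simp: indicator_def elim!: eventually_mono\<close>)
    also have "\<dots> = integral {l..u} g"
      using set_borel_integral_eq_integral(2)[of "{l..u}" g] ind[of "{l..u}"]
      by (simp add: set_integrable_def set_lebesgue_integral_def)
    finally show ?thesis .
  qed
  have der: "(P has_vector_derivative g y) (at y)" for y
  proof -
    have "((\<lambda>u. P (y - 1) + integral {y - 1..u} g) has_vector_derivative g y) (at y within {y - 1..y + 1})"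
      using has_vector_derivative_add[OF has_vector_derivative_const
          integral_has_vector_derivative[OF gc, of y "y - 1" "y + 1"]] by simp
    then have "(P has_vector_derivative g y) (at y within {y - 1..y + 1})"
      by (rule has_vector_derivative_transform[rotated 2]) (auto intro: split)
    then show ?thesis
      by (subst (asm) at_within_interior) (auto simp: )
  qed
  have top: "(P \<longlongrightarrow> integral\<^sup>L lborel g) at_top"
    unfolding P_def
  proof (rule integral_dominated_convergence_at_top[where w="\<lambda>x. norm (g x)"])
    show "AE x in lborel. ((\<lambda>y. indicator {..y} x *\<^sub>R g x) \<longlongrightarrow> g x) at_top"
    proof (rule AE_I2)
      fix x :: real
      show "((\<lambda>y. indicator {..y} x *\<^sub>R g x) \<longlongrightarrow> g x) at_top"
        by (rule tendsto_eventually, rule eventually_mono[OF eventually_ge_at_top[of x]]) simp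
    qed
    show "\<forall>\<^sub>F y in at_top. AE x in lborel. norm (indicator {..y} x *\<^sub>R g x) \<le> norm (g x)"
      by (intro always_eventually allI AE_I2) (auto simp: indicator_def)
  qed (use gi in auto)
  have "((\<lambda>y. P (- y)) \<longlongrightarrow> (LINT x::real|lborel. 0)) at_top"
    unfolding P_def
  proof (rule integral_dominated_convergence_at_top[where w="\<lambda>x. norm (g x)"])
    show "AE x in lborel. ((\<lambda>y. indicator {..- y} x *\<^sub>R g x) \<longlongrightarrow> 0) at_top"
    proof (rule AE_I2)
      fix x :: real
      show "((\<lambda>y. indicator {..- y} x *\<^sub>R g x) \<longlongrightarrow> 0) at_top"
        by (rule tendsto_eventually, rule eventually_mono[OF eventually_gt_at_top[of "- x"]]) simp
    qed
    show "\<forall>\<^sub>F y in at_top. AE x in lborel. norm (indicator {..- y} x *\<^sub>R g x) \<le> norm (g x)"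
      by (intro always_eventually allI AE_I2) (auto simp: indicator_def)
  qed (use gi in auto)
  then have bot: "(P \<longlongrightarrow> 0) at_bot"
    by (simp add: filterlim_at_bot_mirror)
  show ?thesis using that[of P] der top bot unfolding gI by (simp add: g_def)
qed

lemma integrable_exp_neg:
  fixes c :: real
  assumes "c > 0"
  shows "integrable lborel (\<lambda>t. indicator {0<..} t * exp (- c * t))"
proof -
  have "integrable lborel (\<lambda>t. indicator {0..} t * exp (- c * t))"
    by (intro integrable_lborel_has_integral[OF _ _ _ has_integral_exp_minus_to_infinity[OF assms]]) auto
  then show ?thesis
    by (rule integrable_dominated) (auto simp: indicator_def)
qed

text \<open>The weight left in the Laplace variable \<open>t\<close> after the Gaussian integral
  over \<open>k\<close>: the three coordinates produce \<open>t powr (- 3 / 2)\<close>, the spatial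
  Gaussian gives \<open>a / t\<close>, and the drift together with the Laplace factor gives
  \<open>b * t\<close>. The complex \<open>c\<close> enters only as a common scale of the
  exponent.\<close>

definition heat_weight :: "complex \<Rightarrow> real \<Rightarrow> real \<Rightarrow> real \<Rightarrow> complex" where
  "heat_weight c a b t = of_real (t powr (- 3 / 2)) * exp (- c * of_real (a / t + b * t))"

text \<open>The factor \<open>exp (- (r / t))\<close> beats the singularity
  \<open>t powr (- 3 / 2)\<close> at 0, and \<open>exp (- q * t)\<close> gives integrability at
  infinity; both rates are positive because \<open>Re c > 0\<close>.\<close>

lemma heat_weight_integrable:
  assumes c: "Re c > 0" and a: "a > 0" and b: "b > 0"
  shows "integrable lborel (\<lambda>t. indicator {0<..} t *\<^sub>R heat_weight c a b t)"
proof -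
  define r where "r = Re c * a"
  define q where "q = Re c * b"
  have r: "r > 0" and q: "q > 0" using assms by (auto simp: r_def q_def)
  have le: "t powr (- 3 / 2) * exp (- (r / t)) \<le> 2 * r powr (- 3 / 2)" if t: "t > 0" for t :: real
  proof -
    \<comment> \<open>In this variable the claim is \<open>x powr (3 / 2) \<le> 2 * exp x\<close>,
      with \<open>1 + x^2\<close> as an intermediate bound that covers both small and large
      \<open>x\<close>.\<close>
    define x where "x = r / t"
    have x: "x > 0" using r t by (simp add: x_def)
    have "x powr (3 / 2) \<le> 1 + x\<^sup>2"
    proof (cases "x \<le> 1")
      case True
      then have "x powr (3 / 2) \<le> 1 powr (3 / 2)" using x by (intro powr_mono2) auto
      then show ?thesis by (simp add: add_increasing2)
    next
      case False
      then have "x powr (3 / 2) \<le> x powr 2" by (intro powr_mono) auto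
      then show ?thesis using x by simp
    qed
    also have "\<dots> \<le> 2 * exp x"
      using exp_lower_Taylor_quadratic[of x] x by simp
    finally have "x powr (3 / 2) * exp (- x) \<le> 2"
      by (simp add: exp_minus field_simps)
    moreover have "t powr (- 3 / 2) = x powr (3 / 2) * r powr (- 3 / 2)"
      using r t by (simp add: x_def powr_divide powr_minus field_simps)
    ultimately have "t powr (- 3 / 2) * exp (- x) \<le> 2 * r powr (- 3 / 2)"
      using mult_right_mono[of "x powr (3 / 2) * exp (- x)" 2 "r powr (- 3 / 2)"] by (simp add: mult_ac)
    then show ?thesis by (simp add: x_def)
  qed
  have wnorm: "norm (heat_weight c a b t) \<le> 2 * r powr (- 3 / 2) * exp (- q * t)" if t: "t > 0" for t
  proof -
    have "norm (heat_weight c a b t) = t powr (- 3 / 2) * exp (- (r / t)) * exp (- q * t)"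
      using t by (simp add: heat_weight_def norm_mult norm_exp_eq_Re r_def q_def exp_add[symmetric] algebra_simps)
    then show ?thesis using mult_right_mono[OF le[OF t], of "exp (- q * t)"] by simp
  qed
  show ?thesis
  proof (rule integrable_dominated[OF integrable_mult_right[OF integrable_exp_neg[OF q], of "2 * r powr (- 3 / 2)"]])
    show "AE t in lborel. norm (indicator {0<..} t *\<^sub>R heat_weight c a b t)
        \<le> norm (2 * r powr (- 3 / 2) * (indicator {0<..} t * exp (- q * t)))"
      using wnorm r by (intro AE_I2) (auto simp: indicator_def abs_mult)
  qed (unfold heat_weight_def, measurable)
qed

text \<open>With \<open>y = sqrt (b t) - sqrt (a/t)\<close> and \<open>w = sqrt (b t) + sqrt (a/t)\<close> one has
  \<open>y' - w' = sqrt a t\<^sup>-\<^sup>3\<^sup>/\<^sup>2\<close> and \<open>a/t + b t = y\<^sup>2 + 2 sqrt (a b) = w\<^sup>2 - 2 sqrt (a b)\<close>, so an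
  antiderivative of the integrand is a combination of Gaussian antiderivatives at \<open>y\<close> and \<open>w\<close>.\<close>

lemma heat_weight_integral:
  assumes c: "Re c > 0" and a: "a > 0" and b: "b > 0"
  shows "(LINT t|lborel. indicator {0<..} t *\<^sub>R heat_weight c a b t)
    = of_real (sqrt pi) / (csqrt c * of_real (sqrt a)) * exp (- 2 * c * of_real (sqrt (a * b)))"
proof -
  obtain P where P: "\<And>y. (P has_vector_derivative exp (- c * of_real (y\<^sup>2))) (at y)"
    and Ptop: "(P \<longlongrightarrow> of_real (sqrt pi) / csqrt c) at_top" and Pbot: "(P \<longlongrightarrow> 0) at_bot"
    using gaussian_antiderivative[OF c] by blast
  define m where "m = sqrt (a * b)"
  define y where "y = (\<lambda>t. sqrt b * sqrt t - sqrt a / sqrt t)"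
  define w where "w = (\<lambda>t. sqrt b * sqrt t + sqrt a / sqrt t)"
  \<comment> \<open>The two squares differ from \<open>a / t + b * t\<close> by constants of
    opposite sign. The factors \<open>e1\<close> and \<open>e2\<close> undo these shifts, so that
    both terms of the derivative carry the same exponential \<open>E\<close> and only
    \<open>y' - w'\<close> remains.\<close>
  define e1 where "e1 = exp (- 2 * c * of_real m)"
  define e2 where "e2 = exp (2 * c * of_real m)"
  define F where "F = (\<lambda>t. e1 * P (y t) - e2 * P (w t))"
  define f where "f = (\<lambda>t. of_real (sqrt a) * heat_weight c a b t)"
  have F: "(F has_vector_derivative f t) (at t)" if t: "t > 0" for t
  proof -
    define E where "E = exp (- c * of_real (a / t + b * t))"
    define y' where "y' = sqrt b * (inverse (sqrt t) / 2) + sqrt a * (inverse (sqrt t) / 2) / t"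
    define w' where "w' = sqrt b * (inverse (sqrt t) / 2) - sqrt a * (inverse (sqrt t) / 2) / t"
    have st: "sqrt t * sqrt t = t" using t by simp
    have dy: "(y has_real_derivative y') (at t)"
      unfolding y_def y'_def using t st by (auto intro!: derivative_eq_intros simp: field_simps)
    have dw: "(w has_real_derivative w') (at t)"
      unfolding w_def w'_def using t st by (auto intro!: derivative_eq_intros simp: field_simps)
    have ysq: "(y t)\<^sup>2 = a / t + b * t - 2 * m" and wsq: "(w t)\<^sup>2 = a / t + b * t + 2 * m"
      using t a b by (simp_all add: y_def w_def m_def power2_diff power2_sum power_mult_distrib power_divide real_sqrt_mult)
    have g1: "exp (- c * of_real ((y t)\<^sup>2)) * e1 = E"
      unfolding ysq e1_def E_def exp_add[symmetric] by (simp add: algebra_simps)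
    have g2: "exp (- c * of_real ((w t)\<^sup>2)) * e2 = E"
      unfolding wsq e2_def E_def exp_add[symmetric] by (simp add: algebra_simps)
    have P1: "((\<lambda>t. P (y t)) has_vector_derivative (y' *\<^sub>R exp (- c * of_real ((y t)\<^sup>2)))) (at t)"
      using vector_diff_chain_at[OF dy[unfolded has_real_derivative_iff_has_vector_derivative] P]
      by (simp add: o_def)
    have P2: "((\<lambda>t. P (w t)) has_vector_derivative (w' *\<^sub>R exp (- c * of_real ((w t)\<^sup>2)))) (at t)"
      using vector_diff_chain_at[OF dw[unfolded has_real_derivative_iff_has_vector_derivative] P]
      by (simp add: o_def)
    have "(F has_vector_derivative e1 * (y' *\<^sub>R exp (- c * of_real ((y t)\<^sup>2))) - e2 * (w' *\<^sub>R exp (- c * of_real ((w t)\<^sup>2)))) (at t)"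
      unfolding F_def by (intro has_vector_derivative_diff has_vector_derivative_mult_right P1 P2)
    also have "e1 * (y' *\<^sub>R exp (- c * of_real ((y t)\<^sup>2))) - e2 * (w' *\<^sub>R exp (- c * of_real ((w t)\<^sup>2)))
       = y' *\<^sub>R (exp (- c * of_real ((y t)\<^sup>2)) * e1) - w' *\<^sub>R (exp (- c * of_real ((w t)\<^sup>2)) * e2)"
      by (simp add: mult_ac scaleR_conv_of_real)
    also have "\<dots> = (y' - w') *\<^sub>R E"
      unfolding g1 g2 by (simp add: algebra_simps)
    also have "y' - w' = sqrt a * t powr (- 3 / 2)"
    proof -
      have "t powr (3 / 2) = t powr 1 * t powr (1 / 2)" unfolding powr_add[symmetric] by simp
      also have "\<dots> = t * sqrt t" using t by (simp add: powr_half_sqrt)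
      finally have "t powr (- 3 / 2) = inverse (t * sqrt t)" by (simp add: powr_minus)
      then show ?thesis using t by (simp add: y'_def w'_def field_simps)
    qed
    finally show ?thesis by (simp add: f_def heat_weight_def E_def scaleR_conv_of_real mult_ac)
  qed
  \<comment> \<open>As \<open>t\<close> tends to 0, \<open>y\<close> tends to minus infinity and
    \<open>w\<close> to plus infinity; as \<open>t\<close> tends to infinity, both tend to plus
    infinity. The \<open>e2\<close> term therefore has the same limit at both ends and cancels,
    which leaves only the exponential \<open>e1\<close>.\<close>
  have lim0: "(F \<longlongrightarrow> e1 * 0 - e2 * (of_real (sqrt pi) / csqrt c)) (at_right 0)"
    unfolding F_def
  proof (intro tendsto_intros filterlim_compose[OF Pbot] filterlim_compose[OF Ptop])
    show "filterlim y at_bot (at_right 0)" unfolding y_def using a b by real_asymp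
    show "filterlim w at_top (at_right 0)" unfolding w_def using a b by real_asymp
  qed
  have limI: "(F \<longlongrightarrow> e1 * (of_real (sqrt pi) / csqrt c) - e2 * (of_real (sqrt pi) / csqrt c)) at_top"
    unfolding F_def
  proof (intro tendsto_intros filterlim_compose[OF Ptop])
    show "filterlim y at_top at_top" unfolding y_def using a b by real_asymp
    show "filterlim w at_top at_top" unfolding w_def using a b by real_asymp
  qed
  have "(LBINT t=0..\<infinity>. f t) = (e1 * (of_real (sqrt pi) / csqrt c) - e2 * (of_real (sqrt pi) / csqrt c))
      - (e1 * 0 - e2 * (of_real (sqrt pi) / csqrt c))"
  proof (rule interval_integral_FTC_integrable)
    show "(F has_vector_derivative f t) (at t)" if "0 < ereal t" for t
      using F that by simp
    show "isCont f t" if "0 < ereal t" for t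
      unfolding f_def heat_weight_def using that by (intro continuous_intros) auto
    have "einterval 0 \<infinity> = {0<..}" by (auto simp: einterval_def)
    then show "set_integrable lborel (einterval 0 \<infinity>) f"
      using integrable_mult_right[OF heat_weight_integrable[OF assms], of "of_real (sqrt a)"]
      by (simp add: set_integrable_def f_def)
    show "((F \<circ> real_of_ereal) \<longlongrightarrow> e1 * 0 - e2 * (of_real (sqrt pi) / csqrt c)) (at_right 0)"
      using lim0 unfolding zero_ereal_def by (simp add: ereal_tendsto_simps)
    show "((F \<circ> real_of_ereal) \<longlongrightarrow> e1 * (of_real (sqrt pi) / csqrt c) - e2 * (of_real (sqrt pi) / csqrt c)) (at_left \<infinity>)"
      using limI by (simp add: ereal_tendsto_simps)
  qed simp
  moreover have "(LBINT t=0..\<infinity>. f t) = (LINT t|lborel. indicator {0<..} t *\<^sub>R f t)"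
  proof -
    have "einterval 0 \<infinity> = {0<..}" by (auto simp: einterval_def)
    then show ?thesis by (simp add: interval_lebesgue_integral_def set_lebesgue_integral_def)
  qed
  moreover have "(LINT t|lborel. indicator {0<..} t *\<^sub>R f t) = of_real (sqrt a) * (LINT t|lborel. indicator {0<..} t *\<^sub>R heat_weight c a b t)"
    unfolding f_def by (subst integral_mult_right_zero[symmetric]) (simp add: scaleR_conv_of_real mult_ac)
  ultimately have E: "of_real (sqrt a) * (LINT t|lborel. indicator {0<..} t *\<^sub>R heat_weight c a b t) = e1 * (of_real (sqrt pi) / csqrt c)"
    (is "_ * ?I = _")
    by simp
  have "?I = of_real (sqrt a) * ?I / of_real (sqrt a)" using a by simp
  then show ?thesis unfolding E e1_def m_def by (simp add: mult_ac)
qed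

text \<open>Taking norms replaces \<open>w\<close> by its real part, so the third claim is the
  second one at \<open>of_real (Re w)\<close>. It governs the exchange of the Laplace and Fourier
  integrals.\<close>

lemma integral_exp_complex:
  fixes w :: complex
  assumes w: "Re w > 0"
  shows "integrable lborel (\<lambda>t. indicator {0<..} t *\<^sub>R exp (- of_real t * w))"
    and "(LINT t|lborel. indicator {0<..} t *\<^sub>R exp (- of_real t * w)) = 1 / w"
    and "(LINT t|lborel. norm (indicator {0<..} t *\<^sub>R exp (- of_real t * w))) = 1 / Re w"
proof -
  have int: "integrable lborel (\<lambda>t. indicator {0<..} t *\<^sub>R exp (- of_real t * w))"
    and eq: "(LINT t|lborel. indicator {0<..} t *\<^sub>R exp (- of_real t * w)) = 1 / w" if w: "Re w > 0" for w :: complex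
  proof -
    have w0: "w \<noteq> 0" using w by auto
    show int: "integrable lborel (\<lambda>t. indicator {0<..} t *\<^sub>R exp (- of_real t * w))"
      by (rule integrable_dominated[OF integrable_exp_neg[OF w]])
         (auto simp: indicator_def norm_exp_eq_Re mult.commute)
    have e: "einterval 0 \<infinity> = {0<..}" by (auto simp: einterval_def)
    define F where "F = (\<lambda>t. - exp (- of_real t * w) / w)"
    have "((\<lambda>t. exp (- Re w * t)) \<longlongrightarrow> 0) at_top" using w by real_asymp
    then have "((\<lambda>t. exp (- of_real t * w)) \<longlongrightarrow> 0) at_top"
      by (subst tendsto_norm_zero_iff[symmetric]) (simp add: norm_exp_eq_Re mult.commute)
    then have top: "(F \<longlongrightarrow> - 0 / w) at_top"
      unfolding F_def using w0 by (intro tendsto_intros)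
    have cont: "isCont F 0" unfolding F_def using w0 by (intro continuous_intros)
    have "(LBINT t=0..\<infinity>. exp (- of_real t * w)) = - 0 / w - F 0"
    proof (rule interval_integral_FTC_integrable)
      show "(F has_vector_derivative exp (- of_real t * w)) (at t)" for t
      proof -
        have "((\<lambda>t. - exp (- t * w) / w) has_field_derivative exp (- of_real t * w)) (at (of_real t))"
          using w0 by (auto intro!: derivative_eq_intros)
        then show ?thesis unfolding F_def by (rule has_vector_derivative_real_field)
      qed
      show "isCont (\<lambda>t. exp (- of_real t * w)) t" for t by (intro continuous_intros)
      show "set_integrable lborel (einterval 0 \<infinity>) (\<lambda>t. exp (- of_real t * w))"
        using int by (simp add: set_integrable_def e)
      show "((F \<circ> real_of_ereal) \<longlongrightarrow> F 0) (at_right 0)"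
        using cont unfolding zero_ereal_def
        by (simp add: ereal_tendsto_simps) (simp add: continuous_at filterlim_at_split)
      show "((F \<circ> real_of_ereal) \<longlongrightarrow> - 0 / w) (at_left \<infinity>)"
        using top by (simp add: ereal_tendsto_simps)
    qed simp
    then show "(LINT t|lborel. indicator {0<..} t *\<^sub>R exp (- of_real t * w)) = 1 / w"
      by (simp add: F_def interval_lebesgue_integral_def set_lebesgue_integral_def e)
  qed
  show "integrable lborel (\<lambda>t. indicator {0<..} t *\<^sub>R exp (- of_real t * w))" by (rule int[OF w])
  show "(LINT t|lborel. indicator {0<..} t *\<^sub>R exp (- of_real t * w)) = 1 / w" by (rule eq[OF w])
  have r: "Re (of_real (Re w)) > 0" using w by simp
  have n: "of_real (norm (indicator {0<..} t *\<^sub>R exp (- of_real t * w))) = indicator {0<..} t *\<^sub>R exp (- of_real t * of_real (Re w) :: complex)" for t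
    by (simp add: norm_exp_eq_Re indicator_def exp_of_real[symmetric])
  have "complex_of_real (LINT t|lborel. norm (indicator {0<..} t *\<^sub>R exp (- of_real t * w))) = 1 / of_real (Re w)"
    unfolding integral_complex_of_real[symmetric] n by (rule eq[OF r])
  also have "\<dots> = of_real (1 / Re w)" by simp
  finally show "(LINT t|lborel. norm (indicator {0<..} t *\<^sub>R exp (- of_real t * w))) = 1 / Re w"
    unfolding of_real_eq_iff .
qed

section \<open>The medium and bounds for the Green function\<close>

lemma medium_matrix_form:
  "k \<bullet> (C *v k) = k \<bullet> (medium_matrix v C *v k) + (v \<bullet> k)\<^sup>2"
  by (simp add: medium_matrix_def columnvector_def rowvector_def matrix_matrix_mult_def
      matrix_vector_mult_def inner_vec_def sum_3 power2_eq_square algebra_simps)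

text \<open>\<open>whitening\<close> says \<open>T\<^sup>TT = A\<^sup>-\<^sup>1\<close>, so \<open>norm (T *v w)\<close> is \<open>N(w)\<close>; the proofs use \<open>T\<close> in place of \<open>A\<^sup>-\<^sup>1\<close>.\<close>

locale radiation =
  fixes v :: "real^3" and C T :: "real^3^3" and s :: "real^3 \<Rightarrow> complex"
  assumes det_T: "det T \<noteq> 0"
    and whitening: "\<And>x y. (transpose T *v x) \<bullet> (medium_matrix v C *v (transpose T *v y)) = x \<bullet> y"
    and s_measurable[measurable]: "s \<in> borel_measurable borel"
    and s_square: "integrable lborel (\<lambda>x. (norm (s x))\<^sup>2)"
    and s_support: "compact (closure {x. s x \<noteq> 0})"
begin

definition wnorm :: "real^3 \<Rightarrow> real" where "wnorm w = norm (T *v w)"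

definition phase :: "real^3 \<Rightarrow> real" where
  "phase w = sqrt (1 + (wnorm v)\<^sup>2) * wnorm w - (T *v v) \<bullet> (T *v w)"

definition green :: "complex \<Rightarrow> real^3 \<Rightarrow> complex" where
  "green z w = of_real \<bar>det T\<bar> * exp (\<i> * z * of_real (phase w)) / of_real (4 * pi * wnorm w)"

lemma continuous_T[continuous_intros]: "continuous_on S f \<Longrightarrow> continuous_on S (\<lambda>x. T *v f x)"
  by (rule continuous_on_compose2[OF linear_continuous_on[of "(*v) T" UNIV]])
     (auto simp: linear_linear)

lemma wnorm_measurable[measurable]: "wnorm \<in> borel_measurable borel"
  unfolding wnorm_def[abs_def] by (intro borel_measurable_continuous_onI continuous_intros)

lemma phase_measurable[measurable]: "phase \<in> borel_measurable borel"
  unfolding phase_def[abs_def] wnorm_def by (intro borel_measurable_continuous_onI continuous_intros)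

lemma green_measurable[measurable]: "green z \<in> borel_measurable borel"
  unfolding green_def[abs_def] by measurable

lemma wnorm_lower: obtains c where "c > 0" "\<And>w. c * norm w \<le> wnorm w"
proof -
  have "inj ((*v) T)" using det_T det_nz_iff_inj[OF matrix_vector_mul_linear, of T] by simp
  from linear_inj_bounded_below_pos[OF matrix_vector_mul_linear this]
  show ?thesis using that unfolding wnorm_def by (metis mult.commute)
qed

lemma wnorm_eq_0_iff[simp]: "wnorm w = 0 \<longleftrightarrow> w = 0"
proof -
  obtain c where "c > 0" "c * norm w \<le> wnorm w" using wnorm_lower by blast
  then show ?thesis by (auto simp: wnorm_def zero_less_mult_iff mult_le_0_iff)
qed

lemma wnorm_0[simp]: "wnorm 0 = 0" by simp

lemma wnorm_nonneg[simp]: "wnorm w \<ge> 0" by (simp add: wnorm_def)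

lemma wnorm_pos: "w \<noteq> 0 \<Longrightarrow> wnorm w > 0"
  using wnorm_eq_0_iff[of w] wnorm_nonneg[of w] by linarith

text \<open>Coercivity: \<open>transpose T\<close> is onto, the form at
  \<open>transpose T *v q\<close> is \<open>q \<bullet> q\<close>, and the norm of that vector is at
  most \<open>B * norm q\<close>.\<close>

lemma form_lower: "\<exists>c>0. \<forall>k. c * (k \<bullet> k) \<le> k \<bullet> (medium_matrix v C *v k)"
proof -
  have dT: "det (transpose T) \<noteq> 0" using det_T by (simp add: det_transpose)
  then have inj: "inj ((*v) (transpose T))"
    using det_nz_iff_inj[OF matrix_vector_mul_linear, of "transpose T"] by (simp del: transpose_matrix_vector)
  then have surj: "surj ((*v) (transpose T))"
    by (rule linear_injective_imp_surjective[OF matrix_vector_mul_linear]) simp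
  obtain B where B: "B > 0" "\<And>q. norm (transpose T *v q) \<le> B * norm q"
    using linear_bounded_pos[OF matrix_vector_mul_linear] by blast
  have rep: "\<exists>q. k = transpose T *v q \<and> k \<bullet> (medium_matrix v C *v k) = q \<bullet> q" for k
    using surj whitening by (metis surjD)
  have "(1 / B\<^sup>2) * (k \<bullet> k) \<le> k \<bullet> (medium_matrix v C *v k)" for k
  proof -
    obtain q where q: "k = transpose T *v q" "k \<bullet> (medium_matrix v C *v k) = q \<bullet> q" using rep by blast
    have "(norm k)\<^sup>2 \<le> (B * norm q)\<^sup>2" unfolding q(1) by (intro power_mono B) simp
    then show ?thesis unfolding q(2) using B(1)
      by (simp add: dot_square_norm power_mult_distrib field_simps)
  qed
  then show "\<exists>c>0. \<forall>k. c * (k \<bullet> k) \<le> k \<bullet> (medium_matrix v C *v k)"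
    using B(1) by (intro exI[of _ "1 / B\<^sup>2"]) auto
qed

definition supp :: "(real^3) set" where "supp = closure {x. s x \<noteq> 0}"

lemma supp: "compact supp" "s x \<noteq> 0 \<Longrightarrow> x \<in> supp"
  using s_support closure_subset[of "{x. s x \<noteq> 0}"] by (auto simp: supp_def)

lemma supp_measurable[measurable]: "supp \<in> sets borel"
  using supp(1) by (simp add: compact_imp_closed borel_closed)

lemma supp_indicator_integrable: "integrable lborel (indicator supp :: real^3 \<Rightarrow> real)"
  using emeasure_compact_finite[OF supp(1)]
  by (intro integrable_real_indicator) (auto simp: less_top)

text \<open>On the support, which has finite measure, \<open>norm (s x)\<close> is at most its
  square plus 1.\<close>

lemma s_integrable: "integrable lborel s"
proof (rule integrable_dominated[OF
    Bochner_Integration.integrable_add[OF s_square supp_indicator_integrable]])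
  show "AE x in lborel. norm (s x) \<le> norm ((norm (s x))\<^sup>2 + indicator supp x)"
  proof (rule AE_I2)
    fix x
    have "2 * norm (s x) \<le> (norm (s x))\<^sup>2 + 1"
      using zero_le_power2[of "norm (s x) - 1"] by (simp add: power2_diff)
    then have "norm (s x) \<le> (norm (s x))\<^sup>2 + 1"
      using norm_ge_zero[of "s x"] by linarith
    then show "norm (s x) \<le> norm ((norm (s x))\<^sup>2 + indicator supp x)"
      using supp(2)[of x] by (cases "s x = 0") auto
  qed
qed simp

text \<open>Comes from \<open>a * b \<le> a^2 + b^2\<close> for \<open>a = norm (s y)\<close> and
  \<open>b = 1 / (c * norm (x - y))\<close>. The square of the singularity is integrable near
  \<open>x\<close> in dimension three; at distance above 1 it is at most \<open>1 / c^2\<close>, and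
  there only the support of \<open>s\<close> matters.\<close>

definition majorant :: "real \<Rightarrow> real^3 \<Rightarrow> real^3 \<Rightarrow> real" where
  "majorant c x y = (norm (s y))\<^sup>2 + (1 / c\<^sup>2) * (indicator supp y + indicator (cball 0 1) (x - y) * (1 / ((x - y) \<bullet> (x - y))))"

text \<open>By reflection and translation the singular part integrates to the same value for every
  \<open>x\<close>, so bounds drawn from the majorant are uniform in \<open>x\<close>.\<close>

lemma majorant_integrable: "integrable lborel (majorant c x)"
  and majorant_integral: "(LINT y|lborel. majorant c x y) = (LINT y|lborel. majorant c 0 y)"
proof -
  define h where "h = (\<lambda>w::real^3. indicator (cball 0 1) w * (1 / (w \<bullet> w)) :: real)"
  have h: "integrable lborel h" using integrable_inverse_square by (simp add: h_def)
  then have [measurable]: "h \<in> borel_measurable borel" by auto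
  have "h (- w) = h w" for w by (simp add: h_def indicator_def)
  from this[of "x - y" for x y] have sym: "h (x - y) = h (- x + y)" for x y by simp
  have hx: "has_bochner_integral lborel (\<lambda>y. h (x - y)) (integral\<^sup>L lborel h)" for x
    unfolding sym using h integrable_distr_eq[of "(+) (- x)" lborel borel h] integral_distr[of "(+) (- x)" lborel borel h]
    by (simp add: has_bochner_integral_iff lborel_distr_plus)
  have "has_bochner_integral lborel (majorant c x) ((LINT y|lborel. (norm (s y))\<^sup>2) + (1 / c\<^sup>2) * ((LINT y|lborel. indicator supp y) + integral\<^sup>L lborel h))" for x
    unfolding majorant_def[abs_def] h_def[THEN fun_cong, symmetric]
    by (intro has_bochner_integral_add has_bochner_integral_mult_right hx has_bochner_integral_integrable s_square supp_indicator_integrable)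
  then show "integrable lborel (majorant c x)" "(LINT y|lborel. majorant c x y) = (LINT y|lborel. majorant c 0 y)"
    by (auto simp: has_bochner_integral_iff)
qed

lemma majorant_bound:
  assumes c: "c > 0" and le: "\<And>w. c * norm w \<le> wnorm w"
  shows "norm (s y) / wnorm (x - y) \<le> majorant c x y"
\<comment> \<open>At \<open>x = y\<close> the quotient is 0, because \<open>wnorm 0 = 0\<close> and
  division by zero yields 0.\<close>
proof (cases "s y = 0 \<or> x = y")
  case True
  then show ?thesis by (auto simp: majorant_def)
next
  case False
  define r where "r = norm (x - y)"
  have r: "r > 0" using False by (simp add: r_def)
  have n: "0 < c * r" "c * r \<le> wnorm (x - y)" using c r le by (auto simp: r_def)
  have "norm (s y) / wnorm (x - y) \<le> norm (s y) * (1 / (c * r))"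
    using mult_left_mono[OF frac_le[OF zero_le_one order_refl n], of "norm (s y)"] by simp
  also have "\<dots> \<le> (norm (s y))\<^sup>2 + (1 / (c * r))\<^sup>2"
  proof -
    have "2 * (a * b) \<le> a\<^sup>2 + b\<^sup>2" for a b :: real
      using zero_le_power2[of "a - b"] by (simp add: power2_diff)
    moreover have "0 \<le> norm (s y) * (1 / (c * r))" using n by simp
    ultimately show ?thesis by (smt (verit))
  qed
  also have "(1 / (c * r))\<^sup>2 = (1 / c\<^sup>2) * (1 / r\<^sup>2)" by (simp add: power_divide power_mult_distrib)
  finally have le1: "norm (s y) / wnorm (x - y) \<le> (norm (s y))\<^sup>2 + (1 / c\<^sup>2) * (1 / r\<^sup>2)" .
  have "1 / r\<^sup>2 \<le> indicator supp y + indicator (cball 0 1) (x - y) * (1 / ((x - y) \<bullet> (x - y)))"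
  proof (cases "r \<le> 1")
    case True
    then show ?thesis by (simp add: r_def dot_square_norm)
  next
    case F: False
    then have "1 / r\<^sup>2 \<le> 1" by (simp add: power_le_one_iff)
    then show ?thesis using F False supp(2)[of y] by (simp add: r_def)
  qed
  from mult_left_mono[OF this, of "1 / c\<^sup>2"] le1 show ?thesis
    unfolding majorant_def by simp
qed

lemma singular_integrable: "integrable lborel (\<lambda>y. norm (s y) / wnorm (x - y))"
proof -
  obtain c where c: "c > 0" "\<And>w. c * norm w \<le> wnorm w" using wnorm_lower by blast
  show ?thesis
  proof (rule integrable_dominated[OF majorant_integrable[of c x]])
    show "AE y in lborel. norm (norm (s y) / wnorm (x - y)) \<le> norm (majorant c x y)"
      using majorant_bound[OF c] by (intro AE_I2) (auto intro: order_trans[OF _ abs_ge_self])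
  qed measurable
qed

lemma singular_bounded: obtains B where "\<And>x. (LINT y|lborel. norm (s y) / wnorm (x - y)) \<le> B"
proof -
  obtain c where c: "c > 0" "\<And>w. c * norm w \<le> wnorm w" using wnorm_lower by blast
  have "(LINT y|lborel. norm (s y) / wnorm (x - y)) \<le> (LINT y|lborel. majorant c 0 y)" for x
    unfolding majorant_integral[of c x, symmetric]
    by (intro integral_mono singular_integrable majorant_integrable majorant_bound c)
  then show ?thesis by (rule that)
qed

text \<open>Cauchy--Schwarz together with \<open>wnorm v \<le> sqrt (1 + (wnorm v)^2)\<close>.
  Consequently the exponential in \<open>green z\<close> has modulus at most 1 for every
  \<open>z\<close> in the closed upper half plane, which makes the bounds independent of the
  absorption.\<close>

lemma phase_nonneg: "phase w \<ge> 0"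
proof -
  have "(T *v v) \<bullet> (T *v w) \<le> wnorm v * wnorm w"
    unfolding wnorm_def by (rule norm_cauchy_schwarz)
  also have "wnorm v \<le> sqrt (1 + (wnorm v)\<^sup>2)" by (rule real_le_rsqrt) simp
  finally show ?thesis by (simp add: phase_def mult_right_mono)
qed

lemma norm_green_le:
  assumes "Im z \<ge> 0"
  shows "norm (green z w) \<le> \<bar>det T\<bar> / (4 * pi) / wnorm w"
proof -
  have "norm (exp (\<i> * z * of_real (phase w))) \<le> 1"
    using assms phase_nonneg[of w] by (simp add: norm_exp_eq_Re)
  from mult_left_mono[OF this, of "\<bar>det T\<bar>"] show ?thesis
    by (simp add: green_def norm_mult norm_divide divide_right_mono)
qed

end

lemma norm_heat_weight: "norm (heat_weight c a b t) = norm (heat_weight (of_real (Re c)) a b t)"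
  by (simp add: heat_weight_def norm_mult norm_exp_eq_Re)

text \<open>The modulus of the weight is the weight at \<open>Re c\<close>, so the closed form
  applies to it too. It provides the majorant for exchanging the Laplace integral with the integral
  over the source.\<close>

lemma heat_weight_norm_integral:
  assumes c: "Re c > 0" and a: "a > 0" and b: "b > 0"
  shows "(LINT t|lborel. norm (indicator {0<..} t *\<^sub>R heat_weight c a b t))
    = sqrt pi / (sqrt (Re c) * sqrt a) * exp (- 2 * Re c * sqrt (a * b))"
proof -
  have r: "Re (of_real (Re c)) > 0" using c by simp
  have n: "complex_of_real (norm (indicator {0<..} t *\<^sub>R heat_weight c a b t))
      = indicator {0<..} t *\<^sub>R heat_weight (of_real (Re c)) a b t" for t
    unfolding norm_scaleR norm_heat_weight[of c]
    by (simp add: indicator_def heat_weight_def norm_mult exp_of_real[symmetric])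
  have "complex_of_real (LINT t|lborel. norm (indicator {0<..} t *\<^sub>R heat_weight c a b t))
      = of_real (sqrt pi) / (csqrt (of_real (Re c)) * of_real (sqrt a)) * exp (- 2 * of_real (Re c) * of_real (sqrt (a * b)))"
    unfolding integral_complex_of_real[symmetric] n by (rule heat_weight_integral[OF r a b])
  also have "csqrt (of_real (Re c)) = of_real (sqrt (Re c))" using c by (subst csqrt_of_real) auto
  also have "of_real (sqrt pi) / (of_real (sqrt (Re c)) * of_real (sqrt a)) * exp (- 2 * of_real (Re c) * of_real (sqrt (a * b)))
      = complex_of_real (sqrt pi / (sqrt (Re c) * sqrt a) * exp (- 2 * Re c * sqrt (a * b)))"
    by (simp add: exp_of_real[symmetric])
  finally show ?thesis unfolding of_real_eq_iff .
qed

section \<open>From the Fourier integral to the Green function\<close>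

context radiation
begin

definition qform :: "real^3 \<Rightarrow> real" where "qform k = k \<bullet> (medium_matrix v C *v k)"

definition reduced :: "complex \<Rightarrow> real^3 \<Rightarrow> complex" where
  "reduced c k = of_real (qform k) / c + 2 * \<i> * of_real (v \<bullet> k) + c"

lemma qform_measurable[measurable]: "qform \<in> borel_measurable borel"
proof -
  have "continuous_on UNIV (\<lambda>k. medium_matrix v C *v k)"
    by (intro linear_continuous_on linear_linear[THEN iffD2] matrix_vector_mul_linear)
  then show ?thesis unfolding qform_def[abs_def]
    by (intro borel_measurable_continuous_onI continuous_intros)
qed

lemma reduced_measurable[measurable]: "reduced c \<in> borel_measurable borel"
  unfolding reduced_def[abs_def] by measurable

lemma symbol_reduced:
  assumes "Im z > 0"
  shows "of_real (k \<bullet> (C *v k)) - (z - of_real (v \<bullet> k))\<^sup>2 = (- \<i> * z) * reduced (- \<i> * z) k"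
proof -
  have "z \<noteq> 0" using assms by auto
  then show ?thesis
    by (simp add: medium_matrix_form[of k C v] reduced_def qform_def power2_eq_square algebra_simps)
qed

text \<open>For real \<open>k\<close> the drift term is purely imaginary and drops out, however
  large \<open>v\<close> is. What remains has the sign of \<open>Re c\<close> and grows like
  \<open>qform k\<close>.\<close>

lemma Re_reduced: "Re (reduced c k) = qform k * Re c / (norm c)\<^sup>2 + Re c"
  by (simp add: reduced_def Re_divide cmod_def)

lemma reduced_lower:
  assumes c: "Re c > 0"
  obtains d where "d > 0" "\<And>k. d * (1 + k \<bullet> k) \<le> Re (reduced c k)"
proof -
  obtain a where a: "a > 0" "\<And>k. a * (k \<bullet> k) \<le> qform k"
    using form_lower unfolding qform_def by blast
  have c0: "(norm c)\<^sup>2 > 0" using c by auto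
  define d where "d = min (Re c) (a * Re c / (norm c)\<^sup>2)"
  have "d * (1 + k \<bullet> k) \<le> Re (reduced c k)" for k
  proof -
    have "d * (k \<bullet> k) \<le> (a * Re c / (norm c)\<^sup>2) * (k \<bullet> k)"
      by (intro mult_right_mono) (auto simp: d_def)
    also have "\<dots> = (a * (k \<bullet> k)) * (Re c / (norm c)\<^sup>2)" by simp
    also have "\<dots> \<le> qform k * (Re c / (norm c)\<^sup>2)"
      using c c0 by (intro mult_right_mono a) auto
    finally have "d * (k \<bullet> k) \<le> qform k * Re c / (norm c)\<^sup>2" by simp
    moreover have "d \<le> Re c" by (simp add: d_def)
    ultimately show ?thesis by (simp add: Re_reduced distrib_left)
  qed
  moreover have "d > 0" using a c c0 by (simp add: d_def)
  ultimately show ?thesis using that by blast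
qed

text \<open>Both \<open>fourier s\<close> and \<open>1 / (1 + k \<bullet> k)\<close> are square
  integrable, so their product is integrable.\<close>

lemma fourier_weight_integrable: "integrable lborel (\<lambda>k. norm (fourier s k) / (1 + k \<bullet> k))"
proof (rule integrable_dominated[OF Bochner_Integration.integrable_add[OF
    fourier_square_integrable[OF s_integrable s_square] integrable_decay_weight]])
  show "AE k in lborel. norm (norm (fourier s k) / (1 + k \<bullet> k)) \<le> norm ((norm (fourier s k))\<^sup>2 + 1 / (1 + k \<bullet> k)\<^sup>2)"
  proof (rule AE_I2)
    fix k :: "real^3"
    define a where "a = norm (fourier s k)"
    define b where "b = 1 / (1 + k \<bullet> k)"
    have ab: "a \<ge> 0" "b \<ge> 0" by (auto simp: a_def b_def)
    then have "a * b \<ge> 0" by simp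
    moreover have "2 * (a * b) \<le> a\<^sup>2 + b\<^sup>2" using zero_le_power2[of "a - b"] by (simp add: power2_diff)
    ultimately have "a * b \<le> a\<^sup>2 + b\<^sup>2" by linarith
    then show "norm (norm (fourier s k) / (1 + k \<bullet> k)) \<le> norm ((norm (fourier s k))\<^sup>2 + 1 / (1 + k \<bullet> k)\<^sup>2)"
      by (simp add: a_def b_def power_divide)
  qed
qed measurable

lemma fourier_reduced_bound:
  assumes c: "Re c > 0"
  obtains K where "\<And>k. Re (reduced c k) > 0"
    "\<And>k. norm (fourier s k) / Re (reduced c k) \<le> norm (K * (norm (fourier s k) / (1 + k \<bullet> k)))"
proof -
  obtain d where d: "d > 0" "\<And>k. d * (1 + k \<bullet> k) \<le> Re (reduced c k)" using reduced_lower[OF c] by blast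
  have p: "0 < d * (1 + k \<bullet> k)" for k :: "real^3" using d(1) by (simp add: add_pos_nonneg)
  have "norm (fourier s k) / Re (reduced c k) \<le> norm (1 / d * (norm (fourier s k) / (1 + k \<bullet> k)))" for k
    using frac_le[OF norm_ge_zero order_refl p d(2), of "fourier s k" k] d(1) by (simp add: abs_mult)
  with p d(2) show ?thesis using that less_le_trans by blast
qed

lemma field_integrand_reduced:
  assumes z: "Im z > 0" and c: "c = - \<i> * z"
  shows "field_integrand v C z s x k
    = 1 / (c * of_real ((2 * pi) ^ 3)) * (fourier s k * iexp (k \<bullet> x) * (1 / reduced c k))"
  unfolding field_integrand_def symbol_reduced[OF z] c by (simp add: field_simps)

lemma field_integrand_integrable:
  assumes z: "Im z > 0"
  shows "integrable lborel (field_integrand v C z s x)"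
proof -
  define c where "c = - \<i> * z"
  have c: "Re c > 0" using z by (simp add: c_def)
  obtain K where K: "\<And>k. Re (reduced c k) > 0"
    "\<And>k. norm (fourier s k) / Re (reduced c k) \<le> norm (K * (norm (fourier s k) / (1 + k \<bullet> k)))"
    using fourier_reduced_bound[OF c] by blast
  have "integrable lborel (\<lambda>k. fourier s k * iexp (k \<bullet> x) * (1 / reduced c k))"
  proof (rule integrable_dominated[OF integrable_mult_right[OF fourier_weight_integrable, of K]])
    show "AE k in lborel. norm (fourier s k * iexp (k \<bullet> x) * (1 / reduced c k))
        \<le> norm (K * (norm (fourier s k) / (1 + k \<bullet> k)))"
    proof (rule AE_I2)
      fix k
      have "norm (fourier s k) / norm (reduced c k) \<le> norm (fourier s k) / Re (reduced c k)"
        using K(1)[of k] complex_Re_le_cmod[of "reduced c k"] by (intro frac_le) auto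
      also note K(2)
      finally show "norm (fourier s k * iexp (k \<bullet> x) * (1 / reduced c k))
        \<le> norm (K * (norm (fourier s k) / (1 + k \<bullet> k)))"
        by (simp add: norm_mult norm_divide norm_exp_eq_Re)
    qed
  qed measurable
  from integrable_mult_right[OF this, of "1 / (c * of_real ((2 * pi) ^ 3))"] show ?thesis
    unfolding field_integrand_reduced[OF z c_def] .
qed

definition vdot :: "real^3 \<Rightarrow> real" where "vdot w = (T *v v) \<bullet> (T *v w)"

lemma vdot_measurable[measurable]: "vdot \<in> borel_measurable borel"
  unfolding vdot_def[abs_def] by (intro borel_measurable_continuous_onI continuous_intros)

text \<open>The reciprocal of \<open>reduced c k\<close> is a Laplace integral of exponentials.
  Integrating norms in \<open>t\<close> returns \<open>1 / Re (reduced c k)\<close>, whose decay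
  suffices against \<open>fourier s\<close>, so the order may be exchanged. The imaginary drift term
  combines with the character into the displaced point
  \<open>x - (2 * t) *\<^sub>R v\<close>.\<close>

lemma field_at_laplace:
  assumes z: "Im z > 0" and c: "c = - \<i> * z"
  shows "field_at v C z s x = 1 / (c * of_real ((2 * pi) ^ 3)) *
    (LINT t|lborel. indicator {0<..} t *\<^sub>R (exp (- of_real t * c) *
      (LINT k|lborel. fourier s k * exp (- (of_real t / c) * of_real (qform k) + \<i> * of_real (k \<bullet> (x - (2 * t) *\<^sub>R v))))))"
proof -
  have cp: "Re c > 0" using z by (simp add: c)
  obtain K where rp: "\<And>k. Re (reduced c k) > 0"
    and K: "\<And>k. norm (fourier s k) / Re (reduced c k) \<le> norm (K * (norm (fourier s k) / (1 + k \<bullet> k)))"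
    using fourier_reduced_bound[OF cp] by blast
  define F where "F = (\<lambda>k t. fourier s k * iexp (k \<bullet> x) * (indicator {0<..} t *\<^sub>R exp (- of_real t * reduced c k)))"
  have Ft: "(LINT t|lborel. F k t) = fourier s k * iexp (k \<bullet> x) * (1 / reduced c k)" for k
    unfolding F_def integral_mult_right_zero integral_exp_complex(2)[OF rp] ..
  have "integrable (lborel \<Otimes>\<^sub>M lborel) (case_prod F)"
  proof (rule lborel_pair.Fubini_integrable)
    show "case_prod F \<in> borel_measurable (lborel \<Otimes>\<^sub>M lborel)"
      unfolding F_def by measurable
    have n: "(LINT t|lborel. norm (case_prod F (k, t))) = norm (fourier s k) * (1 / Re (reduced c k))" for k
      unfolding F_def prod.case norm_mult
      by (simp only: integral_mult_right_zero integral_exp_complex(3)[OF rp]) (simp add: norm_exp_eq_Re)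
    show "integrable lborel (\<lambda>k. LINT t|lborel. norm (case_prod F (k, t)))"
      unfolding n
    proof (rule integrable_dominated[OF integrable_mult_right[OF fourier_weight_integrable, of K]])
      show "AE k in lborel. norm (norm (fourier s k) * (1 / Re (reduced c k))) \<le> norm (K * (norm (fourier s k) / (1 + k \<bullet> k)))"
        using rp by (intro AE_I2 order_trans[OF _ K]) (simp add: less_imp_le)
    qed measurable
    show "AE k in lborel. integrable lborel (\<lambda>t. case_prod F (k, t))"
      unfolding F_def prod.case by (intro AE_I2 integrable_mult_right integral_exp_complex(1)[OF rp])
  qed
  from lborel_pair.Fubini_integral[OF this]
  have "(LINT k|lborel. LINT t|lborel. F k t) = (LINT t|lborel. LINT k|lborel. F k t)" by simp
  moreover have "(LINT k|lborel. F k t) = indicator {0<..} t *\<^sub>R (exp (- of_real t * c) *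
      (LINT k|lborel. fourier s k * exp (- (of_real t / c) * of_real (qform k) + \<i> * of_real (k \<bullet> (x - (2 * t) *\<^sub>R v)))))" for t
  proof -
    have "F k t = indicator {0<..} t *\<^sub>R (exp (- of_real t * c) *
      (fourier s k * exp (- (of_real t / c) * of_real (qform k) + \<i> * of_real (k \<bullet> (x - (2 * t) *\<^sub>R v)))))" for k
    proof -
      have "iexp (k \<bullet> x) * exp (- of_real t * reduced c k)
        = exp (- of_real t * c) * exp (- (of_real t / c) * of_real (qform k) + \<i> * of_real (k \<bullet> (x - (2 * t) *\<^sub>R v)))"
        unfolding exp_add[symmetric] reduced_def
        by (rule arg_cong[where f=exp]) (simp add: inner_diff_right inner_commute algebra_simps)
      then show ?thesis unfolding F_def by (simp add: scaleR_conv_of_real mult_ac)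
    qed
    then show ?thesis by (simp only: integral_scaleR_right integral_mult_right_zero)
  qed
  ultimately show ?thesis
    unfolding field_at_def field_integrand_reduced[OF z c] Ft[symmetric]
    by (simp only: integral_mult_right_zero)
qed

text \<open>The principal root of \<open>c\<close> has strictly positive real part, hence so has the
  quotient; this identifies the quotient as the principal root of its square.\<close>

lemma csqrt_divide_pos:
  assumes c: "Re c > 0" and t: "t > 0"
  shows "csqrt (of_real t / c) = of_real (sqrt t) / csqrt c"
proof (rule csqrt_unique)
  show "(of_real (sqrt t) / csqrt c)\<^sup>2 = of_real t / c"
    using t by (simp add: power_divide flip: of_real_power)
  have "Re (csqrt c) > 0"
  proof -
    have "Re (r\<^sup>2) \<le> 0" if "Re r = 0" for r :: complex
      using that by (simp add: Re_power2)
    from this[of "csqrt c"] have "Re (csqrt c) \<noteq> 0"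
      unfolding power2_csqrt using c by linarith
    then show ?thesis using Re_csqrt[of c] by linarith
  qed
  then show "0 < Re (of_real (sqrt t) / csqrt c) \<or> Re (of_real (sqrt t) / csqrt c) = 0 \<and> 0 \<le> Im (of_real (sqrt t) / csqrt c)"
    using t by (intro disjI1) (simp add: Re_divide add_pos_nonneg)
qed

text \<open>With \<open>w = x - y\<close>, the Gaussian at the displaced point and the Laplace
  factor combine into the exponent \<open>c * vdot w - c * (a w / t + b * t)\<close>. The integral
  of the heat weight contributes \<open>- 2 * c * sqrt (a w * b)\<close>, that is
  \<open>- c * sqrt b * wnorm w\<close>, so the total exponent is
  \<open>- c * phase w = \<i> * z * phase w\<close>.\<close>

theorem field_at_green:
  assumes z: "Im z > 0"
  shows "field_at v C z s x = (LINT y|lborel. s y * green z (x - y))"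
proof -
  define c where "c = - \<i> * z"
  have cp: "Re c > 0" and c0: "c \<noteq> 0" using z by (auto simp: c_def)
  define b where "b = 1 + (wnorm v)\<^sup>2"
  have b: "b > 0" by (simp add: b_def add_pos_nonneg)
  define a where "a = (\<lambda>w. (wnorm w)\<^sup>2 / 4)"
  \<comment> \<open>Collects the factors free of \<open>t\<close>: the Jacobian and the cube of
    \<open>sqrt pi / csqrt (t / c)\<close> with its power of \<open>t\<close> removed.\<close>
  define Q where "Q = of_real \<bar>det T\<bar> * (of_real (sqrt pi) * csqrt c) ^ 3"
  define H where "H = (\<lambda>y t. Q * s y * exp (c * of_real (vdot (x - y))) * (indicator {0<..} t *\<^sub>R heat_weight c (a (x - y)) b t))"
  have inner_eq: "indicator {0<..} t *\<^sub>R (exp (- of_real t * c) *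
      (LINT k|lborel. fourier s k * exp (- (of_real t / c) * of_real (qform k) + \<i> * of_real (k \<bullet> (x - (2 * t) *\<^sub>R v)))))
    = (LINT y|lborel. H y t)" for t
  proof (cases "t > 0")
    case True
    have tc: "Re (of_real t / c) > 0"
      using True cp c0 by (simp add: Re_divide complex_neq_0[symmetric])
    have st: "sqrt t ^ 3 = 1 / t powr (- 3 / 2)"
    proof -
      have "sqrt t ^ 3 = (t powr (1 / 2)) ^ 3" using True by (simp add: powr_half_sqrt)
      also have "\<dots> = t powr (3 / 2)" using powr_cube[of t "1 / 2"] by simp
      also have "\<dots> = 1 / t powr (- 3 / 2)"
      proof -
        have e: "- 3 / 2 = - (3 / 2 :: real)" by simp
        show ?thesis unfolding e powr_minus by (simp only: divide_inverse inverse_inverse_eq mult_1_left)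
      qed
      finally show ?thesis .
    qed
    have eq: "exp (- of_real t * c) * (s y * (of_real \<bar>det T\<bar> * (of_real (sqrt pi) / csqrt (of_real t / c)) ^ 3
        * exp (- (of_real ((T *v (x - (2 * t) *\<^sub>R v - y)) \<bullet> (T *v (x - (2 * t) *\<^sub>R v - y))) / (4 * (of_real t / c)))))) = H y t" for y
    proof -
      define w where "w = x - y"
      have "(of_real (sqrt pi) / csqrt (of_real t / c)) ^ 3 = (of_real (sqrt pi) * csqrt c) ^ 3 / of_real (sqrt t ^ 3)"
        unfolding csqrt_divide_pos[OF cp True] by (simp add: power_divide power_mult_distrib)
      also have "\<dots> = (of_real (sqrt pi) * csqrt c) ^ 3 * of_real (t powr (- 3 / 2))"
        unfolding st by simp
      finally have p: "(of_real (sqrt pi) / csqrt (of_real t / c)) ^ 3 = (of_real (sqrt pi) * csqrt c) ^ 3 * of_real (t powr (- 3 / 2))" .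
      have "T *v (x - (2 * t) *\<^sub>R v - y) = T *v w - (2 * t) *\<^sub>R (T *v v)"
        by (simp add: w_def matrix_vector_linear)
      then have sq: "(T *v (x - (2 * t) *\<^sub>R v - y)) \<bullet> (T *v (x - (2 * t) *\<^sub>R v - y)) = (wnorm w)\<^sup>2 - 4 * t * vdot w + 4 * t\<^sup>2 * (wnorm v)\<^sup>2"
        unfolding wnorm_def power2_norm_eq_inner
        by (simp add: vdot_def inner_diff_left inner_diff_right power2_eq_square inner_commute)
      have "- of_real t * c + - (of_real ((wnorm w)\<^sup>2 - 4 * t * vdot w + 4 * t\<^sup>2 * (wnorm v)\<^sup>2) / (4 * (of_real t / c)))
        = c * of_real (vdot w) + - c * of_real (a w / t + b * t)"
        using True c0 by (simp add: a_def b_def field_simps power2_eq_square)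
      then have e: "exp (- of_real t * c) * exp (- (of_real ((wnorm w)\<^sup>2 - 4 * t * vdot w + 4 * t\<^sup>2 * (wnorm v)\<^sup>2) / (4 * (of_real t / c))))
        = exp (c * of_real (vdot w)) * exp (- c * of_real (a w / t + b * t))"
        unfolding exp_add[symmetric] by (rule arg_cong)
      have "exp (- of_real t * c) * (s y * (of_real \<bar>det T\<bar> * (of_real (sqrt pi) / csqrt (of_real t / c)) ^ 3
        * exp (- (of_real ((T *v (x - (2 * t) *\<^sub>R v - y)) \<bullet> (T *v (x - (2 * t) *\<^sub>R v - y))) / (4 * (of_real t / c))))))
        = s y * of_real \<bar>det T\<bar> * (of_real (sqrt pi) * csqrt c) ^ 3 * of_real (t powr (- 3 / 2)) *
          (exp (- of_real t * c) * exp (- (of_real ((wnorm w)\<^sup>2 - 4 * t * vdot w + 4 * t\<^sup>2 * (wnorm v)\<^sup>2) / (4 * (of_real t / c)))))"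
        unfolding sq p by (simp only: mult_ac)
      also have "\<dots> = H y t"
        unfolding e using True by (simp add: H_def heat_weight_def Q_def w_def mult_ac)
      finally show ?thesis .
    qed
    have w': "\<And>q. (transpose T *v q) \<bullet> (medium_matrix v C *v (transpose T *v q)) = q \<bullet> q"
      by (rule whitening)
    show ?thesis
      unfolding qform_def gaussian_fourier_multiplier[OF tc det_T w' s_integrable] eq[symmetric]
      using True by (simp only: integral_mult_right_zero) simp
  qed (simp add: H_def)
  have vdot_phase: "vdot w = sqrt b * wnorm w - phase w" for w
    by (simp add: phase_def vdot_def b_def)
  have ab: "sqrt (a w * b) = sqrt b * wnorm w / 2" "sqrt (a w) = wnorm w / 2" for w
    by (simp_all add: a_def real_sqrt_mult real_sqrt_divide)
  have ap: "a w > 0" if "w \<noteq> 0" for w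
    using that by (simp add: a_def)
  \<comment> \<open>At \<open>y = x\<close> the parameter \<open>a\<close> is 0 and the heat weight
    is not integrable at \<open>t = 0\<close>; the single point is a null set.\<close>
  have xy: "AE y in lborel. x - y \<noteq> 0"
    using AE_lborel_singleton[of x] by eventually_elim auto
  \<comment> \<open>The norm integral in \<open>t\<close> is evaluated exactly: it is a constant
    times \<open>norm (s y) / wnorm w\<close> times \<open>exp (- (Re c * phase w))\<close>, and the
    last factor is at most 1.\<close>
  have "integrable (lborel \<Otimes>\<^sub>M lborel) (case_prod H)"
  proof (rule lborel_pair.Fubini_integrable)
    show m: "case_prod H \<in> borel_measurable (lborel \<Otimes>\<^sub>M lborel)"
      unfolding H_def heat_weight_def a_def by measurable
    show "integrable lborel (\<lambda>y. LINT t|lborel. norm (case_prod H (y, t)))"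
    proof (rule integrable_dominated[OF integrable_mult_right[OF singular_integrable[of x],
          of "norm Q * (2 * sqrt pi / sqrt (Re c))"]])
      show "(\<lambda>y. LINT t|lborel. norm (case_prod H (y, t))) \<in> borel_measurable lborel"
        by (intro lborel.borel_measurable_lebesgue_integral) (use m in simp)
      show "AE y in lborel. norm (LINT t|lborel. norm (case_prod H (y, t)))
         \<le> norm (norm Q * (2 * sqrt pi / sqrt (Re c)) * (norm (s y) / wnorm (x - y)))"
        using xy
      proof eventually_elim
        case (elim y)
        define w where "w = x - y"
        have w: "a w > 0" using elim ap by (simp add: w_def)
        have "(LINT t|lborel. norm (case_prod H (y, t)))
          = norm Q * norm (s y) * exp (Re c * vdot w) * (LINT t|lborel. norm (indicator {0<..} t *\<^sub>R heat_weight c (a w) b t))"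
          unfolding H_def prod.case norm_mult w_def[symmetric]
          by (simp only: integral_mult_right_zero) (simp add: norm_exp_eq_Re)
        also have "\<dots> = norm Q * norm (s y) * (sqrt pi / (sqrt (Re c) * (wnorm w / 2))) * (exp (Re c * vdot w) * exp (- 2 * Re c * (sqrt b * wnorm w / 2)))"
          unfolding heat_weight_norm_integral[OF cp w b] ab by (simp only: mult_ac)
        also have "exp (Re c * vdot w) * exp (- 2 * Re c * (sqrt b * wnorm w / 2)) = exp (- (Re c * phase w))"
          unfolding exp_add[symmetric] vdot_phase by (simp add: algebra_simps)
        finally have E: "(LINT t|lborel. norm (case_prod H (y, t)))
          = (norm Q * (2 * sqrt pi / sqrt (Re c)) * (norm (s y) / wnorm w)) * exp (- (Re c * phase w))"
          by (simp add: field_simps)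
        have le1: "exp (- (Re c * phase w)) \<le> 1" using cp phase_nonneg[of w] by simp
        have nn: "0 \<le> norm Q * (2 * sqrt pi / sqrt (Re c)) * (norm (s y) / wnorm w)"
          using cp by simp
        have shrink: "norm (X * u) \<le> norm X" if "0 \<le> X" "u \<le> 1" "0 \<le> u" for X u :: real
          using that mult_left_mono[of u 1 X] by simp
        show ?case
          unfolding E w_def[symmetric] by (rule shrink[OF nn le1 exp_ge_zero])
      qed
    qed
    show "AE y in lborel. integrable lborel (\<lambda>t. case_prod H (y, t))"
      using xy
    proof eventually_elim
      case (elim y)
      show ?case unfolding H_def prod.case
        by (intro integrable_mult_right heat_weight_integrable cp ap b elim)
    qed
  qed
  from lborel_pair.Fubini_integral[OF this]
  have "(LINT t|lborel. LINT y|lborel. H y t) = (LINT y|lborel. LINT t|lborel. H y t)" by simp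
  also have "\<dots> = (LINT y|lborel. c * of_real ((2 * pi) ^ 3) * (s y * green z (x - y)))"
  proof (rule integral_cong_AE)
    show "(\<lambda>y. LINT t|lborel. H y t) \<in> borel_measurable lborel"
      by (intro lborel.borel_measurable_lebesgue_integral) (unfold H_def heat_weight_def a_def, measurable)
    show "AE y in lborel. (LINT t|lborel. H y t) = c * of_real ((2 * pi) ^ 3) * (s y * green z (x - y))"
      using xy
    proof eventually_elim
      case (elim y)
      define w where "w = x - y"
      have w: "a w > 0" and w0: "wnorm w \<noteq> 0" using elim ap by (auto simp: w_def)
      have "(LINT t|lborel. H y t) = Q * s y * exp (c * of_real (vdot w)) *
         (of_real (sqrt pi) / (csqrt c * of_real (sqrt (a w))) * exp (- 2 * c * of_real (sqrt (a w * b))))"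
        unfolding H_def w_def[symmetric] integral_mult_right_zero heat_weight_integral[OF cp w b] ..
      also have "\<dots> = Q * s y * (of_real (sqrt pi) / (csqrt c * of_real (wnorm w / 2))) *
         (exp (c * of_real (vdot w)) * exp (- 2 * c * of_real (sqrt b * wnorm w / 2)))"
        unfolding ab by (simp only: mult_ac)
      also have "exp (c * of_real (vdot w)) * exp (- 2 * c * of_real (sqrt b * wnorm w / 2)) = exp (\<i> * z * of_real (phase w))"
        unfolding exp_add[symmetric] vdot_phase by (rule arg_cong[where f=exp]) (simp add: c_def algebra_simps)
      \<comment> \<open>Four factors \<open>sqrt pi\<close> and three factors
        \<open>csqrt c\<close>, against one \<open>csqrt c\<close> in the denominator, leave
        \<open>pi^2 * c\<close>. With the 2 from \<open>sqrt (a w) = wnorm w / 2\<close> this is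
        \<open>c * (2 * pi) ^ 3 / (4 * pi)\<close>.\<close>
      also have "Q * s y * (of_real (sqrt pi) / (csqrt c * of_real (wnorm w / 2))) = c * of_real ((2 * pi) ^ 3) * s y * of_real \<bar>det T\<bar> / of_real (4 * pi * wnorm w)"
      proof -
        have s1: "csqrt c * csqrt c = c" by (metis power2_csqrt power2_eq_square)
        have s2: "complex_of_real (sqrt pi) * of_real (sqrt pi) = of_real pi"
          by (metis of_real_mult pi_ge_zero real_sqrt_mult_self abs_of_nonneg)
        have n0: "csqrt c \<noteq> 0" using c0 by simp
        have "(of_real (sqrt pi) * csqrt c) ^ 3 * of_real (sqrt pi)
           = (complex_of_real (sqrt pi) * of_real (sqrt pi)) * (complex_of_real (sqrt pi) * of_real (sqrt pi)) * (csqrt c * csqrt c) * csqrt c"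
          by (simp add: power3_eq_cube mult_ac)
        also have "\<dots> = of_real pi * of_real pi * c * csqrt c" unfolding s1 s2 ..
        finally have q: "Q * of_real (sqrt pi) = of_real \<bar>det T\<bar> * (of_real pi * of_real pi * c * csqrt c)"
          by (simp add: Q_def mult_ac)
        have "Q * s y * (of_real (sqrt pi) / (csqrt c * of_real (wnorm w / 2))) = (Q * of_real (sqrt pi)) * s y / (csqrt c * of_real (wnorm w / 2))"
          by simp
        also have "\<dots> = c * of_real ((2 * pi) ^ 3) * s y * of_real \<bar>det T\<bar> / of_real (4 * pi * wnorm w)"
          unfolding q using n0 w0 by (simp add: field_simps power3_eq_cube)
        finally show ?thesis .
      qed
      finally show ?case unfolding green_def w_def[symmetric] by (simp add: mult_ac)
    qed
  qed measurable
  finally show ?thesis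
    unfolding field_at_laplace[OF z c_def] inner_eq integral_mult_right_zero using c0 by simp
qed

end

section \<open>The limit of vanishing absorption\<close>

context radiation
begin

lemma norm_source_green_le:
  assumes "Im z \<ge> 0"
  shows "norm (s y * green z w) \<le> \<bar>det T\<bar> / (4 * pi) * (norm (s y) / wnorm w)"
  using mult_left_mono[OF norm_green_le[OF assms, of w], of "norm (s y)"] by (simp add: norm_mult mult_ac)

lemma green_integrable:
  assumes "Im z \<ge> 0"
  shows "integrable lborel (\<lambda>y. s y * green z (x - y))"
proof (rule integrable_dominated[OF integrable_mult_right[OF singular_integrable[of x], of "\<bar>det T\<bar> / (4 * pi)"]])
  show "AE y in lborel. norm (s y * green z (x - y)) \<le> norm (\<bar>det T\<bar> / (4 * pi) * (norm (s y) / wnorm (x - y)))"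
    unfolding real_norm_def by (intro AE_I2 order_trans[OF norm_source_green_le[OF assms] abs_ge_self])
qed measurable

text \<open>One constant serves every point and every frequency in the closed upper half plane. It
  gives local integrability of the outgoing field and dominates the fields at positive absorption
  when the wave equation passes to the limit.\<close>

lemma green_bounded:
  obtains B where "B \<ge> 0" "\<And>x z. Im z \<ge> 0 \<Longrightarrow> norm (LINT y|lborel. s y * green z (x - y)) \<le> B"
proof -
  obtain B where B: "\<And>x. (LINT y|lborel. norm (s y) / wnorm (x - y)) \<le> B"
    by (rule singular_bounded) blast
  have le: "norm (LINT y|lborel. s y * green z (x - y)) \<le> \<bar>det T\<bar> / (4 * pi) * B" if "Im z \<ge> 0" for x z
  proof -
    have "norm (LINT y|lborel. s y * green z (x - y)) \<le> (LINT y|lborel. norm (s y * green z (x - y)))"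
      by (rule integral_norm_bound)
    also have "\<dots> \<le> (LINT y|lborel. \<bar>det T\<bar> / (4 * pi) * (norm (s y) / wnorm (x - y)))"
    proof (rule integral_mono)
      show "norm (s y * green z (x - y)) \<le> \<bar>det T\<bar> / (4 * pi) * (norm (s y) / wnorm (x - y))" for y
        by (rule norm_source_green_le[OF that])
    qed (intro integrable_norm green_integrable that integrable_mult_right singular_integrable)+
    also have "\<dots> \<le> \<bar>det T\<bar> / (4 * pi) * B"
      unfolding integral_mult_right_zero by (intro mult_left_mono B) simp
    finally show ?thesis .
  qed
  moreover have "\<bar>det T\<bar> / (4 * pi) * B \<ge> 0"
    using order_trans[OF norm_ge_zero le[of 0 0]] by simp
  ultimately show ?thesis using that by blast
qed

text \<open>The majorant \<open>norm (s y) / wnorm (x - y)\<close>, up to a constant, does not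
  depend on the frequency, and away from \<open>y = x\<close> the kernel is continuous in
  \<open>z\<close>.\<close>

lemma field_tendsto:
  "((\<lambda>\<epsilon>::real. field_at v C (of_real \<omega> + \<i> * of_real \<epsilon>) s x) \<longlongrightarrow> (LINT y|lborel. s y * green (of_real \<omega>) (x - y))) (at_right 0)"
  unfolding tendsto_at_iff_sequentially
proof (intro allI impI)
  fix e :: "nat \<Rightarrow> real" assume e: "\<forall>i. e i \<in> {0<..} - {0}" "e \<longlonglongrightarrow> 0"
  define z where "z = (\<lambda>i. complex_of_real \<omega> + \<i> * of_real (e i))"
  have zi: "Im (z i) > 0" for i using e(1) by (simp add: z_def)
  have zl: "z \<longlonglongrightarrow> of_real \<omega> + \<i> * of_real 0"
    unfolding z_def by (intro tendsto_intros e(2))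
  have "(\<lambda>i. LINT y|lborel. s y * green (z i) (x - y)) \<longlonglongrightarrow> (LINT y|lborel. s y * green (of_real \<omega>) (x - y))"
  proof (rule integral_dominated_convergence)
    show "integrable lborel (\<lambda>y. \<bar>det T\<bar> / (4 * pi) * (norm (s y) / wnorm (x - y)))"
      by (intro integrable_mult_right singular_integrable)
    show "AE y in lborel. (\<lambda>i. s y * green (z i) (x - y)) \<longlonglongrightarrow> s y * green (of_real \<omega>) (x - y)"
      using AE_lborel_singleton[of x]
    proof eventually_elim
      case (elim y)
      then have "complex_of_real (4 * pi * wnorm (x - y)) \<noteq> 0" by simp
      then show ?case
        unfolding green_def using zl by (intro tendsto_intros) simp_all
    qed
    show "AE y in lborel. norm (s y * green (z i) (x - y)) \<le> \<bar>det T\<bar> / (4 * pi) * (norm (s y) / wnorm (x - y))" for i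
      by (intro AE_I2 norm_source_green_le less_imp_le zi)
  qed measurable
  then show "((\<lambda>\<epsilon>. field_at v C (of_real \<omega> + \<i> * of_real \<epsilon>) s x) \<circ> e) \<longlonglongrightarrow> (LINT y|lborel. s y * green (of_real \<omega>) (x - y))"
    by (simp add: o_def field_at_green[OF zi[unfolded z_def]] z_def)
qed

lemma outgoing_field_green: "outgoing_field v C \<omega> s x = (LINT y|lborel. s y * green (of_real \<omega>) (x - y))"
  unfolding outgoing_field_def by (intro tendsto_Lim field_tendsto) simp

lemma green_convolution_measurable[measurable]:
  "(\<lambda>x. LINT y|lborel. s y * green z (x - y)) \<in> borel_measurable borel"
  by measurable

end

subsection \<open>Integration by parts against plane waves\<close>

lemma partial_eq_0:
  assumes K: "closed K" and f: "\<And>X. X \<notin> K \<Longrightarrow> f X = 0" and X: "X \<notin> K"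
  shows "partial a f X = 0"
proof -
  have "((\<lambda>h. f (X + h *\<^sub>R st_axis a)) has_vector_derivative 0) (at 0)"
  proof (rule has_vector_derivative_transform_within_open[OF has_vector_derivative_const])
    show "open ((\<lambda>h. X + h *\<^sub>R st_axis a) -` (- K))"
      using K by (intro open_vimage continuous_intros) auto
    show "0 \<in> (\<lambda>h. X + h *\<^sub>R st_axis a) -` (- K)" using X by simp
    show "0 = f (X + h *\<^sub>R st_axis a)" if "h \<in> (\<lambda>h. X + h *\<^sub>R st_axis a) -` (- K)" for h
      using f that by auto
  qed
  then show ?thesis unfolding partial_def by (rule vector_derivative_at)
qed

text \<open>Differentiability at 0 from every base point gives it along the whole line: the base
  point is moved by \<open>h\<close> and the parameter shifted back.\<close>

lemma has_partial:
  assumes "\<And>X. (\<lambda>h::real. f (X + h *\<^sub>R st_axis a)) differentiable at 0"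
  shows "((\<lambda>h. f (X + h *\<^sub>R st_axis a)) has_vector_derivative partial a f (X + h *\<^sub>R st_axis a)) (at h)"
proof -
  have "((\<lambda>u. f (X + h *\<^sub>R st_axis a + u *\<^sub>R st_axis a)) has_vector_derivative partial a f (X + h *\<^sub>R st_axis a)) (at 0)"
    unfolding partial_def using assms by (rule vector_derivative_works[THEN iffD1])
  moreover have "(\<lambda>u. f (X + h *\<^sub>R st_axis a + u *\<^sub>R st_axis a)) = (\<lambda>h. f (X + h *\<^sub>R st_axis a)) \<circ> (\<lambda>u. h + u)"
    by (auto simp: fun_eq_iff algebra_simps)
  ultimately have "((\<lambda>h. f (X + h *\<^sub>R st_axis a)) \<circ> (\<lambda>u. h + u) has_vector_derivative partial a f (X + h *\<^sub>R st_axis a)) (at 0)"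
    by simp
  then have "(((\<lambda>h. f (X + h *\<^sub>R st_axis a)) \<circ> (\<lambda>u. h + u)) \<circ> (\<lambda>u. u - h) has_vector_derivative 1 *\<^sub>R partial a f (X + h *\<^sub>R st_axis a)) (at h)"
    by (intro vector_diff_chain_at) (auto intro!: derivative_eq_intros)
  then show ?thesis by (simp add: o_def)
qed

lemma Ck_1_iff: "Ck (Suc 0) f \<longleftrightarrow> continuous_on UNIV f \<and>
   (\<forall>a. (\<forall>X. (\<lambda>h::real. f (X + h *\<^sub>R st_axis a)) differentiable at 0) \<and> continuous_on UNIV (partial a f))"
  by simp

lemma compact_support_bounded:
  fixes f :: "'a::t2_space \<Rightarrow> complex"
  assumes "compact K" "\<And>X. X \<notin> K \<Longrightarrow> f X = 0" "continuous_on UNIV f"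
  obtains B where "B > 0" "\<And>X. norm (f X) \<le> B"
proof -
  have "bounded (f ` K)"
    by (intro compact_imp_bounded compact_continuous_image assms(1) continuous_on_subset[OF assms(3)]) simp
  then obtain B where B: "B > 0" "\<And>y. y \<in> f ` K \<Longrightarrow> norm y \<le> B" by (auto simp: bounded_pos)
  have "norm (f X) \<le> B" for X using B assms(2)[of X] by (cases "X \<in> K") auto
  then show ?thesis using that B by blast
qed

lemma compact_support_integrable:
  fixes f :: "'a::euclidean_space \<Rightarrow> complex"
  assumes K: "compact K" "\<And>X. X \<notin> K \<Longrightarrow> f X = 0" and f: "continuous_on UNIV f"
  shows "integrable lborel f"
proof -
  have "integrable lborel (\<lambda>X. indicator K X *\<^sub>R f X)"
    using borel_integrable_compact[OF K(1) continuous_on_subset[OF f]] by (simp add: set_integrable_def)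
  also have "(\<lambda>X. indicator K X *\<^sub>R f X) = f" using K(2) by (auto simp: indicator_def fun_eq_iff)
  finally show ?thesis .
qed

text \<open>Difference quotients integrate to 0 by translation invariance and tend to the partial
  derivative. The mean value inequality bounds them by \<open>B\<close> on a fixed compact set, so
  the limit passes under the integral without splitting off a coordinate.\<close>

lemma integral_partial_eq_0:
  assumes K: "compact K" "\<And>X. X \<notin> K \<Longrightarrow> f X = 0" and f: "Ck (Suc 0) f"
  shows "(LINT X|lborel. partial a f X) = 0"
proof -
  have fc: "continuous_on UNIV f" and pc: "continuous_on UNIV (partial a f)"
    and fd: "\<And>X. (\<lambda>h::real. f (X + h *\<^sub>R st_axis a)) differentiable at 0"
    using f unfolding Ck_1_iff by auto
  have [measurable]: "f \<in> borel_measurable borel" by (rule borel_measurable_continuous_onI[OF fc])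
  have fi: "integrable lborel f" by (rule compact_support_integrable[OF K fc])
  have p0: "partial a f X = 0" if "X \<notin> K" for X
    using that by (intro partial_eq_0[OF compact_imp_closed[OF K(1)]] K(2))
  obtain B where B: "B > 0" "\<And>X. norm (partial a f X) \<le> B"
    by (rule compact_support_bounded[OF K(1) p0 pc]) auto
  define e where "e = st_axis a"
  define h where "h = (\<lambda>n. 1 / real (Suc n))"
  have h: "h n > 0" "h n \<le> 1" for n by (simp_all add: h_def)
  \<comment> \<open>\<open>K\<close> swept backwards along \<open>e\<close> by all lengths up to 1.
    As \<open>h n \<le> 1\<close>, both \<open>X\<close> and \<open>h n *\<^sub>R e + X\<close> miss
    \<open>K\<close> whenever \<open>X\<close> lies outside \<open>K'\<close>.\<close>
  define K' where "K' = {x + y |x y. x \<in> K \<and> y \<in> (\<lambda>t. - (t *\<^sub>R e)) ` {0..1::real}}"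
  have K': "compact K'" unfolding K'_def
    by (intro compact_sums K(1) compact_continuous_image continuous_intros) auto
  have K'I: "Y + - (t *\<^sub>R e) \<in> K'" if "Y \<in> K" "0 \<le> t" "t \<le> 1" for Y t
    unfolding K'_def using that by (intro CollectI exI[of _ Y] exI[of _ "- (t *\<^sub>R e)"] conjI refl) auto
  define d where "d = (\<lambda>n X. (1 / h n) *\<^sub>R (f (h n *\<^sub>R e + X) - f X))"
  have bound: "norm (d n X) \<le> B * indicator K' X" for n X
  proof (cases "X \<in> K'")
    case True
    have "norm (f (X + h n *\<^sub>R e) - f (X + 0 *\<^sub>R e)) \<le> B * norm (h n - 0)"
    proof (rule differentiable_bound[where S="{0..h n}" and f'="\<lambda>t u. u *\<^sub>R partial a f (X + t *\<^sub>R e)"])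
      show "((\<lambda>t. f (X + t *\<^sub>R e)) has_derivative (\<lambda>u. u *\<^sub>R partial a f (X + t *\<^sub>R e))) (at t within {0..h n})" for t
        using has_partial[OF fd, of X t] unfolding has_vector_derivative_def e_def
        by (rule has_derivative_at_withinI)
      show "onorm (\<lambda>u::real. u *\<^sub>R partial a f (X + t *\<^sub>R e)) \<le> B" for t
      proof (rule onorm_le)
        fix u :: real
        show "norm (u *\<^sub>R partial a f (X + t *\<^sub>R e)) \<le> B * norm u"
          using mult_right_mono[OF B(2)[of "X + t *\<^sub>R e"], of "\<bar>u\<bar>"] by (simp add: mult.commute)
      qed
    qed (use h[of n] in auto)
    then have "norm (f (h n *\<^sub>R e + X) - f X) \<le> B * h n"
      using h[of n] by (simp add: add.commute)
    moreover have "norm (d n X) = norm (f (h n *\<^sub>R e + X) - f X) / h n"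
      unfolding d_def norm_scaleR using h(1)[of n] by simp
    ultimately show ?thesis using True h(1)[of n] by (simp add: divide_le_eq)
  next
    case False
    have "X \<notin> K"
    proof
      assume "X \<in> K"
      then have "X + - (0 *\<^sub>R e) \<in> K'" by (rule K'I) auto
      then show False using False by simp
    qed
    moreover have "h n *\<^sub>R e + X \<notin> K"
    proof
      assume "h n *\<^sub>R e + X \<in> K"
      then have "(h n *\<^sub>R e + X) + - (h n *\<^sub>R e) \<in> K'"
        by (rule K'I) (use h[of n] in auto)
      then show False using False by simp
    qed
    ultimately show ?thesis using K(2) B(1) by (simp add: d_def)
  qed
  have "(\<lambda>n. LINT X|lborel. d n X) \<longlonglongrightarrow> (LINT X|lborel. partial a f X)"
  proof (rule integral_dominated_convergence[where w="\<lambda>X. B * indicator K' X"])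
    show "partial a f \<in> borel_measurable lborel" using borel_measurable_continuous_onI[OF pc] by simp
    show "d n \<in> borel_measurable lborel" for n unfolding d_def by measurable
    show "integrable lborel (\<lambda>X. B * indicator K' X)"
      using emeasure_compact_finite[OF K'] K'
      by (intro integrable_mult_right integrable_real_indicator) (auto simp: less_top compact_imp_closed)
    show "AE X in lborel. norm (d n X) \<le> B * indicator K' X" for n using bound by simp
    show "AE X in lborel. (\<lambda>n. d n X) \<longlonglongrightarrow> partial a f X"
    proof (rule AE_I2)
      fix X
      define p where "p = partial a f X"
      have "((\<lambda>t. (1 / norm (t - 0)) *\<^sub>R (f (X + t *\<^sub>R e) - (f (X + 0 *\<^sub>R e) + (t - 0) *\<^sub>R p))) \<longlongrightarrow> 0) (at 0)"
        using has_partial[OF fd, of X 0] by (simp add: e_def p_def has_vector_derivative_def has_derivative_within)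
      moreover have "filterlim h (at 0) sequentially"
        unfolding h_def filterlim_at using LIMSEQ_Suc[OF lim_1_over_n] by (auto intro!: always_eventually)
      ultimately have "(\<lambda>n. (1 / norm (h n - 0)) *\<^sub>R (f (X + h n *\<^sub>R e) - (f (X + 0 *\<^sub>R e) + (h n - 0) *\<^sub>R p))) \<longlonglongrightarrow> 0"
        by (rule filterlim_compose)
      moreover have "(1 / norm (h n - 0)) *\<^sub>R (f (X + h n *\<^sub>R e) - (f (X + 0 *\<^sub>R e) + (h n - 0) *\<^sub>R p)) = d n X - p" for n
        using h(1)[of n] by (simp add: d_def add.commute scaleR_diff_right scaleR_add_right)
      ultimately have "(\<lambda>n. d n X - p) \<longlonglongrightarrow> 0" by simp
      then show "(\<lambda>n. d n X) \<longlonglongrightarrow> partial a f X"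
        unfolding p_def by (rule LIM_zero_cancel)
    qed
  qed
  moreover have "(LINT X|lborel. d n X) = 0" for n
  proof -
    have "integrable lborel (\<lambda>X. f (h n *\<^sub>R e + X))"
      using integrable_distr_eq[of "(+) (h n *\<^sub>R e)" lborel borel f] fi by (simp add: lborel_distr_plus)
    then show ?thesis
      using fi lborel_integral_translate[of f "h n *\<^sub>R e"] by (simp add: d_def)
  qed
  ultimately have "(\<lambda>n. 0) \<longlonglongrightarrow> (LINT X|lborel. partial a f X)" by simp
  then show ?thesis using LIMSEQ_const_iff by metis
qed

definition plane_wave :: "real^3 \<Rightarrow> complex \<Rightarrow> real \<times> (real^3) \<Rightarrow> complex" where
  "plane_wave k z X = exp (\<i> * (of_real (k \<bullet> snd X) - z * of_real (fst X)))"

definition wave_covector :: "real^3 \<Rightarrow> complex \<Rightarrow> 3 option \<Rightarrow> complex" where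
  "wave_covector k z a = (case a of None \<Rightarrow> - (\<i> * z) | Some j \<Rightarrow> \<i> * of_real (k $ j))"

lemma continuous_plane_wave: "continuous_on S (plane_wave k z)"
  unfolding plane_wave_def[abs_def] by (intro continuous_intros)

lemma has_derivative_plane_wave:
  "((\<lambda>h::real. plane_wave k z (X + h *\<^sub>R st_axis a)) has_vector_derivative wave_covector k z a * plane_wave k z X) (at 0)"
proof -
  define l where "l = wave_covector k z a"
  define e where "e = \<i> * (complex_of_real (k \<bullet> snd X) - z * of_real (fst X))"
  have eq: "(\<lambda>h::real. plane_wave k z (X + h *\<^sub>R st_axis a)) = (\<lambda>h. exp (e + of_real h * l))"
    unfolding plane_wave_def
    by (rule ext, rule arg_cong[where f=exp], cases a)
       (simp_all add: st_axis_def l_def wave_covector_def e_def inner_add_right inner_axis algebra_simps)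
  have "((\<lambda>h::real. exp (e + of_real h * l)) has_vector_derivative (exp e * l)) (at 0)"
    by (rule has_vector_derivative_real_field[where f="\<lambda>h. exp (e + h * l)"])
       (auto intro!: derivative_eq_intros)
  then show ?thesis unfolding eq by (simp add: l_def e_def plane_wave_def mult.commute)
qed

lemma partial_plane_wave_eq: "partial a (\<lambda>X. c * plane_wave k z X) = (\<lambda>X. c * wave_covector k z a * plane_wave k z X)"
  unfolding plane_wave_def wave_covector_def by (rule partial_plane_wave)

text \<open>The plane wave has no compact support but its product with \<open>f\<close> has, so the
  integral of the derivative of the product vanishes; the product rule gives the rest.\<close>

lemma integral_partial_plane_wave:
  assumes K: "compact K" "\<And>X. X \<notin> K \<Longrightarrow> f X = 0" and f: "Ck (Suc 0) f"
  shows "(LINT X|lborel. partial a f X * plane_wave k z X) = - wave_covector k z a * (LINT X|lborel. f X * plane_wave k z X)"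
proof -
  have fc: "continuous_on UNIV f" and pc: "\<And>a. continuous_on UNIV (partial a f)"
    and fd: "\<And>a X. (\<lambda>h::real. f (X + h *\<^sub>R st_axis a)) differentiable at 0"
    using f unfolding Ck_1_iff by auto
  have p0: "partial a f X = 0" if "X \<notin> K" for a X
    using that by (intro partial_eq_0[OF compact_imp_closed[OF K(1)]] K(2))
  define g where "g = (\<lambda>X. f X * plane_wave k z X)"
  have der: "((\<lambda>h. g (X + h *\<^sub>R st_axis a)) has_vector_derivative
      f X * (wave_covector k z a * plane_wave k z X) + partial a f X * plane_wave k z X) (at 0)" for a X
    using has_vector_derivative_mult[OF has_partial[OF fd, of X a 0] has_derivative_plane_wave[of k z X a]]
    by (simp add: g_def)
  have pg: "partial a g = (\<lambda>X. wave_covector k z a * (f X * plane_wave k z X) + partial a f X * plane_wave k z X)" for a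
    unfolding partial_def[of a g, abs_def] by (rule ext) (simp add: vector_derivative_at[OF der] mult_ac)
  have "Ck (Suc 0) g"
    unfolding Ck_1_iff
  proof (intro conjI allI)
    show "continuous_on UNIV g" unfolding g_def by (intro continuous_intros fc continuous_plane_wave)
    show "(\<lambda>h::real. g (X + h *\<^sub>R st_axis a)) differentiable at 0" for a X
      using der by (rule differentiableI_vector)
    show "continuous_on UNIV (partial a g)" for a
      unfolding pg by (intro continuous_intros fc pc continuous_plane_wave)
  qed
  then have "0 = (LINT X|lborel. partial a g X)"
    using integral_partial_eq_0[OF K(1), of g] K(2) by (simp add: g_def)
  also have "\<dots> = wave_covector k z a * (LINT X|lborel. f X * plane_wave k z X) + (LINT X|lborel. partial a f X * plane_wave k z X)"
  proof -
    have "integrable lborel (\<lambda>X. f X * plane_wave k z X)"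
      by (rule compact_support_integrable[OF K(1)]) (auto simp: K(2) intro!: continuous_intros fc continuous_plane_wave)
    moreover have "integrable lborel (\<lambda>X. partial a f X * plane_wave k z X)"
      by (rule compact_support_integrable[OF K(1)]) (auto simp: p0 intro!: continuous_intros pc continuous_plane_wave)
    ultimately show ?thesis unfolding pg by simp
  qed
  finally show ?thesis by (simp add: eq_neg_iff_add_eq_0 add.commute)
qed

lemma test_function_partial:
  assumes \<phi>: "test_function \<phi>" and K: "K = closure {X. \<phi> X \<noteq> 0}"
  shows "compact K" "\<And>X. X \<notin> K \<Longrightarrow> \<phi> X = 0" "\<And>a X. X \<notin> K \<Longrightarrow> partial a \<phi> X = 0"
    "\<And>a b X. X \<notin> K \<Longrightarrow> partial a (partial b \<phi>) X = 0"
    "Ck (Suc 0) \<phi>" "\<And>a. Ck (Suc 0) (partial a \<phi>)" "continuous_on UNIV \<phi>" "\<And>a b. continuous_on UNIV (partial a (partial b \<phi>))"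
proof -
  show c: "compact K" using \<phi> K by (simp add: test_function_def)
  show 0: "\<phi> X = 0" if "X \<notin> K" for X using that closure_subset[of "{X. \<phi> X \<noteq> 0}"] by (auto simp: K)
  show 1: "partial a \<phi> X = 0" if "X \<notin> K" for a X
    using that by (intro partial_eq_0[OF compact_imp_closed[OF c]] 0)
  show "partial a (partial b \<phi>) X = 0" if "X \<notin> K" for a b X
    using that by (intro partial_eq_0[OF compact_imp_closed[OF c]] 1)
  have "Ck (Suc 0) \<phi>" "Ck (Suc (Suc 0)) \<phi>" using \<phi> unfolding test_function_def by blast+
  then show "Ck (Suc 0) \<phi>" "\<And>a. Ck (Suc 0) (partial a \<phi>)" "continuous_on UNIV \<phi>" "\<And>a b. continuous_on UNIV (partial a (partial b \<phi>))"
    by simp_all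
qed

lemma wave_op_test_function:
  assumes \<phi>: "test_function \<phi>" and K: "K = closure {X. \<phi> X \<noteq> 0}"
  shows "X \<notin> K \<Longrightarrow> wave_op Q \<phi> X = 0" and "continuous_on UNIV (wave_op Q \<phi>)"
  using test_function_partial(4)[OF \<phi> K]
  by (auto simp: wave_op_def[abs_def] intro!: continuous_intros test_function_partial(8)[OF \<phi> K])

text \<open>Two integrations by parts produce two minus signs, hence the factor
  \<open>l a * l b\<close>, and the form \<open>Q\<close> evaluated on these covectors is the
  symbol.\<close>

lemma wave_op_pairing:
  assumes \<phi>: "test_function \<phi>"
  shows "(LINT X|lborel. wave_op (medium_form v C) \<phi> X * plane_wave k z X)
    = (of_real (k \<bullet> (C *v k)) - (z - of_real (v \<bullet> k))\<^sup>2) * (LINT X|lborel. \<phi> X * plane_wave k z X)"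
proof -
  define K where "K = closure {X. \<phi> X \<noteq> 0}"
  note tf = test_function_partial[OF \<phi> K_def]
  define Q where "Q = medium_form v C"
  define l where "l = wave_covector k z"
  define I where "I = (LINT X|lborel. \<phi> X * plane_wave k z X)"
  have I2: "(LINT X|lborel. partial a (partial b \<phi>) X * plane_wave k z X) = l a * l b * I" for a b
    using integral_partial_plane_wave[OF tf(1,3,6), of a b k z] integral_partial_plane_wave[OF tf(1,2,5), of b k z]
    by (simp add: l_def I_def)
  have i2: "integrable lborel (\<lambda>X. partial a (partial b \<phi>) X * plane_wave k z X)" for a b
    by (rule compact_support_integrable[OF tf(1)]) (auto simp: tf(4) intro!: continuous_intros tf(8) continuous_plane_wave)
  have "(LINT X|lborel. wave_op Q \<phi> X * plane_wave k z X)
     = (LINT X|lborel. (\<Sum>a\<in>UNIV. \<Sum>b\<in>UNIV. of_real (Q $ a $ b) * (partial a (partial b \<phi>) X * plane_wave k z X)))"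
    by (simp add: wave_op_def sum_distrib_right mult.assoc)
  also have "\<dots> = (\<Sum>a\<in>UNIV. \<Sum>b\<in>UNIV. of_real (Q $ a $ b) * (l a * l b * I))"
    by (simp add: Bochner_Integration.integral_sum Bochner_Integration.integrable_sum i2 I2)
  also have "\<dots> = (\<Sum>a\<in>UNIV. \<Sum>b\<in>UNIV. of_real (Q $ a $ b) * (l a * l b)) * I"
    by (simp add: sum_distrib_right mult.assoc)
  also have "(\<Sum>a\<in>UNIV. \<Sum>b\<in>UNIV. of_real (Q $ a $ b) * (l a * l b))
     = of_real (k \<bullet> (C *v k)) - (z - of_real (v \<bullet> k))\<^sup>2"
  proof -
    \<comment> \<open>The sum is identified by applying the operator to the plane wave itself and
      evaluating at the origin, where the wave is 1.\<close>
    have "partial b (plane_wave k z) = (\<lambda>X. l b * plane_wave k z X)" for b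
      using partial_plane_wave_eq[of b 1 k z] by (simp add: l_def)
    then have "partial a (partial b (plane_wave k z)) 0 = l a * l b" for a b
      by (simp only: partial_plane_wave_eq) (simp add: l_def plane_wave_def mult.commute)
    then have "wave_op Q (plane_wave k z) 0 = (\<Sum>a\<in>UNIV. \<Sum>b\<in>UNIV. of_real (Q $ a $ b) * (l a * l b))"
      by (simp add: wave_op_def)
    moreover have "wave_op Q (plane_wave k z) 0 = of_real (k \<bullet> (C *v k)) - (z - of_real (v \<bullet> k))\<^sup>2"
      using wave_op_plane_wave[of v C k z 0] by (simp add: Q_def plane_wave_def[abs_def])
    ultimately show ?thesis by simp
  qed
  finally show ?thesis by (simp add: Q_def I_def)
qed

subsection \<open>Pairing a Fourier transform with a continuous function\<close>

lemma compact_fst_bounded: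
  fixes K :: "(real \<times> (real^3)) set"
  assumes "compact K"
  obtains R where "R > 0" "\<And>X. X \<in> K \<Longrightarrow> \<bar>fst X\<bar> \<le> R"
proof -
  obtain R where R: "R > 0" "\<And>X. X \<in> K \<Longrightarrow> norm X \<le> R"
    using compact_imp_bounded[OF assms] by (auto simp: bounded_pos)
  have "\<bar>fst X\<bar> \<le> R" if "X \<in> K" for X
    using norm_fst_le[of "fst X" "snd X"] R(2)[OF that] by simp
  then show ?thesis using that R(1) by blast
qed

lemma integrable_indicator_Icc[simp]: "integrable lborel (indicator {a..b::real} :: real \<Rightarrow> real)"
  using emeasure_compact_finite[of "{a..b}"] by (intro integrable_real_indicator) (auto simp: less_top)

text \<open>Fourier inversion in paired form. Integrability is given for the product of the two
  transforms rather than for each, so Gaussian damping is inserted: the damped integral pairs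
  \<open>s\<close> with Gaussian averages \<open>J n\<close> of \<open>\<eta>\<close> of width
  \<open>h n\<close>, and these tend to \<open>(2 * pi) ^ 3\<close> times
  \<open>\<eta>\<close>.\<close>

lemma fourier_pairing:
  fixes s \<eta> :: "real^3 \<Rightarrow> complex"
  assumes s: "integrable lborel s" and \<eta>i: "integrable lborel \<eta>" and \<eta>c: "continuous_on UNIV \<eta>"
    and M: "\<And>x. norm (\<eta> x) \<le> M"
    and int: "integrable lborel (\<lambda>k. fourier s k * (LINT x|lborel. \<eta> x * iexp (k \<bullet> x)))"
  shows "(LINT k|lborel. fourier s k * (LINT x|lborel. \<eta> x * iexp (k \<bullet> x)))
    = of_real ((2 * pi) ^ 3) * (LINT x|lborel. s x * \<eta> x)"
proof -
  have [measurable]: "s \<in> borel_measurable borel" "\<eta> \<in> borel_measurable borel" using s \<eta>i by auto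
  define L where "L = (LINT x|lborel. norm (s x))"
  have L: "norm (fourier s k) \<le> L" for k unfolding L_def by (rule norm_fourier_le)
  have G: "integrable lborel gauss" "integral\<^sup>L lborel gauss = (2 * pi) ^ 3"
    using gauss_integral by (auto simp: has_bochner_integral_iff)
  define \<Phi> where "\<Phi> = (\<lambda>k. LINT x|lborel. \<eta> x * iexp (k \<bullet> x))"
  have \<Phi>m[measurable]: "\<Phi> \<in> borel_measurable borel" unfolding \<Phi>_def by measurable
  define h where "h = (\<lambda>n. 1 / real (Suc n))"
  have h: "h n > 0" for n by (simp add: h_def)
  have hl: "h \<longlonglongrightarrow> 0" unfolding h_def by (rule LIMSEQ_Suc[OF lim_1_over_n])
  define e where "e = (\<lambda>n (k::real^3). exp (- (h n)\<^sup>2 * (k \<bullet> k)))"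
  have ei: "integrable lborel (e n)" for n
  proof -
    have c: "Re (complex_of_real ((h n)\<^sup>2)) > 0" using h[of n] by simp
    show ?thesis
      using integrable_norm[OF gaussian_fourier_euclidean(1)[OF c, of "0::real^3"]]
      by (simp add: e_def norm_exp_eq_Re flip: of_real_power)
  qed
  have em[measurable]: "e n \<in> borel_measurable borel" for n using ei[of n] by auto
  define H where "H = (\<lambda>n u. gauss ((1 / h n) *\<^sub>R u) / h n ^ 3)"
  define A where "A = (\<lambda>n. LINT k|lborel. of_real (e n k) * (fourier s k * \<Phi> k))"
  define J where "J = (\<lambda>n y. LINT u|lborel. \<eta> (y + h n *\<^sub>R u) * of_real (gauss u))"
  have "A \<longlonglongrightarrow> (LINT k|lborel. fourier s k * \<Phi> k)"
    unfolding A_def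
  proof (rule integral_dominated_convergence[where w="\<lambda>k. norm (fourier s k * \<Phi> k)"])
    show "AE k in lborel. (\<lambda>n. of_real (e n k) * (fourier s k * \<Phi> k)) \<longlonglongrightarrow> fourier s k * \<Phi> k"
    proof (rule AE_I2)
      fix k
      have "(\<lambda>n. of_real (exp (- (h n)\<^sup>2 * (k \<bullet> k))) * (fourier s k * \<Phi> k)) \<longlonglongrightarrow> of_real (exp (- 0\<^sup>2 * (k \<bullet> k))) * (fourier s k * \<Phi> k)"
        by (intro tendsto_intros hl)
      then show "(\<lambda>n. of_real (e n k) * (fourier s k * \<Phi> k)) \<longlonglongrightarrow> fourier s k * \<Phi> k" by (simp add: e_def)
    qed
    show "AE k in lborel. norm (of_real (e n k) * (fourier s k * \<Phi> k)) \<le> norm (fourier s k * \<Phi> k)" for n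
      by (intro AE_I2) (simp add: e_def norm_mult mult_left_le_one_le)
    show "integrable lborel (\<lambda>k. norm (fourier s k * \<Phi> k))" using int by (simp add: \<Phi>_def)
  qed measurable
  moreover have Aeq: "A n = (LINT y|lborel. s y * J n y)" for n
  proof -
    define F where "F = (\<lambda>k x. of_real (e n k) * fourier s k * (\<eta> x * iexp (k \<bullet> x)))"
    have "A n = (LINT k|lborel. LINT x|lborel. F k x)"
      unfolding A_def F_def \<Phi>_def integral_mult_right_zero by (simp only: mult.assoc)
    also have "\<dots> = (LINT x|lborel. LINT k|lborel. F k x)"
    proof (rule Fubini_lborel_dominated)
      show "case_prod F \<in> borel_measurable (borel \<Otimes>\<^sub>M borel)" unfolding F_def by measurable
      show "norm (F k x) \<le> (L * e n k) * norm (\<eta> x)" for k x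
        using mult_right_mono[OF L[of k], of "e n k * norm (\<eta> x)"]
        by (simp add: F_def norm_mult norm_exp_eq_Re e_def mult_ac)
    qed (use ei \<eta>i in auto)
    also have "\<dots> = (LINT x|lborel. LINT y|lborel. \<eta> x * (s y * of_real (H n (x - y))))"
    proof (rule Bochner_Integration.integral_cong[OF refl])
      fix x
      have "(LINT k|lborel. F k x) = \<eta> x * (LINT k|lborel. fourier s k * (of_real (e n k) * iexp (k \<bullet> x)))"
        unfolding integral_mult_right_zero[symmetric] F_def by (simp only: mult_ac)
      then show "(LINT k|lborel. F k x) = (LINT y|lborel. \<eta> x * (s y * of_real (H n (x - y))))"
        unfolding integral_mult_right_zero e_def gaussian_regularised_fourier[OF s h] H_def .
    qed
    also have "\<dots> = (LINT y|lborel. LINT x|lborel. \<eta> x * (s y * of_real (H n (x - y))))"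
    proof (rule Fubini_lborel_dominated)
      show "(\<lambda>(x, y). \<eta> x * (s y * of_real (H n (x - y)))) \<in> borel_measurable (borel \<Otimes>\<^sub>M borel)"
        unfolding H_def by measurable
      show "norm (\<eta> x * (s y * of_real (H n (x - y)))) \<le> norm (\<eta> x) * ((sqrt pi ^ 3 / h n ^ 3) * norm (s y))" for x y
      proof -
        have "\<bar>H n u\<bar> \<le> sqrt pi ^ 3 / h n ^ 3" for u
          using h[of n] by (simp add: H_def gauss_def divide_right_mono mult_left_le)
        from mult_left_mono[OF this, of "norm (\<eta> x) * norm (s y)"] show ?thesis
          by (simp add: norm_mult mult_ac)
      qed
    qed (use \<eta>i s in auto)
    also have "\<dots> = (LINT y|lborel. s y * (LINT x|lborel. \<eta> x * of_real (H n (x - y))))"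
      unfolding integral_mult_right_zero[symmetric] by (simp only: mult_ac)
    also have "\<dots> = (LINT y|lborel. s y * J n y)"
      unfolding H_def J_def by (simp only: gauss_scale[OF \<open>\<eta> \<in> borel_measurable borel\<close> h])
    finally show ?thesis .
  qed
  moreover have Jb: "norm (J n y) \<le> M * (2 * pi) ^ 3" for n y
  proof -
    have le: "norm (\<eta> (y + h n *\<^sub>R u) * of_real (gauss u)) \<le> M * gauss u" for u
      using M by (simp add: norm_mult mult_right_mono)
    have i: "integrable lborel (\<lambda>u. M * gauss u)" using G(1) by simp
    have "norm (J n y) \<le> (LINT u|lborel. norm (\<eta> (y + h n *\<^sub>R u) * of_real (gauss u)))"
      unfolding J_def by (rule integral_norm_bound)
    also have "\<dots> \<le> (LINT u|lborel. M * gauss u)"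
    proof (rule integral_mono[OF _ i le], rule integrable_norm, rule integrable_dominated[OF i])
      show "AE u in lborel. norm (\<eta> (y + h n *\<^sub>R u) * of_real (gauss u)) \<le> norm (M * gauss u)"
        unfolding real_norm_def by (intro AE_I2 order_trans[OF le abs_ge_self])
    qed measurable
    finally show ?thesis by (simp add: G(2))
  qed
  moreover have Jlim: "(\<lambda>n. J n y) \<longlonglongrightarrow> \<eta> y * of_real ((2 * pi) ^ 3)" for y
  proof -
    have "(\<lambda>n. J n y) \<longlonglongrightarrow> (LINT u|lborel. \<eta> y * of_real (gauss u))"
      unfolding J_def
    proof (rule integral_dominated_convergence[where w="\<lambda>u. M * gauss u"])
      show "AE u in lborel. (\<lambda>n. \<eta> (y + h n *\<^sub>R u) * of_real (gauss u)) \<longlonglongrightarrow> \<eta> y * of_real (gauss u)"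
      proof (rule AE_I2)
        fix u
        have "(\<lambda>n. y + h n *\<^sub>R u) \<longlonglongrightarrow> y + 0 *\<^sub>R u" by (intro tendsto_intros hl)
        then have "(\<lambda>n. \<eta> (y + h n *\<^sub>R u)) \<longlonglongrightarrow> \<eta> (y + 0 *\<^sub>R u)"
          by (rule continuous_on_tendsto_compose[OF \<eta>c]) auto
        then show "(\<lambda>n. \<eta> (y + h n *\<^sub>R u) * of_real (gauss u)) \<longlonglongrightarrow> \<eta> y * of_real (gauss u)"
          by (intro tendsto_intros) simp
      qed
      show "AE u in lborel. norm (\<eta> (y + h n *\<^sub>R u) * of_real (gauss u)) \<le> M * gauss u" for n
        using M by (intro AE_I2) (simp add: norm_mult mult_right_mono)
      show "integrable lborel (\<lambda>u. M * gauss u)" using G(1) by simp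
    qed measurable
    also have "(LINT u|lborel. \<eta> y * of_real (gauss u)) = \<eta> y * of_real ((2 * pi) ^ 3)"
      unfolding integral_mult_right_zero integral_complex_of_real G(2) ..
    finally show ?thesis .
  qed
  moreover have Jm[measurable]: "J n \<in> borel_measurable borel" for n unfolding J_def by measurable
  moreover have "A \<longlonglongrightarrow> (LINT y|lborel. s y * (\<eta> y * of_real ((2 * pi) ^ 3)))"
    unfolding Aeq
  proof (rule integral_dominated_convergence[where w="\<lambda>y. norm (s y) * (M * (2 * pi) ^ 3)"])
    show "AE y in lborel. (\<lambda>n. s y * J n y) \<longlonglongrightarrow> s y * (\<eta> y * of_real ((2 * pi) ^ 3))"
      by (intro AE_I2 tendsto_intros Jlim)
    show "AE y in lborel. norm (s y * J n y) \<le> norm (s y) * (M * (2 * pi) ^ 3)" for n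
      unfolding norm_mult by (intro AE_I2 mult_left_mono Jb norm_ge_zero)
    show "integrable lborel (\<lambda>y. norm (s y) * (M * (2 * pi) ^ 3))" using s by simp
  qed measurable
  ultimately have "(LINT k|lborel. fourier s k * \<Phi> k) = (LINT y|lborel. s y * (\<eta> y * of_real ((2 * pi) ^ 3)))"
    by (blast intro: LIMSEQ_unique)
  then show ?thesis
    unfolding \<Phi>_def integral_mult_right_zero[symmetric] by (simp only: mult_ac)
qed

text \<open>A plane wave factors into a function of time and a spatial character. Absorbing the time
  factor into \<open>\<psi>\<close> and integrating over time turns space-time pairings into spatial
  ones, to which the Fourier pairing applies. Bounded support in time supplies the majorant for
  continuity of \<open>\<eta>\<close>.\<close>

lemma time_integral:
  fixes \<psi> :: "real \<times> (real^3) \<Rightarrow> complex"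
  assumes K': "compact K" "\<forall>X. X \<notin> K \<longrightarrow> \<psi> X = 0" and \<psi>: "continuous_on UNIV \<psi>"
  defines "\<eta> \<equiv> \<lambda>x. LINT t|lborel. \<psi> (t, x)"
  shows "continuous_on UNIV \<eta>" "integrable lborel \<eta>" "\<exists>M. \<forall>x. norm (\<eta> x) \<le> M"
    and "integrable lborel g \<Longrightarrow> integrable lborel (\<lambda>X. \<psi> X * g (snd X))"
    and "integrable lborel (\<lambda>X. \<psi> X * g (snd X)) \<Longrightarrow> (LINT X|lborel. \<psi> X * g (snd X)) = (LINT x|lborel. \<eta> x * g x)"
proof -
  have K: "compact K" "\<And>X. X \<notin> K \<Longrightarrow> \<psi> X = 0" using K' by auto
  have [measurable]: "\<psi> \<in> borel_measurable (borel \<Otimes>\<^sub>M borel)"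
    unfolding borel_prod by (rule borel_measurable_continuous_onI[OF \<psi>])
  obtain M where M: "M > 0" "\<And>X. norm (\<psi> X) \<le> M"
    by (rule compact_support_bounded[OF K \<psi>]) auto
  obtain R where R: "\<And>X. X \<in> K \<Longrightarrow> \<bar>fst X\<bar> \<le> R"
    by (rule compact_fst_bounded[OF K(1)]) auto
  define w where "w = (\<lambda>t::real. M * indicator {-R..R} t)"
  have wi: "integrable lborel w" by (simp add: w_def)
  have le: "norm (\<psi> (t, x)) \<le> w t" for t x
    using R[of "(t, x)"] K(2)[of "(t, x)"] M(1) M(2)[of "(t, x)"]
    by (cases "(t, x) \<in> K") (auto simp: w_def indicator_def abs_le_iff)
  have "isCont \<eta> x" for x
    unfolding continuous_at_sequentially o_def \<eta>_def
  proof (intro allI impI integral_dominated_convergence[where w=w] AE_I2 le wi)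
    fix X :: "nat \<Rightarrow> real^3" and t :: real assume "X \<longlonglongrightarrow> x"
    then have "(\<lambda>n. (t, X n)) \<longlonglongrightarrow> (t, x)" by (intro tendsto_intros)
    then show "(\<lambda>n. \<psi> (t, X n)) \<longlonglongrightarrow> \<psi> (t, x)"
      by (rule continuous_on_tendsto_compose[OF \<psi>]) auto
  qed measurable
  then show "continuous_on UNIV \<eta>" by (simp add: continuous_at_imp_continuous_on)
  have "integrable (lborel \<Otimes>\<^sub>M lborel) (\<lambda>(t, x). \<psi> (t, x))"
    using compact_support_integrable[OF K \<psi>] by (simp add: lborel_prod)
  from lborel_pair.integrable_snd[OF this] show "integrable lborel \<eta>" by (simp add: \<eta>_def)
  have "norm (\<eta> x) \<le> integral\<^sup>L lborel w" for x
  proof -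
    have i: "integrable lborel (\<lambda>t. norm (\<psi> (t, x)))"
      by (rule integrable_dominated[OF wi]) (auto intro!: AE_I2 order_trans[OF le abs_ge_self])
    have "norm (\<eta> x) \<le> (LINT t|lborel. norm (\<psi> (t, x)))" unfolding \<eta>_def by (rule integral_norm_bound)
    also have "\<dots> \<le> integral\<^sup>L lborel w" by (rule integral_mono[OF i wi le])
    finally show ?thesis .
  qed
  then show "\<exists>M. \<forall>x. norm (\<eta> x) \<le> M" by blast
  show "integrable lborel (\<lambda>X. \<psi> X * g (snd X))" if g: "integrable lborel g"
  proof -
    have [measurable]: "g \<in> borel_measurable borel" using g by auto
    have "integrable (lborel \<Otimes>\<^sub>M lborel) (\<lambda>(t, x). \<psi> (t, x) * g x)"
    proof (rule integrable_lborel_pair_dominated[OF _ wi integrable_norm[OF g]])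
      show "norm (\<psi> (t, x) * g x) \<le> w t * norm (g x)" for t x
        unfolding norm_mult by (intro mult_right_mono le norm_ge_zero)
    qed measurable
    then show ?thesis by (simp add: lborel_prod case_prod_unfold)
  qed
  show "(LINT X|lborel. \<psi> X * g (snd X)) = (LINT x|lborel. \<eta> x * g x)" if "integrable lborel (\<lambda>X. \<psi> X * g (snd X))"
  proof -
    have "integrable (lborel \<Otimes>\<^sub>M lborel) (\<lambda>(t, x). \<psi> (t, x) * g x)"
      using that by (simp add: lborel_prod case_prod_unfold)
    from lborel_pair.integral_snd[OF this] show ?thesis
      by (simp add: \<eta>_def lborel_prod case_prod_unfold)
  qed
qed

section \<open>The wave equation at complex and at real frequency\<close>

context radiation
begin

text \<open>The field is a superposition of plane waves with density \<open>f0\<close>. Pairing each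
  of them with \<open>W\<close> gives \<open>D k * \<Phi> k\<close>, and \<open>D k\<close> cancels
  the denominator of \<open>f0\<close>. What is left is \<open>fourier s k * \<Phi> k\<close> up to
  a constant, and the Fourier pairing returns it to \<open>s\<close>.\<close>

lemma field_wave_equation:
  assumes z: "Im z > 0" and \<phi>: "test_function \<phi>"
  shows "(LINT X|lborel. field_at v C z s (snd X) * exp (- (\<i> * z * of_real (fst X))) * wave_op (medium_form v C) \<phi> X)
    = (LINT X|lborel. s (snd X) * exp (- (\<i> * z * of_real (fst X))) * \<phi> X)"
proof -
  define K where "K = closure {X. \<phi> X \<noteq> 0}"
  note tf = test_function_partial[OF \<phi> K_def]
  define W where "W = wave_op (medium_form v C) \<phi>"
  note W0 = wave_op_test_function(1)[OF \<phi> K_def, of _ "medium_form v C", folded W_def]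
  note Wc = wave_op_test_function(2)[OF \<phi> K_def, of "medium_form v C", folded W_def]
  define E where "E = (\<lambda>X::real \<times> (real^3). exp (- (\<i> * z * of_real (fst X))))"
  have Ec: "continuous_on UNIV E" unfolding E_def by (intro continuous_intros)
  have pw: "plane_wave k z X = E X * iexp (k \<bullet> snd X)" for k X
    unfolding plane_wave_def E_def exp_add[symmetric] by (rule arg_cong[where f=exp]) (simp add: algebra_simps)
  have EWc: "continuous_on UNIV (\<lambda>X. E X * W X)" by (intro continuous_intros Ec Wc)
  have EWi: "integrable lborel (\<lambda>X. E X * W X)"
    by (rule compact_support_integrable[OF tf(1)]) (auto simp: W0 EWc)
  have EWm[measurable]: "(\<lambda>X. E X * W X) \<in> borel_measurable (borel \<Otimes>\<^sub>M borel)"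
    unfolding borel_prod by (rule borel_measurable_continuous_onI[OF EWc])
  define f0 where "f0 = field_integrand v C z s 0"
  have f0i: "integrable lborel f0" unfolding f0_def by (rule field_integrand_integrable[OF z])
  then have [measurable]: "f0 \<in> borel_measurable borel" by auto
  have fx: "field_integrand v C z s x k = f0 k * iexp (k \<bullet> x)" for x k
    by (simp add: f0_def field_integrand_def)
  define D where "D = (\<lambda>k. complex_of_real (k \<bullet> (C *v k)) - (z - of_real (v \<bullet> k))\<^sup>2)"
  have D0: "D k \<noteq> 0" for k
  proof -
    have c: "Re (- \<i> * z) > 0" using z by simp
    have "Re (reduced (- \<i> * z) k) > 0" using fourier_reduced_bound[OF c] by blast
    then have "reduced (- \<i> * z) k \<noteq> 0" by auto
    moreover have "z \<noteq> 0" using z by auto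
    ultimately show ?thesis unfolding D_def symbol_reduced[OF z] by simp
  qed
  have f0D: "f0 k * D k = fourier s k / of_real ((2 * pi) ^ 3)" for k
  proof -
    have "f0 k = fourier s k / D k / of_real ((2 * pi) ^ 3)"
      unfolding f0_def field_integrand_def D_def by simp
    then show ?thesis using D0[of k] by simp
  qed
  define \<psi> where "\<psi> = (\<lambda>X. \<phi> X * E X)"
  have psic: "continuous_on UNIV \<psi>" unfolding \<psi>_def by (intro continuous_intros Ec tf(7))
  define \<Phi> where "\<Phi> = (\<lambda>k::real^3. LINT X|lborel. \<psi> X * iexp (k \<bullet> snd X))"
  have \<Phi>: "\<Phi> k = (LINT X|lborel. \<phi> X * plane_wave k z X)" for k
    unfolding \<Phi>_def \<psi>_def pw by (simp only: mult.assoc)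
  have WD: "(LINT X|lborel. (E X * W X) * iexp (k \<bullet> snd X)) = D k * \<Phi> k" for k
    using wave_op_pairing[OF \<phi>, of v C k z] unfolding \<Phi> D_def W_def[symmetric] pw by (simp add: mult_ac)
  have key: "f0 k * (D k * \<Phi> k) = (1 / of_real ((2 * pi) ^ 3)) * (fourier s k * \<Phi> k)" for k
    using f0D[of k] by (simp add: mult.assoc[symmetric])
  \<comment> \<open>No decay estimate for \<open>\<Phi>\<close> is used:
    \<open>D k * \<Phi> k\<close> is bounded, being a transform of the integrable
    \<open>E X * W X\<close>, and \<open>f0\<close> is integrable.\<close>
  have fPi: "integrable lborel (\<lambda>k. fourier s k * \<Phi> k)"
  proof -
    define B where "B = (LINT X|lborel. norm (E X * W X))"
    have "integrable lborel (\<lambda>k. f0 k * (D k * \<Phi> k))"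
    proof (rule integrable_dominated[OF integrable_mult_left[OF integrable_norm[OF f0i], of B]])
      have "norm (D k * \<Phi> k) \<le> B" for k
      proof -
        have "norm (D k * \<Phi> k) \<le> (LINT X|lborel. norm ((E X * W X) * iexp (k \<bullet> snd X)))"
          unfolding WD[symmetric] by (rule integral_norm_bound)
        then show ?thesis by (simp add: B_def norm_mult norm_exp_eq_Re)
      qed
      then show "AE k in lborel. norm (f0 k * (D k * \<Phi> k)) \<le> norm (norm (f0 k) * B)"
        by (intro AE_I2) (auto simp: norm_mult abs_mult intro!: mult_left_mono order_trans[OF _ abs_ge_self])
      show "(\<lambda>k. f0 k * (D k * \<Phi> k)) \<in> borel_measurable lborel"
        unfolding WD[symmetric] lborel_prod[symmetric] by measurable
    qed
    from integrable_mult_right[OF this, of "of_real ((2 * pi) ^ 3)"] show ?thesis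
      unfolding key by simp
  qed
  define F where "F = (\<lambda>k X. f0 k * ((E X * W X) * iexp (k \<bullet> snd X)))"
  have "(LINT X|lborel. field_at v C z s (snd X) * E X * W X) = (LINT X|lborel. LINT k|lborel. F k X)"
    unfolding field_at_def fx F_def
    by (intro Bochner_Integration.integral_cong refl, subst mult.assoc, subst integral_mult_left_zero[symmetric])
       (simp only: mult_ac)
  also have "\<dots> = (LINT k|lborel. LINT X|lborel. F k X)"
  proof (rule Fubini_lborel_dominated[symmetric])
    show "case_prod F \<in> borel_measurable (borel \<Otimes>\<^sub>M borel)" unfolding F_def borel_prod[symmetric] by measurable
    show "norm (F k X) \<le> norm (f0 k) * norm (E X * W X)" for k X
      by (simp add: F_def norm_mult norm_exp_eq_Re)
  qed (use f0i EWi in auto)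
  also have "\<dots> = (LINT k|lborel. (1 / of_real ((2 * pi) ^ 3)) * (fourier s k * \<Phi> k))"
    unfolding F_def integral_mult_right_zero WD key ..
  also have "\<dots> = (1 / of_real ((2 * pi) ^ 3)) * (LINT k|lborel. fourier s k * \<Phi> k)"
    by (rule integral_mult_right_zero)
  also have "(LINT k|lborel. fourier s k * \<Phi> k) = of_real ((2 * pi) ^ 3) * (LINT X|lborel. s (snd X) * \<psi> X)"
  proof -
    have psi0: "\<forall>X. X \<notin> K \<longrightarrow> \<psi> X = 0" by (simp add: \<psi>_def tf(2))
    note ti = time_integral[OF tf(1) psi0 psic]
    define \<eta> where "\<eta> = (\<lambda>x. LINT t|lborel. \<psi> (t, x))"
    obtain M where M: "\<And>x. norm (\<eta> x) \<le> M" using ti(3) unfolding \<eta>_def by blast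
    have \<Phi>\<eta>: "\<Phi> k = (LINT x|lborel. \<eta> x * iexp (k \<bullet> x))" for k
      unfolding \<Phi>_def \<eta>_def
      by (intro ti(5) compact_support_integrable[OF tf(1)]) (auto simp: psi0 intro!: continuous_intros psic)
    have "(LINT k|lborel. fourier s k * \<Phi> k) = of_real ((2 * pi) ^ 3) * (LINT x|lborel. s x * \<eta> x)"
      using fourier_pairing[OF s_integrable ti(2,1)[folded \<eta>_def] M] fPi unfolding \<Phi>\<eta> by blast
    then show ?thesis using ti(5)[OF ti(4)[OF s_integrable]] by (simp add: \<eta>_def mult.commute)
  qed
  also have "(1 / of_real ((2 * pi) ^ 3)) * (of_real ((2 * pi) ^ 3) * (LINT X|lborel. s (snd X) * \<psi> X)) = (LINT X|lborel. s (snd X) * E X * \<phi> X)"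
    by (simp add: \<psi>_def mult_ac)
  finally show ?thesis unfolding E_def W_def .
qed

lemma locally_integrable_time_harmonic_bounded:
  assumes [measurable]: "f \<in> borel_measurable borel" and B: "\<And>x. norm (f x) \<le> B"
  shows "locally_integrable (time_harmonic \<omega> f)"
  unfolding locally_integrable_def
proof (intro allI impI)
  fix K :: "(real \<times> (real^3)) set" assume K: "compact K"
  have Kb: "K \<in> sets borel" using K by (simp add: compact_imp_closed borel_closed)
  then have [measurable]: "K \<in> sets (borel \<Otimes>\<^sub>M borel)" unfolding borel_prod .
  have "integrable lborel (\<lambda>X. B * indicator K X)"
    using emeasure_compact_finite[OF K]
    by (intro integrable_mult_right integrable_real_indicator) (auto simp: less_top Kb)
  then show "set_integrable lborel K (time_harmonic \<omega> f)"
    unfolding set_integrable_def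
  proof (rule integrable_dominated)
    show "AE X in lborel. norm (indicator K X *\<^sub>R time_harmonic \<omega> f X) \<le> norm (B * indicator K X)"
      using B by (intro AE_I2) (auto simp: time_harmonic_def indicator_def norm_mult norm_exp_eq_Re intro: order_trans[OF _ abs_ge_self])
    show "(\<lambda>X. indicator K X *\<^sub>R time_harmonic \<omega> f X) \<in> borel_measurable lborel"
      unfolding time_harmonic_def lborel_prod[symmetric] by measurable
  qed
qed

text \<open>The source may be unbounded, so the bound combines boundedness of \<open>K\<close> in
  time with integrability of \<open>s\<close> in space.\<close>

lemma locally_integrable_source: "locally_integrable (time_harmonic \<omega> s)"
  unfolding locally_integrable_def
proof (intro allI impI)
  fix K :: "(real \<times> (real^3)) set" assume K: "compact K"
  obtain R where R: "R > 0" "\<And>X. X \<in> K \<Longrightarrow> \<bar>fst X\<bar> \<le> R"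
    by (rule compact_fst_bounded[OF K]) auto
  have "K \<in> sets borel" using K by (simp add: compact_imp_closed borel_closed)
  then have [measurable]: "K \<in> sets (borel \<Otimes>\<^sub>M borel)" unfolding borel_prod .
  define F where "F = (\<lambda>t x. indicator K (t, x) *\<^sub>R time_harmonic \<omega> s (t, x))"
  have "integrable (lborel \<Otimes>\<^sub>M lborel) (case_prod F)"
  proof (rule integrable_lborel_pair_dominated[of _ "indicator {-R..R}" "\<lambda>x. norm (s x)"])
    show "case_prod F \<in> borel_measurable (borel \<Otimes>\<^sub>M borel)"
      unfolding F_def time_harmonic_def by measurable
    show "norm (F t x) \<le> indicator {-R..R} t * norm (s x)" for t x
      using R(2)[of "(t, x)"] by (auto simp: F_def time_harmonic_def norm_mult norm_exp_eq_Re indicator_def abs_le_iff)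
  qed (use s_integrable in auto)
  then show "set_integrable lborel K (time_harmonic \<omega> s)"
    unfolding set_integrable_def F_def by (simp add: lborel_prod case_prod_unfold)
qed

text \<open>The weak equation holds at the frequencies \<open>z n\<close>, and both sides converge.
  The time factor has modulus \<open>exp (Im z * t)\<close>, which is harmless because the test
  function has bounded support in time. On the left the field is dominated by the constant
  \<open>B\<close>, on the right the source by its own modulus.\<close>

lemma outgoing_solves_wave_eq:
  "solves_wave_eq (medium_form v C) (time_harmonic \<omega> (outgoing_field v C \<omega> s)) (time_harmonic \<omega> s)"
  unfolding solves_wave_eq_def
proof (intro conjI allI impI)
  obtain B where B: "B \<ge> 0" "\<And>x z. Im z \<ge> 0 \<Longrightarrow> norm (LINT y|lborel. s y * green z (x - y)) \<le> B"
    using green_bounded by blast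
  have om[measurable]: "outgoing_field v C \<omega> s \<in> borel_measurable borel"
    unfolding outgoing_field_green[abs_def] by measurable
  show "locally_integrable (time_harmonic \<omega> (outgoing_field v C \<omega> s))"
    by (rule locally_integrable_time_harmonic_bounded[OF om, of B]) (simp add: outgoing_field_green B(2))
  show "locally_integrable (time_harmonic \<omega> s)" by (rule locally_integrable_source)
  fix \<phi> assume \<phi>: "test_function \<phi>"
  define K where "K = closure {X. \<phi> X \<noteq> 0}"
  note tf = test_function_partial[OF \<phi> K_def]
  define W where "W = wave_op (medium_form v C) \<phi>"
  note W0 = wave_op_test_function(1)[OF \<phi> K_def, of _ "medium_form v C", folded W_def]
  note Wc = wave_op_test_function(2)[OF \<phi> K_def, of "medium_form v C", folded W_def]
  have Wi: "integrable lborel W" by (rule compact_support_integrable[OF tf(1) W0 Wc])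
  have [measurable]: "W \<in> borel_measurable (borel \<Otimes>\<^sub>M borel)" "\<phi> \<in> borel_measurable (borel \<Otimes>\<^sub>M borel)"
    unfolding borel_prod by (rule borel_measurable_continuous_onI, rule Wc tf(7))+
  obtain R where R: "R > 0" "\<And>X. X \<in> K \<Longrightarrow> \<bar>fst X\<bar> \<le> R"
    by (rule compact_fst_bounded[OF tf(1)]) auto
  obtain M where M: "M > 0" "\<And>X. norm (\<phi> X) \<le> M"
    by (rule compact_support_bounded[OF tf(1,2,7)]) auto
  \<comment> \<open>With \<open>Suc n\<close> the absorption stays in the interval from 0 (excluded)
    to 1, so \<open>exp R\<close> bounds the time factor for all \<open>n\<close>.\<close>
  define z where "z = (\<lambda>n. complex_of_real \<omega> + \<i> * of_real (1 / real (Suc n)))"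
  have zp: "Im (z n) > 0" "Im (z n) \<le> 1" for n by (simp_all add: z_def)
  have zl: "z \<longlonglongrightarrow> of_real \<omega>"
  proof -
    have "z \<longlonglongrightarrow> of_real \<omega> + \<i> * of_real 0"
      unfolding z_def by (intro tendsto_intros LIMSEQ_Suc[OF lim_1_over_n])
    then show ?thesis by simp
  qed
  define E where "E = (\<lambda>z (X::real \<times> (real^3)). exp (- (\<i> * z * of_real (fst X))))"
  have El: "(\<lambda>n. E (z n) X) \<longlonglongrightarrow> E (of_real \<omega>) X" for X
    unfolding E_def by (intro tendsto_intros zl)
  have Eb: "norm (E (z n) X) \<le> exp R" if "X \<in> K" for n X
  proof -
    have "Im (z n) * fst X \<le> \<bar>Im (z n)\<bar> * \<bar>fst X\<bar>" by (simp flip: abs_mult)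
    also have "\<dots> \<le> 1 * R" using zp[of n] R(2)[OF that] by (intro mult_mono) auto
    finally show ?thesis by (simp add: E_def norm_exp_eq_Re)
  qed
  have Em[measurable]: "E w \<in> borel_measurable (borel \<Otimes>\<^sub>M borel)" for w
    unfolding E_def by measurable
  have fm[measurable]: "field_at v C (z n) s \<in> borel_measurable borel" for n
    unfolding field_at_green[OF zp(1), abs_def] by measurable
  have fl: "(\<lambda>n. field_at v C (z n) s x) \<longlonglongrightarrow> outgoing_field v C \<omega> s x" for x
  proof -
    have "filterlim (\<lambda>n. 1 / real (Suc n)) (at_right 0) sequentially"
      unfolding filterlim_at using LIMSEQ_Suc[OF lim_1_over_n] by (auto intro!: always_eventually)
    from filterlim_compose[OF field_tendsto[of \<omega> x] this] show ?thesis
      by (simp only: z_def outgoing_field_green)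
  qed
  have fb: "norm (field_at v C (z n) s x) \<le> B" for n x
    unfolding field_at_green[OF zp(1)] using zp(1)[of n] by (intro B(2)) simp
  have "(\<lambda>n. LINT X|lborel. field_at v C (z n) s (snd X) * E (z n) X * W X)
     \<longlonglongrightarrow> (LINT X|lborel. outgoing_field v C \<omega> s (snd X) * E (of_real \<omega>) X * W X)"
  proof (rule integral_dominated_convergence[where w="\<lambda>X. (B * exp R) * norm (W X)"])
    show "AE X in lborel. (\<lambda>n. field_at v C (z n) s (snd X) * E (z n) X * W X) \<longlonglongrightarrow> outgoing_field v C \<omega> s (snd X) * E (of_real \<omega>) X * W X"
      by (intro AE_I2 tendsto_intros fl El)
    show "AE X in lborel. norm (field_at v C (z n) s (snd X) * E (z n) X * W X) \<le> (B * exp R) * norm (W X)" for n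
    proof (rule AE_I2)
      fix X
      show "norm (field_at v C (z n) s (snd X) * E (z n) X * W X) \<le> (B * exp R) * norm (W X)"
      proof (cases "X \<in> K")
        case True
        show ?thesis unfolding norm_mult using B(1) by (intro mult_mono fb Eb[OF True]) auto
      qed (simp add: W0)
    qed
    show "integrable lborel (\<lambda>X. (B * exp R) * norm (W X))" using Wi by simp
  qed (unfold lborel_prod[symmetric], measurable)
  moreover have "(\<lambda>n. LINT X|lborel. s (snd X) * E (z n) X * \<phi> X)
     \<longlonglongrightarrow> (LINT X|lborel. s (snd X) * E (of_real \<omega>) X * \<phi> X)"
  proof (rule integral_dominated_convergence[where w="\<lambda>X. (exp R * M) * (indicator {-R..R} (fst X) * norm (s (snd X)))"])
    have "integrable (lborel \<Otimes>\<^sub>M lborel) (\<lambda>(t, x). complex_of_real (indicator {-R..R} t * norm (s x)))"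
      by (rule integrable_lborel_pair_dominated[of _ "indicator {-R..R}" "\<lambda>x. norm (s x)"])
         (use s_integrable in \<open>auto simp: norm_mult indicator_def\<close>)
    then have "integrable (lborel \<Otimes>\<^sub>M lborel) (\<lambda>X. complex_of_real (indicator {-R..R} (fst X) * norm (s (snd X))))"
      by (simp add: case_prod_unfold)
    then have "integrable (lborel \<Otimes>\<^sub>M lborel) (\<lambda>X. indicator {-R..R} (fst X) * norm (s (snd X)))"
      unfolding complex_of_real_integrable_eq .
    then show "integrable lborel (\<lambda>X. (exp R * M) * (indicator {-R..R} (fst X) * norm (s (snd X))))"
      unfolding lborel_prod by (rule integrable_mult_right)
    show "AE X in lborel. (\<lambda>n. s (snd X) * E (z n) X * \<phi> X) \<longlonglongrightarrow> s (snd X) * E (of_real \<omega>) X * \<phi> X"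
      by (intro AE_I2 tendsto_intros El)
    show "AE X in lborel. norm (s (snd X) * E (z n) X * \<phi> X) \<le> (exp R * M) * (indicator {-R..R} (fst X) * norm (s (snd X)))" for n
    proof (rule AE_I2)
      fix X
      show "norm (s (snd X) * E (z n) X * \<phi> X) \<le> (exp R * M) * (indicator {-R..R} (fst X) * norm (s (snd X)))"
      proof (cases "X \<in> K")
        case True
        have "norm (E (z n) X) * norm (\<phi> X) \<le> exp R * M" by (intro mult_mono Eb[OF True] M(2)) auto
        from mult_left_mono[OF this, of "norm (s (snd X))"] show ?thesis
          using R(2)[OF True] by (simp add: norm_mult mult_ac abs_le_iff)
      qed (use M(1) in \<open>simp add: tf(2)\<close>)
    qed
  qed (unfold lborel_prod[symmetric], measurable)
  moreover have "(LINT X|lborel. field_at v C (z n) s (snd X) * E (z n) X * W X) = (LINT X|lborel. s (snd X) * E (z n) X * \<phi> X)" for n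
    unfolding E_def W_def by (rule field_wave_equation[OF zp(1) \<phi>])
  ultimately have "(LINT X|lborel. outgoing_field v C \<omega> s (snd X) * E (of_real \<omega>) X * W X) = (LINT X|lborel. s (snd X) * E (of_real \<omega>) X * \<phi> X)"
    using LIMSEQ_unique by simp
  then show "(LINT X|lborel. time_harmonic \<omega> (outgoing_field v C \<omega> s) X * wave_op (medium_form v C) \<phi> X)
      = (LINT X|lborel. time_harmonic \<omega> s X * \<phi> X)"
    by (simp add: time_harmonic_def E_def W_def)
qed

end

subsection \<open>Far field\<close>

lemma norm_exp_ii_minus_1_le: "norm (iexp t - 1) \<le> \<bar>t\<bar>"
  using iexp_approx1[of t 0] by (simp add: power2_eq_square)

context radiation
begin

abbreviation spherical :: "real^3 \<Rightarrow> real \<Rightarrow> complex \<Rightarrow> complex" where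
  "spherical n r X \<equiv> of_real \<bar>det T\<bar> * X / of_real (4 * pi * r * wnorm n)"

text \<open>\<open>L\<close> is the first-order term of the distance. The squares of
  \<open>P\<close> and of \<open>Q = r * a - L\<close> differ by \<open>(norm Y)^2 - L^2\<close>,
  with no term in \<open>r\<close>, so \<open>P - Q\<close> is this remainder divided by
  \<open>P + Q\<close>, which is at least \<open>r * a\<close>. The requirement
  \<open>2 * S \<le> r * wnorm n\<close> keeps both \<open>P\<close> and \<open>Q\<close> above
  \<open>r * a / 2\<close>.\<close>

lemma wnorm_expansion:
  assumes r: "r > 0" and S: "wnorm y \<le> S" and rS: "2 * S \<le> r * wnorm n" and n: "n \<noteq> 0"
  defines "L \<equiv> (T *v n) \<bullet> (T *v y) / wnorm n"
  shows "wnorm (r *\<^sub>R n - y) \<ge> r * wnorm n / 2" "\<bar>wnorm (r *\<^sub>R n - y) - r * wnorm n\<bar> \<le> S"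
    "\<bar>wnorm (r *\<^sub>R n - y) - (r * wnorm n - L)\<bar> \<le> S\<^sup>2 / (r * wnorm n)"
proof -
  define W where "W = T *v n"
  define Y where "Y = T *v y"
  define a where "a = wnorm n"
  have a: "a > 0" using n by (simp add: a_def wnorm_pos)
  have nW: "norm W = a" and nY: "norm Y \<le> S" using S by (simp_all add: W_def Y_def a_def wnorm_def)
  define P where "P = wnorm (r *\<^sub>R n - y)"
  define Q where "Q = r * a - L"
  have Pe: "P = norm (r *\<^sub>R W - Y)"
    by (simp add: P_def wnorm_def W_def Y_def matrix_vector_linear)
  have Le: "L = (W \<bullet> Y) / a" by (simp add: L_def W_def Y_def a_def)
  have Lb: "\<bar>L\<bar> \<le> norm Y"
    using Cauchy_Schwarz_ineq2[of W Y] a by (simp add: Le nW divide_le_eq mult.commute)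
  have nrW: "norm (r *\<^sub>R W) = r * a" using r by (simp add: nW)
  have t1: "P \<ge> r * a - norm Y" unfolding Pe nrW[symmetric] by (rule norm_triangle_ineq2)
  have t2: "P \<le> r * a + norm Y" unfolding Pe nrW[symmetric] by (rule norm_triangle_ineq4)
  have ra: "r * a > 0" using r a by simp
  have PH: "P \<ge> r * a / 2" using t1 nY rS by (simp add: a_def)
  have QH: "Q \<ge> r * a / 2" using Lb nY rS by (simp add: Q_def a_def)
  have "P\<^sup>2 = (r * a)\<^sup>2 - 2 * r * (W \<bullet> Y) + (norm Y)\<^sup>2"
  proof -
    have "P\<^sup>2 = r * r * (W \<bullet> W) - 2 * r * (W \<bullet> Y) + Y \<bullet> Y"
      unfolding Pe power2_norm_eq_inner by (simp add: inner_diff_left inner_diff_right inner_commute algebra_simps)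
    moreover have "W \<bullet> W = a\<^sup>2" using nW power2_norm_eq_inner[of W] by simp
    ultimately show ?thesis using power2_norm_eq_inner[of Y] by (simp add: power2_eq_square algebra_simps)
  qed
  moreover have "Q\<^sup>2 = (r * a)\<^sup>2 - 2 * r * (W \<bullet> Y) + L\<^sup>2"
  proof -
    have "W \<bullet> Y = a * L" using a by (simp add: Le)
    then show ?thesis by (simp add: Q_def power2_eq_square algebra_simps)
  qed
  ultimately have "(P - Q) * (P + Q) = (norm Y)\<^sup>2 - L\<^sup>2" by (simp add: power2_eq_square algebra_simps)
  then have "\<bar>P - Q\<bar> * \<bar>P + Q\<bar> = \<bar>(norm Y)\<^sup>2 - L\<^sup>2\<bar>" by (simp flip: abs_mult)
  also have "\<dots> \<le> S\<^sup>2"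
  proof -
    have "L\<^sup>2 \<le> (norm Y)\<^sup>2" using Lb by (simp add: abs_le_square_iff[symmetric])
    moreover have "(norm Y)\<^sup>2 \<le> S\<^sup>2" using nY by (intro power_mono) auto
    ultimately show ?thesis using zero_le_power2[of L] by linarith
  qed
  finally have "\<bar>P - Q\<bar> * \<bar>P + Q\<bar> \<le> S\<^sup>2" .
  moreover have "\<bar>P - Q\<bar> * (r * a) \<le> \<bar>P - Q\<bar> * \<bar>P + Q\<bar>"
    using PH QH by (intro mult_left_mono) auto
  ultimately have "\<bar>P - Q\<bar> * (r * a) \<le> S\<^sup>2" by linarith
  then show "\<bar>wnorm (r *\<^sub>R n - y) - (r * wnorm n - L)\<bar> \<le> S\<^sup>2 / (r * wnorm n)"
    using ra by (simp add: P_def Q_def a_def le_divide_eq)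
  show "wnorm (r *\<^sub>R n - y) \<ge> r * wnorm n / 2" using PH by (simp add: P_def a_def)
  show "\<bar>wnorm (r *\<^sub>R n - y) - r * wnorm n\<bar> \<le> S" using t1 t2 nY by (simp add: P_def a_def abs_le_iff)
qed

text \<open>The hypothesis on \<open>k\<close> makes it \<open>\<omega>\<close> times the gradient
  of the phase in direction \<open>n\<close>. Hence
  \<open>\<omega> * phase (r *\<^sub>R n - y)\<close> is
  \<open>(k \<bullet> n) * r - k \<bullet> y\<close> up to an error \<open>\<theta>\<close> of order
  \<open>1 / r\<close>. Multiplied by the amplitude, and together with the error of the amplitude,
  this is of order \<open>1 / r^2\<close> uniformly in \<open>y\<close>.\<close>

lemma green_far_field:
  assumes n: "n \<noteq> 0" and S: "S \<ge> 0" and \<omega>: "\<omega> \<ge> 0"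
    and k: "\<And>y. k \<bullet> y = \<omega> * (sqrt (1 + (wnorm v)\<^sup>2) * ((T *v n) \<bullet> (T *v y) / wnorm n) - (T *v v) \<bullet> (T *v y))"
  obtains D where "D \<ge> 0" "\<And>r y. \<lbrakk>r > 0; 2 * S \<le> r * wnorm n; wnorm y \<le> S\<rbrakk> \<Longrightarrow>
    norm (green (of_real \<omega>) (r *\<^sub>R n - y) - spherical n r (iexp ((k \<bullet> n) * r) * exp (- (\<i> * of_real (k \<bullet> y)))))
      \<le> D / r\<^sup>2"
proof -
  define q where "q = sqrt (1 + (wnorm v)\<^sup>2)"
  have q: "q \<ge> 0" by (simp add: q_def)
  define a where "a = wnorm n"
  have a: "a > 0" using n by (simp add: a_def wnorm_pos)
  define c where "c = \<bar>det T\<bar> / (4 * pi)"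
  have c: "c \<ge> 0" by (simp add: c_def)
  \<comment> \<open>The first term is the phase error \<open>\<omega> * q * S^2 / (r * a)\<close>
    times \<open>1 / P \<le> 2 / (r * a)\<close>. The second is the amplitude error
    \<open>\<bar>P - r * a\<bar> / (P * (r * a))\<close> with
    \<open>\<bar>P - r * a\<bar> \<le> S\<close>.\<close>
  define D where "D = c * (2 * \<omega> * q * S\<^sup>2 / a\<^sup>2 + 2 * S / a\<^sup>2)"
  have D: "D \<ge> 0" unfolding D_def using c \<omega> q S a by (intro mult_nonneg_nonneg add_nonneg_nonneg divide_nonneg_nonneg) auto
  have kn: "k \<bullet> n = \<omega> * (q * a - (T *v v) \<bullet> (T *v n))"
  proof -
    have "(T *v n) \<bullet> (T *v n) / wnorm n = a"
      using a by (simp add: a_def wnorm_def power2_norm_eq_inner[symmetric] power2_eq_square)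
    then show ?thesis by (simp add: k q_def)
  qed
  have "norm (green (of_real \<omega>) (r *\<^sub>R n - y) - spherical n r (iexp ((k \<bullet> n) * r) * exp (- (\<i> * of_real (k \<bullet> y))))) \<le> D / r\<^sup>2"
    if r: "r > 0" and rS: "2 * S \<le> r * wnorm n" and y: "wnorm y \<le> S" for r y
  proof -
    note ex = wnorm_expansion[OF r y rS n]
    define P where "P = wnorm (r *\<^sub>R n - y)"
    define L where "L = (T *v n) \<bullet> (T *v y) / wnorm n"
    define \<theta> where "\<theta> = \<omega> * q * (P - (r * a - L))"
    have ra: "r * a > 0" using r a by simp
    have P: "P \<ge> r * a / 2" using ex(1) by (simp add: P_def a_def)
    then have P0: "P > 0" using ra by linarith
    have "\<omega> * phase (r *\<^sub>R n - y) = (k \<bullet> n) * r - k \<bullet> y + \<theta>"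
      unfolding kn k[of y] L_def[symmetric] phase_def P_def[symmetric] q_def[symmetric] \<theta>_def
      by (simp add: matrix_vector_linear inner_diff_right algebra_simps)
    then have ph: "complex_of_real (\<omega> * phase (r *\<^sub>R n - y)) = of_real ((k \<bullet> n) * r - k \<bullet> y + \<theta>)"
      by (simp only:)
    have "\<i> * of_real \<omega> * of_real (phase (r *\<^sub>R n - y)) = \<i> * of_real (\<omega> * phase (r *\<^sub>R n - y))" by simp
    also have "\<dots> = \<i> * of_real ((k \<bullet> n) * r) + - (\<i> * of_real (k \<bullet> y)) + \<i> * of_real \<theta>"
      unfolding ph by (simp add: algebra_simps)
    finally have "\<i> * of_real \<omega> * of_real (phase (r *\<^sub>R n - y)) = \<i> * of_real ((k \<bullet> n) * r) + - (\<i> * of_real (k \<bullet> y)) + \<i> * of_real \<theta>" .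
    then have e: "exp (\<i> * of_real \<omega> * of_real (phase (r *\<^sub>R n - y))) = (iexp ((k \<bullet> n) * r) * exp (- (\<i> * of_real (k \<bullet> y)))) * iexp \<theta>"
      by (simp only: exp_add)
    define E where "E = iexp ((k \<bullet> n) * r) * exp (- (\<i> * of_real (k \<bullet> y)))"
    have nE: "norm E = 1" by (simp add: E_def norm_mult norm_exp_eq_Re)
    have "green (of_real \<omega>) (r *\<^sub>R n - y) - spherical n r E
      = of_real c * E * ((iexp \<theta> - 1) / of_real P + of_real (1 / P - 1 / (r * a)))"
      unfolding green_def e E_def[symmetric] P_def[symmetric] a_def[symmetric] c_def
      using P0 r a by (simp add: field_simps)
    then have "norm (green (of_real \<omega>) (r *\<^sub>R n - y) - spherical n r E)
      = c * norm ((iexp \<theta> - 1) / of_real P + of_real (1 / P - 1 / (r * a)))"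
      using c by (simp only: norm_mult nE norm_of_real abs_of_nonneg mult_1_right)
    also have "\<dots> \<le> c * (2 * \<omega> * q * S\<^sup>2 / (r * a)\<^sup>2 + 2 * S / (r * a)\<^sup>2)"
    proof (rule mult_left_mono[OF order_trans[OF norm_triangle_ineq add_mono] c])
      have inv: "1 / P \<le> 2 / (r * a)" using P P0 ra by (simp add: field_simps)
      have "norm (iexp \<theta> - 1) \<le> \<omega> * q * (S\<^sup>2 / (r * a))"
      proof -
        have "\<bar>\<theta>\<bar> = \<omega> * q * \<bar>P - (r * a - L)\<bar>" using \<omega> q by (simp add: \<theta>_def abs_mult)
        also have "\<dots> \<le> \<omega> * q * (S\<^sup>2 / (r * a))"
          using ex(3) \<omega> q by (intro mult_left_mono) (auto simp: P_def a_def L_def)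
        finally show ?thesis using norm_exp_ii_minus_1_le[of \<theta>] by linarith
      qed
      from mult_mono[OF this inv] have "norm (iexp \<theta> - 1) * (1 / P) \<le> \<omega> * q * (S\<^sup>2 / (r * a)) * (2 / (r * a))"
        using \<omega> q ra P0 by simp
      then show "norm ((iexp \<theta> - 1) / of_real P) \<le> 2 * \<omega> * q * S\<^sup>2 / (r * a)\<^sup>2"
        using P0 by (simp add: norm_divide power2_eq_square mult_ac)
      have "norm (complex_of_real (1 / P - 1 / (r * a))) = \<bar>P - r * a\<bar> * (1 / P) * (1 / (r * a))"
      proof -
        have "1 / P - 1 / (r * a) = (r * a - P) * (1 / P) * (1 / (r * a))"
          using P0 r a by (simp add: field_simps)
        then show ?thesis
          unfolding norm_of_real abs_minus_commute[of P] using P0 ra by (simp only: abs_mult) simp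
      qed
      also have "\<dots> \<le> S * (2 / (r * a)) * (1 / (r * a))"
        using ex(2) S ra P0 inv by (intro mult_mono) (auto simp: P_def a_def)
      finally show "norm (complex_of_real (1 / P - 1 / (r * a))) \<le> 2 * S / (r * a)\<^sup>2"
        by (simp add: power2_eq_square mult_ac)
    qed
    also have "\<dots> = D / r\<^sup>2" using a r by (simp add: D_def power_mult_distrib field_simps)
    finally show ?thesis unfolding E_def .
  qed
  with D show ?thesis using that by blast
qed

text \<open>The kernel bound is uniform over the support and integrates against
  \<open>norm (s y)\<close>; the factors \<open>exp (- (\<i> * of_real (k \<bullet> y)))\<close>
  collect into \<open>fourier s k\<close>.\<close>

theorem outgoing_far_field:
  assumes n: "n \<noteq> 0" and \<omega>: "\<omega> \<ge> 0"
    and k: "\<And>y. k \<bullet> y = \<omega> * (sqrt (1 + (wnorm v)\<^sup>2) * ((T *v n) \<bullet> (T *v y) / wnorm n) - (T *v v) \<bullet> (T *v y))"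
  shows "(\<lambda>r::real. outgoing_field v C \<omega> s (r *\<^sub>R n)
      - spherical n r (fourier s k * iexp ((k \<bullet> n) * r)))
    \<in> O[at_top](\<lambda>r. of_real (1 / r\<^sup>2))"
proof -
  have "bounded (wnorm ` supp)"
    unfolding wnorm_def by (intro compact_imp_bounded compact_continuous_image continuous_intros supp(1))
  then obtain S where S: "S > 0" "\<And>y. y \<in> supp \<Longrightarrow> wnorm y \<le> S"
    by (force simp: bounded_pos)
  obtain D where D: "D \<ge> 0" "\<And>r y. \<lbrakk>r > 0; 2 * S \<le> r * wnorm n; wnorm y \<le> S\<rbrakk> \<Longrightarrow>
    norm (green (of_real \<omega>) (r *\<^sub>R n - y) - spherical n r (iexp ((k \<bullet> n) * r) * exp (- (\<i> * of_real (k \<bullet> y)))))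
      \<le> D / r\<^sup>2"
    using green_far_field[OF n less_imp_le[OF S(1)] \<omega> k] by blast
  have a: "wnorm n > 0" using n by (rule wnorm_pos)
  define I where "I = (LINT y|lborel. norm (s y))"
  have bound: "norm (outgoing_field v C \<omega> s (r *\<^sub>R n)
      - spherical n r (fourier s k * iexp ((k \<bullet> n) * r))) \<le> (D * I) * (1 / r\<^sup>2)"
    if r: "r > 0" "2 * S / wnorm n \<le> r" for r
  proof -
    have rS: "2 * S \<le> r * wnorm n" using r(2) a by (simp add: divide_le_eq)
    define c where "c = of_real \<bar>det T\<bar> * iexp ((k \<bullet> n) * r) / complex_of_real (4 * pi * r * wnorm n)"
    define g where "g = (\<lambda>y. c * exp (- (\<i> * of_real (k \<bullet> y))))"
    have gi: "integrable lborel (\<lambda>y. s y * g y)"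
    proof (rule integrable_dominated[OF integrable_mult_right[OF integrable_norm[OF s_integrable], of "norm c"]])
      show "AE y in lborel. norm (s y * g y) \<le> norm (norm c * norm (s y))"
        by (intro AE_I2) (simp add: g_def norm_mult norm_exp_eq_Re)
    qed (unfold g_def, measurable)
    have "spherical n r (fourier s k * iexp ((k \<bullet> n) * r)) = c * fourier s k"
      by (simp add: c_def)
    also have "\<dots> = (LINT y|lborel. s y * g y)"
      unfolding fourier_def integral_mult_right_zero[symmetric] g_def by (simp only: mult_ac)
    finally have F: "spherical n r (fourier s k * iexp ((k \<bullet> n) * r)) = (LINT y|lborel. s y * g y)" .
    have ri: "integrable lborel (\<lambda>y. s y * green (of_real \<omega>) (r *\<^sub>R n - y))" by (rule green_integrable) simp
    have "norm (outgoing_field v C \<omega> s (r *\<^sub>R n) - (LINT y|lborel. s y * g y))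
      = norm (LINT y|lborel. s y * green (of_real \<omega>) (r *\<^sub>R n - y) - s y * g y)"
      unfolding outgoing_field_green by (subst Bochner_Integration.integral_diff[OF ri gi]) simp
    also have "\<dots> \<le> (LINT y|lborel. norm (s y * green (of_real \<omega>) (r *\<^sub>R n - y) - s y * g y))"
      by (rule integral_norm_bound)
    also have "\<dots> \<le> (LINT y|lborel. (D / r\<^sup>2) * norm (s y))"
    proof (rule integral_mono)
      show "norm (s y * green (of_real \<omega>) (r *\<^sub>R n - y) - s y * g y) \<le> (D / r\<^sup>2) * norm (s y)" for y
      proof (cases "s y = 0")
        case False
        then have "wnorm y \<le> S" using S(2) supp(2) by blast
        from D(2)[OF r(1) rS this] have "norm (green (of_real \<omega>) (r *\<^sub>R n - y) - g y) \<le> D / r\<^sup>2"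
          by (simp add: g_def c_def mult_ac)
        from mult_left_mono[OF this, of "norm (s y)"] show ?thesis
          unfolding right_diff_distrib[symmetric] norm_mult by (simp add: mult.commute)
      qed simp
    qed (use s_integrable ri gi in auto)
    also have "\<dots> = (D * I) * (1 / r\<^sup>2)" by (simp add: I_def)
    finally show ?thesis unfolding F .
  qed
  show ?thesis
  proof (rule bigoI)
    show "\<forall>\<^sub>F r in at_top. norm (outgoing_field v C \<omega> s (r *\<^sub>R n)
      - spherical n r (fourier s k * iexp ((k \<bullet> n) * r))) \<le> (D * I) * norm (complex_of_real (1 / r\<^sup>2))"
      using eventually_gt_at_top[of 0] eventually_ge_at_top[of "2 * S / wnorm n"]
    proof eventually_elim
      case (elim r)
      then show ?case using bound[of r] by (simp only: norm_of_real) simp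
    qed
  qed
qed

end

subsection \<open>The sonic ellipsoid\<close>

lemma medium_matrix_mult: "C *v k = medium_matrix v C *v k + (v \<bullet> k) *\<^sub>R v"
  by (simp add: vec_eq_iff medium_matrix_def columnvector_def rowvector_def matrix_matrix_mult_def
      matrix_vector_mult_def inner_vec_def sum_3 algebra_simps)

text \<open>The ellipsoid is the square of the second description. If
  \<open>\<omega> \<le> v \<bullet> k\<close> held on it, the form \<open>a\<close> would be at most
  \<open>- (\<omega>^2)\<close>, against positivity; so the whole ellipsoid lies on the branch with
  the positive root.\<close>

lemma sonic_ellipsoid_iff:
  assumes pd: "pos_def (medium_matrix v C)" and \<omega>: "\<omega> > 0"
  shows "k \<in> sonic_ellipsoid v C \<omega> \<longleftrightarrow> \<omega> - v \<bullet> k = sqrt (k \<bullet> (C *v k))"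
    and "k \<in> sonic_ellipsoid v C \<omega> \<Longrightarrow> \<omega> - v \<bullet> k > 0"
proof -
  define a where "a = k \<bullet> (medium_matrix v C *v k)"
  have a: "a \<ge> 0" "a = 0 \<Longrightarrow> k = 0"
    using pd unfolding pos_def_def a_def by (metis inner_zero_left less_eq_real_def order_refl, metis less_irrefl)
  have kC: "k \<bullet> (C *v k) = a + (v \<bullet> k)\<^sup>2" unfolding a_def by (rule medium_matrix_form)
  have mem: "k \<in> sonic_ellipsoid v C \<omega> \<longleftrightarrow> a + 2 * \<omega> * (v \<bullet> k) = \<omega>\<^sup>2"
    by (simp add: sonic_ellipsoid_def a_def)
  have pos: "\<omega> - v \<bullet> k > 0" if "k \<in> sonic_ellipsoid v C \<omega>"
  proof (rule ccontr)
    assume "\<not> ?thesis"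
    then have "\<omega> * \<omega> \<le> \<omega> * (v \<bullet> k)" using \<omega> by simp
    moreover have "a = \<omega> * \<omega> - 2 * (\<omega> * (v \<bullet> k))" using that mem by (simp add: power2_eq_square)
    moreover have "\<omega> * \<omega> > 0" using \<omega> by simp
    ultimately show False using a(1) by linarith
  qed
  show "k \<in> sonic_ellipsoid v C \<omega> \<Longrightarrow> \<omega> - v \<bullet> k > 0" by (rule pos)
  have sq: "k \<in> sonic_ellipsoid v C \<omega> \<longleftrightarrow> (\<omega> - v \<bullet> k)\<^sup>2 = k \<bullet> (C *v k)"
    unfolding mem kC by (auto simp: power2_diff)
  show "k \<in> sonic_ellipsoid v C \<omega> \<longleftrightarrow> \<omega> - v \<bullet> k = sqrt (k \<bullet> (C *v k))"
  proof
    assume k: "k \<in> sonic_ellipsoid v C \<omega>"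
    then show "\<omega> - v \<bullet> k = sqrt (k \<bullet> (C *v k))"
      using sq pos[OF k] by (metis less_imp_le real_sqrt_unique)
  next
    assume "\<omega> - v \<bullet> k = sqrt (k \<bullet> (C *v k))"
    moreover have "k \<bullet> (C *v k) \<ge> 0" unfolding kC using a(1) by simp
    ultimately show "k \<in> sonic_ellipsoid v C \<omega>" using sq by simp
  qed
qed

lemma group_velocity_on_ellipsoid:
  assumes "pos_def (medium_matrix v C)" "\<omega> > 0" "k \<in> sonic_ellipsoid v C \<omega>"
  shows "group_velocity v C k = (1 / (\<omega> - v \<bullet> k)) *\<^sub>R (medium_matrix v C *v k + \<omega> *\<^sub>R v)"
proof -
  define d where "d = \<omega> - v \<bullet> k"
  have d: "d > 0" "sqrt (k \<bullet> (C *v k)) = d"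
    using sonic_ellipsoid_iff[OF assms(1,2), of k] assms(3) by (auto simp: d_def)
  have "medium_matrix v C *v k + \<omega> *\<^sub>R v = C *v k + d *\<^sub>R v"
    unfolding medium_matrix_mult[of C k v] by (simp add: d_def algebra_simps)
  then show ?thesis
    unfolding group_velocity_def d(2) d_def[symmetric] using d(1) by (simp add: scaleR_add_right)
qed

text \<open>Since \<open>LINT\<close> and \<open>Lim\<close> are total, the formula for the outgoing
  field is meaningful only together with convergence of the integrals and existence of the limit.
  Both are therefore conjuncts, at every point, and so is the wave equation; square integrability of
  the source secures them. The characterisation of \<open>kstar\<close> is an equivalence, so that
  it contains existence as well as uniqueness.\<close>

theorem lemma37:
  fixes v n \<nu> kstar :: "real^3" and C A :: "real^3^3" and p \<omega> \<mu> :: real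
    and s :: "real^3 \<Rightarrow> complex"
  assumes "admissible v C"
    and "A = medium_matrix v C"
    and "p = (1 + v \<bullet> (matrix_inv A *v v)) powr (- 1 / 2)"
    and "\<omega> > 0"
    and "s \<in> borel_measurable lborel"
    and "integrable lborel (\<lambda>x. (norm (s x))\<^sup>2)"
    and "compact (closure {x. s x \<noteq> 0})"
    and "norm n = 1"
    and "\<nu> = (1 / sqrt (n \<bullet> (matrix_inv A *v n))) *\<^sub>R n"
    and "kstar = \<omega> *\<^sub>R (matrix_inv A *v ((1 / p) *\<^sub>R \<nu> - v))"
    and "\<mu> = 1 / p - v \<bullet> (matrix_inv A *v \<nu>)"
  shows
    "(\<forall>x. \<forall>\<epsilon>>0. integrable lborel (field_integrand v C (of_real \<omega> + \<i> * of_real \<epsilon>) s x)) \<and>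
     (\<forall>x. ((\<lambda>\<epsilon>::real. field_at v C (of_real \<omega> + \<i> * of_real \<epsilon>) s x)
             \<longlongrightarrow> outgoing_field v C \<omega> s x) (at_right 0)) \<and>
     solves_wave_eq (medium_form v C)
       (time_harmonic \<omega> (outgoing_field v C \<omega> s)) (time_harmonic \<omega> s) \<and>
     kstar \<bullet> n = \<omega> * (sqrt (n \<bullet> (matrix_inv A *v n)) / p - v \<bullet> (matrix_inv A *v n)) \<and>
     (\<lambda>r::real. outgoing_field v C \<omega> s (r *\<^sub>R n)
          - fourier s kstar * exp (\<i> * of_real ((kstar \<bullet> n) * r))
            / of_real (4 * pi * r * sqrt (det A) * sqrt (n \<bullet> (matrix_inv A *v n))))
        \<in> O[at_top](\<lambda>r. of_real (1 / r\<^sup>2)) \<and>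
     (\<forall>k. k \<in> sonic_ellipsoid v C \<omega> \<longleftrightarrow> \<omega> - v \<bullet> k = sqrt (k \<bullet> (C *v k))) \<and>
     (\<forall>k. k \<in> sonic_ellipsoid v C \<omega> \<and> (\<exists>c>0. group_velocity v C k = c *\<^sub>R n) \<longleftrightarrow> k = kstar) \<and>
     \<mu> > 0 \<and>
     norm (group_velocity v C kstar) = 1 / (sqrt (n \<bullet> (matrix_inv A *v n)) * \<mu>)"
proof -
  note \<omega> = \<open>\<omega> > 0\<close>
  have pd: "pos_def A" "pos_def (medium_matrix v C)" using assms(1,2) by (simp_all add: admissible_def)
  obtain T :: "real^3^3" where T: "det T \<noteq> 0" "det A > 0" "\<bar>det T\<bar> = 1 / sqrt (det A)" "A ** matrix_inv A = mat 1"
    "\<And>x y. x \<bullet> (matrix_inv A *v y) = (T *v x) \<bullet> (T *v y)"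
    "\<And>x y. (transpose T *v x) \<bullet> (A *v (transpose T *v y)) = x \<bullet> y"
    using pos_def_factor_inverse[OF pd(1)] by metis
  interpret radiation v C T s
    by unfold_locales (use T assms in auto)
  define Ai where "Ai = matrix_inv A"
  have AAi: "A *v (Ai *v x) = x" for x
    using T(4) by (simp add: Ai_def matrix_vector_mul_assoc)
  have AiA: "Ai *v (A *v x) = x" for x
    using T(4) matrix_left_right_inverse[of A "matrix_inv A"] by (simp add: Ai_def matrix_vector_mul_assoc)
  have sym: "x \<bullet> (Ai *v y) = y \<bullet> (Ai *v x)" for x y unfolding Ai_def T(5) by (rule inner_commute)
  have n0: "n \<noteq> 0" using \<open>norm n = 1\<close> by auto
  define N where "N = sqrt (n \<bullet> (Ai *v n))"
  have Nn: "N = wnorm n" by (simp add: N_def Ai_def T(5) wnorm_def norm_eq_sqrt_inner)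
  have N: "N > 0" using n0 by (simp add: Nn wnorm_pos)
  have N2: "n \<bullet> (Ai *v n) = N\<^sup>2" by (simp add: Nn Ai_def T(5) wnorm_def power2_norm_eq_inner)
  define b where "b = v \<bullet> (Ai *v v)"
  have bn: "b = (wnorm v)\<^sup>2" by (simp add: b_def Ai_def T(5) wnorm_def power2_norm_eq_inner)
  then have b: "b \<ge> 0" by simp
  define q where "q = sqrt (1 + b)"
  have q: "q > 0" "q\<^sup>2 = 1 + b" using b by (simp_all add: q_def add_pos_nonneg)
  have pq: "1 / p = q"
  proof -
    have e: "- 1 / 2 = - (1 / 2 :: real)" by simp
    have "p = inverse q"
      unfolding assms(3) Ai_def[symmetric] b_def[symmetric] e powr_minus q_def using b by (simp add: powr_half_sqrt)
    then show ?thesis by (simp add: divide_inverse)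
  qed
  have \<nu>: "\<nu> = (1 / N) *\<^sub>R n" using assms(9) by (simp add: N_def Ai_def)
  have ks: "kstar = \<omega> *\<^sub>R (Ai *v (q *\<^sub>R \<nu> - v))" using assms(10) by (simp add: pq Ai_def)
  have mu: "\<mu> = q - v \<bullet> (Ai *v \<nu>)" using assms(11) by (simp add: pq Ai_def)
  define m where "m = v \<bullet> (Ai *v n)"
  \<comment> \<open>\<open>A *v k + \<omega> *\<^sub>R v\<close> is half the gradient of the
    quadratic function that defines the ellipsoid, so the normal at \<open>kstar\<close> points
    along \<open>n\<close>.\<close>
  have Aks: "A *v kstar + \<omega> *\<^sub>R v = (\<omega> * q / N) *\<^sub>R n"
    unfolding ks matrix_vector_mult_scaleR AAi by (simp add: \<nu> scaleR_diff_right)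
  have ks': "kstar = Ai *v ((\<omega> * q / N) *\<^sub>R n - \<omega> *\<^sub>R v)"
    using AiA[of kstar] Aks by (metis add_diff_cancel_right')
  \<comment> \<open>Vectors at which this gradient is \<open>c\<close> times \<open>n\<close>, up to
    the factor 2, have the form assumed for \<open>k\<close>. For them membership in the ellipsoid
    becomes \<open>c^2 * N^2 = \<omega>^2 * (1 + b)\<close>, whose only positive solution is
    \<open>c = \<omega> * q / N\<close>.\<close>
  have mem_eq: "k \<bullet> (A *v k) + 2 * \<omega> * (v \<bullet> k) = c\<^sup>2 * N\<^sup>2 - \<omega>\<^sup>2 * b" if k: "k = Ai *v (c *\<^sub>R n - \<omega> *\<^sub>R v)" for k c
  proof -
    have "A *v k = c *\<^sub>R n - \<omega> *\<^sub>R v" unfolding k by (rule AAi)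
    then have "k \<bullet> (A *v k) + 2 * \<omega> * (v \<bullet> k) = (c *\<^sub>R n + \<omega> *\<^sub>R v) \<bullet> k"
      by (simp add: inner_diff_right inner_add_right inner_commute)
    also have "\<dots> = c\<^sup>2 * N\<^sup>2 - \<omega>\<^sup>2 * b"
      unfolding k
      by (simp add: matrix_vector_linear inner_diff_right inner_add_left
          N2 b_def[symmetric] sym[of n v] power2_eq_square algebra_simps)
    finally show ?thesis .
  qed
  have in_iff: "k \<in> sonic_ellipsoid v C \<omega> \<longleftrightarrow> k \<bullet> (A *v k) + 2 * \<omega> * (v \<bullet> k) = \<omega>\<^sup>2" for k
    by (simp add: sonic_ellipsoid_def assms(2))
  have ksE: "kstar \<in> sonic_ellipsoid v C \<omega>"
  proof -
    have "(\<omega> * q / N)\<^sup>2 * N\<^sup>2 = \<omega>\<^sup>2 * (1 + b)" using N q(2) by (simp add: power_divide power_mult_distrib)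
    then show ?thesis unfolding in_iff mem_eq[OF ks'] by (simp add: algebra_simps)
  qed
  \<comment> \<open>Rests on \<open>q^2 = 1 + b\<close>. The left side is positive on the ellipsoid,
    which yields \<open>\<mu> > 0\<close>; dividing the normal by it gives the group velocity
    \<open>(1 / (N * \<mu>)) *\<^sub>R n\<close>.\<close>
  have wk: "\<omega> - v \<bullet> kstar = \<omega> * q * \<mu>"
  proof -
    have "v \<bullet> kstar = \<omega> * (q * (v \<bullet> (Ai *v \<nu>)) - b)"
      unfolding ks by (simp add: matrix_vector_linear inner_diff_right b_def)
    then have "\<omega> - v \<bullet> kstar = \<omega> * ((1 + b) - q * (v \<bullet> (Ai *v \<nu>)))" by (simp add: algebra_simps)
    then show ?thesis by (simp add: q(2)[symmetric] mu power2_eq_square algebra_simps)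
  qed
  have mu0: "\<mu> > 0"
    using sonic_ellipsoid_iff(2)[OF pd(2) \<omega> ksE] mult_pos_pos[OF \<omega> q(1)]
    unfolding wk by (rule zero_less_mult_pos)
  have gk: "group_velocity v C kstar = (1 / (N * \<mu>)) *\<^sub>R n"
    unfolding group_velocity_on_ellipsoid[OF pd(2) \<omega> ksE] assms(2)[symmetric] Aks wk
    using \<omega> q(1) by simp
  have uniq: "k = kstar" if k: "k \<in> sonic_ellipsoid v C \<omega>" and c: "c > 0" "group_velocity v C k = c *\<^sub>R n" for k c
  proof -
    have d: "\<omega> - v \<bullet> k > 0" by (rule sonic_ellipsoid_iff(2)[OF pd(2) \<omega> k])
    \<comment> \<open>Both factors are positive. The sign of \<open>c'\<close> excludes the second
      root \<open>- \<omega> * q / N\<close>, which belongs to the point whose group velocity points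
      along \<open>- n\<close>.\<close>
    define c' where "c' = c * (\<omega> - v \<bullet> k)"
    have c': "c' > 0" using c(1) d by (simp add: c'_def)
    have "(\<omega> - v \<bullet> k) *\<^sub>R group_velocity v C k = A *v k + \<omega> *\<^sub>R v"
      unfolding group_velocity_on_ellipsoid[OF pd(2) \<omega> k] assms(2)[symmetric] using d by simp
    then have "A *v k + \<omega> *\<^sub>R v = c' *\<^sub>R n" unfolding c(2) by (simp add: c'_def mult.commute)
    then have "A *v k = c' *\<^sub>R n - \<omega> *\<^sub>R v" by (simp add: algebra_simps)
    then have kk: "k = Ai *v (c' *\<^sub>R n - \<omega> *\<^sub>R v)" using AiA[of k] by simp
    have "c'\<^sup>2 * N\<^sup>2 - \<omega>\<^sup>2 * b = \<omega>\<^sup>2" using k unfolding in_iff mem_eq[OF kk] .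
    then have "(c' * N)\<^sup>2 = (\<omega> * q)\<^sup>2" by (simp add: power_mult_distrib q(2) algebra_simps)
    then have "c' * N = \<omega> * q" using c' N \<omega> q(1) by (simp add: power2_eq_iff_nonneg)
    then have "c' = \<omega> * q / N" using N by (simp add: eq_divide_eq)
    then show ?thesis using kk ks' by simp
  qed
  have kdot: "kstar \<bullet> y = \<omega> * (sqrt (1 + (wnorm v)\<^sup>2) * ((T *v n) \<bullet> (T *v y) / wnorm n) - (T *v v) \<bullet> (T *v y))" for y
  proof -
    have "kstar \<bullet> y = \<omega> * (y \<bullet> (Ai *v (q *\<^sub>R \<nu> - v)))" by (simp add: ks inner_commute)
    also have "\<dots> = \<omega> * (q / N * (y \<bullet> (Ai *v n)) - y \<bullet> (Ai *v v))"
      by (simp add: \<nu> matrix_vector_linear inner_diff_right)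
    also have "\<dots> = \<omega> * (q / N * ((T *v n) \<bullet> (T *v y)) - (T *v v) \<bullet> (T *v y))"
      by (simp add: Ai_def T(5) inner_commute)
    finally show ?thesis by (simp add: q_def bn Nn)
  qed
  have kn: "kstar \<bullet> n = \<omega> * (N / p - v \<bullet> (Ai *v n))"
  proof -
    have "kstar \<bullet> n = \<omega> * (n \<bullet> (Ai *v (q *\<^sub>R \<nu> - v)))" by (simp add: ks inner_commute)
    also have "\<dots> = \<omega> * (q * N - v \<bullet> (Ai *v n))"
      using N by (simp add: \<nu> matrix_vector_linear inner_diff_right N2 sym[of n v] power2_eq_square)
    finally show ?thesis using pq by (simp add: divide_inverse mult.commute)
  qed
  have far: "(\<lambda>r::real. outgoing_field v C \<omega> s (r *\<^sub>R n)
          - fourier s kstar * iexp ((kstar \<bullet> n) * r) / of_real (4 * pi * r * sqrt (det A) * N))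
        \<in> O[at_top](\<lambda>r. of_real (1 / r\<^sup>2))"
  proof -
    have "of_real \<bar>det T\<bar> * X / of_real (4 * pi * r * wnorm n) = X / complex_of_real (4 * pi * r * sqrt (det A) * N)" for X r
      unfolding T(3) Nn by simp
    with outgoing_far_field[OF n0 less_imp_le[OF \<omega>] kdot] show ?thesis by simp
  qed
  have gv: "norm (group_velocity v C kstar) = 1 / (N * \<mu>)"
    unfolding gk using N mu0 \<open>norm n = 1\<close> by simp
  have char: "k \<in> sonic_ellipsoid v C \<omega> \<and> (\<exists>c>0. group_velocity v C k = c *\<^sub>R n) \<longleftrightarrow> k = kstar" for k
  proof
    assume "k = kstar"
    moreover have "1 / (N * \<mu>) > 0" using N mu0 by simp
    ultimately show "k \<in> sonic_ellipsoid v C \<omega> \<and> (\<exists>c>0. group_velocity v C k = c *\<^sub>R n)"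
      using ksE gk by blast
  qed (use uniq in blast)
  have lim: "((\<lambda>\<epsilon>::real. field_at v C (of_real \<omega> + \<i> * of_real \<epsilon>) s x) \<longlongrightarrow> outgoing_field v C \<omega> s x) (at_right 0)" for x
    unfolding outgoing_field_green by (rule field_tendsto)
  show ?thesis
    unfolding Ai_def[symmetric] N_def[symmetric]
    using field_integrand_integrable lim outgoing_solves_wave_eq kn far sonic_ellipsoid_iff(1)[OF pd(2) \<omega>] char mu0 gv
    by simp
qed

end
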